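(* Let $k\ge 2$ be a constant. If any of #F$k$-OV, #F$k$-SUM, or #F$k$-XOR can be solved in $T(n)$ time then all of #F$k$-OV, #F$k$-SUM, and #F$k$-XOR can be solved in $\tilde{O}(T(n))$ time.
   Context: $g=o(\lg n/\lg\lg n)$, $b=o(\lg n)$. A $(g,b)$-factored vector $v$ is a $g$-tuple of sets $v[i]\subseteq\{0,1\}^b$. For $f:(\{0,1\}^b)^k\to\{0,1\}$, #F$k$-$f$: given $k$ sets $V_1,\dots,V_k$ of $n$ factored vectors each, output $\sum_{v_1\in V_1,\dots,v_k\in V_k}\prod_{i=1}^g\sum_{w_1\in v_1[i],\dots,w_k\in v_k[i]}f(w_1,\dots,w_k)$. #F$k$-OV: $f=1$ iff $\sum_{a=1}^b\prod_j w_j[a]=0$. #F$k$-XOR: $f=1$ iff $w_1\oplus\cdots\oplus w_k=\vec 0$. #F$k$-SUM: $f=1$ iff $w_1+\cdots+w_k=0$ as $b$-bit numbers. (Reductions may change $b$ by a constant factor.) *)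

theory Defs
  imports Complex_Main "HOL-Library.Landau_Symbols"
begin

section \<open>Word RAM\<close>

text \<open>
  Unit-cost word RAM with word length \<open>w\<close>: registers and memory cells hold \<open>w\<close>-bit words, memory is
  addressed by words, and all arithmetic is modulo \<open>2 ^ w\<close>.  Control flow is structured, which
  changes running times by at most a constant factor (depending on the program) compared to jumps.
\<close>

datatype binop = Add | Sub | Mul | Div | Mod | And | Or | Xor | Shl | Shr | Less | Eq

primrec binop_val :: "nat \<Rightarrow> binop \<Rightarrow> nat \<Rightarrow> nat \<Rightarrow> nat" where
  "binop_val w Add x y = (x + y) mod 2 ^ w"
| "binop_val w Sub x y = (x + (2 ^ w - y)) mod 2 ^ w"
| "binop_val w Mul x y = (x * y) mod 2 ^ w"
| "binop_val w Div x y = x div y"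
| "binop_val w Mod x y = x mod y"
| "binop_val w And x y = and x y"
| "binop_val w Or x y = or x y"
| "binop_val w Xor x y = xor x y"
| "binop_val w Shl x y = (x * 2 ^ y) mod 2 ^ w"
| "binop_val w Shr x y = x div 2 ^ y"
| "binop_val w Less x y = of_bool (x < y)"
| "binop_val w Eq x y = of_bool (x = y)"

text \<open>The output is a separate write-only sequence of words, so that every word of output costs time.\<close>

record ram_state =
  regs :: "nat \<Rightarrow> nat"
  mem :: "nat \<Rightarrow> nat"
  outs :: "nat list"

datatype ram_prog =
    Skip
  | Const nat nat
  | BinOp binop nat nat nat
  | Load nat nat
  | Store nat nat
  | Output nat
  | Seq ram_prog ram_prog
  | Cond nat ram_prog ram_prog
  | While nat ram_prog

text \<open>\<open>exec w P s t s'\<close>: with word length \<open>w\<close>, started in \<open>s\<close>, \<open>P\<close> halts in \<open>s'\<close> after \<open>t\<close> steps.\<close>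

inductive exec :: "nat \<Rightarrow> ram_prog \<Rightarrow> ram_state \<Rightarrow> nat \<Rightarrow> ram_state \<Rightarrow> bool" for w :: nat where
  Skip: "exec w Skip s 1 s"
| Const: "exec w (Const r c) s 1 (s\<lparr>regs := (regs s)(r := c mod 2 ^ w)\<rparr>)"
| BinOp: "exec w (BinOp p r x y) s 1
            (s\<lparr>regs := (regs s)(r := binop_val w p (regs s x) (regs s y))\<rparr>)"
| Load: "exec w (Load r a) s 1 (s\<lparr>regs := (regs s)(r := mem s (regs s a))\<rparr>)"
| Store: "exec w (Store a r) s 1 (s\<lparr>mem := (mem s)(regs s a := regs s r)\<rparr>)"
| Output: "exec w (Output r) s 1 (s\<lparr>outs := outs s @ [regs s r]\<rparr>)"
| Seq: "exec w P s t s' \<Longrightarrow> exec w Q s' u s'' \<Longrightarrow> exec w (Seq P Q) s (t + u) s''"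
| CondTrue: "regs s r \<noteq> 0 \<Longrightarrow> exec w P s t s' \<Longrightarrow> exec w (Cond r P Q) s (t + 1) s'"
| CondFalse: "regs s r = 0 \<Longrightarrow> exec w Q s t s' \<Longrightarrow> exec w (Cond r P Q) s (t + 1) s'"
| WhileFalse: "regs s r = 0 \<Longrightarrow> exec w (While r P) s 1 s"
| WhileTrue: "regs s r \<noteq> 0 \<Longrightarrow> exec w P s t s' \<Longrightarrow> exec w (While r P) s' u s'' \<Longrightarrow>
    exec w (While r P) s (t + u + 1) s''"

definition init_state :: "nat \<Rightarrow> nat list \<Rightarrow> ram_state" where
  "init_state w xs =
     \<lparr>regs = (\<lambda>_. 0), mem = (\<lambda>i. if i < length xs then xs ! i mod 2 ^ w else 0), outs = []\<rparr>"

text \<open>The answer may exceed a single word; it is output in base \<open>2 ^ w\<close>, least significant word first.\<close>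

definition computes_within :: "nat \<Rightarrow> ram_prog \<Rightarrow> nat list \<Rightarrow> nat \<Rightarrow> nat \<Rightarrow> bool" where
  "computes_within w P xs y t \<longleftrightarrow>
     (\<exists>t' s. exec w P (init_state w xs) t' s \<and> t' \<le> t \<and> horner_sum (\<lambda>x. x) (2 ^ w) (outs s) = y)"

section \<open>Factored problems\<close>

type_synonym bitvec = "bool list"
type_synonym fvec = "bitvec set list"

definition factored_vectors :: "nat \<Rightarrow> nat \<Rightarrow> fvec set" where
  "factored_vectors g b = {v. length v = g \<and> (\<forall>S\<in>set v. S \<subseteq> {w. length w = b})}"

definition factored_instance :: "nat \<Rightarrow> nat \<Rightarrow> nat \<Rightarrow> nat \<Rightarrow> fvec set list \<Rightarrow> bool" where
  "factored_instance k n g b V \<longleftrightarrow>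
     length V = k \<and> (\<forall>U\<in>set V. U \<subseteq> factored_vectors g b \<and> finite U \<and> card U = n)"

text \<open>\<open>listset [A\<^sub>1, \<dots>, A\<^sub>k]\<close> is the Cartesian product of the sets, as a set of lists.\<close>

definition factored_count :: "(bitvec list \<Rightarrow> bool) \<Rightarrow> nat \<Rightarrow> fvec set list \<Rightarrow> nat" where
  "factored_count f g V =
     (\<Sum>vs\<in>listset V. \<Prod>i<g. \<Sum>ws\<in>listset (map (\<lambda>v. v ! i) vs). of_bool (f ws))"

definition ov_pred :: "nat \<Rightarrow> bitvec list \<Rightarrow> bool" where
  "ov_pred b ws \<longleftrightarrow> (\<Sum>a<b. \<Prod>j<length ws. of_bool (ws ! j ! a)) = (0::nat)"

definition xor_pred :: "nat \<Rightarrow> bitvec list \<Rightarrow> bool" where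
  "xor_pred b ws \<longleftrightarrow> foldr (map2 (\<noteq>)) ws (replicate b False) = replicate b False"

text \<open>
  Addition of \<open>b\<close>-bit numbers is modulo \<open>2 ^ b\<close>; over the natural numbers the sum would vanish only
  if all summands do.
\<close>

definition sum_pred :: "nat \<Rightarrow> bitvec list \<Rightarrow> bool" where
  "sum_pred b ws \<longleftrightarrow> (\<Sum>w\<leftarrow>ws. horner_sum of_bool 2 w) mod 2 ^ b = (0::nat)"

section \<open>Representation of instances in memory\<close>

text \<open>
  All sets are given by duplicate-free lists in arbitrary order.  An instance is laid out as
  \<open>n, g, b\<close> followed by all sets \<open>v[i]\<close> in sequence, each as its cardinality followed by its
  elements, one word per bit vector.
\<close>

definition lists_fvec :: "bitvec list list \<Rightarrow> fvec \<Rightarrow> bool" where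
  "lists_fvec xss v \<longleftrightarrow> (\<forall>xs\<in>set xss. distinct xs) \<and> map set xss = v"

definition lists_fvecs :: "bitvec list list list \<Rightarrow> fvec set \<Rightarrow> bool" where
  "lists_fvecs L U \<longleftrightarrow> (\<exists>vs. distinct vs \<and> set vs = U \<and> list_all2 lists_fvec L vs)"

definition encode_set :: "bitvec list \<Rightarrow> nat list" where
  "encode_set xs = length xs # map (horner_sum of_bool 2) xs"

definition encode_instance :: "nat \<Rightarrow> nat \<Rightarrow> nat \<Rightarrow> bitvec list list list list \<Rightarrow> nat list" where
  "encode_instance n g b I = [n, g, b] @ concat (map encode_set (concat (concat I)))"

section \<open>Solvability within a time bound\<close>

text \<open>
  Words have \<open>\<Omega>(lg n)\<close> bits: the program has to work for every word length at least \<open>c lg n\<close> for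
  some constant \<open>c\<close>, within a time bound that does not depend on the word length.
\<close>

definition solves_factored ::
  "nat \<Rightarrow> (nat \<Rightarrow> bitvec list \<Rightarrow> bool) \<Rightarrow> (nat \<Rightarrow> nat) \<Rightarrow> (nat \<Rightarrow> nat) \<Rightarrow> ram_prog \<Rightarrow> (nat \<Rightarrow> nat) \<Rightarrow> bool"
where
  "solves_factored k f g b P t \<longleftrightarrow>
     (\<exists>c::nat. \<forall>n V I w.
        factored_instance k n (g n) (b n) V \<and> list_all2 lists_fvecs I V \<and>
        real c * log 2 (real n + 2) \<le> real w \<longrightarrow>
        computes_within w P (encode_instance n (g n) (b n) I) (factored_count (f (b n)) (g n) V) (t n))"

text \<open>
  The factored problem for \<open>f\<close> is solvable in a class of running times if this is so for all
  parameters \<open>g = o(lg n / lg lg n)\<close> and \<open>b = o(lg n)\<close>.  The constant factors hidden in the running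
  time may depend on the functions \<open>g\<close> and \<open>b\<close>.
\<close>

definition factored_solvable ::
  "nat \<Rightarrow> (nat \<Rightarrow> bitvec list \<Rightarrow> bool) \<Rightarrow> (nat \<Rightarrow> real) set \<Rightarrow> bool" where
  "factored_solvable k f C \<longleftrightarrow>
     (\<forall>g b :: nat \<Rightarrow> nat.
        (\<lambda>n. real (g n)) \<in> o(\<lambda>n. log 2 (real n) / log 2 (log 2 (real n))) \<longrightarrow>
        (\<lambda>n. real (b n)) \<in> o(\<lambda>n. log 2 (real n)) \<longrightarrow>
        (\<exists>P t. (\<lambda>n. real (t n)) \<in> C \<and> solves_factored k f g b P t))"

definition soft_O :: "(nat \<Rightarrow> real) \<Rightarrow> (nat \<Rightarrow> real) set" where
  "soft_O T = (\<Union>c::nat. O(\<lambda>n. T n * log 2 (real n) ^ c))"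

end

theory Submission
  imports Defs
begin

text \<open>
  Each of the three predicates can test whether \<open>k\<close> numbers are equal: put copies of the first number into
  \<open>k - 1\<close> fields and compare the field \<open>j\<close> with the \<open>j\<close>-th number.  Hence any of the three problems reduces
  to any other by letting every word guess the entire tuple it belongs to: a word of the \<open>j\<close>-th family is
  replaced by the codes of all accepted tuples that contain it at position \<open>j\<close>, and counting accepted
  tuples becomes counting \<open>k\<close>-tuples of equal codes.  There are only \<open>2 ^ (k * b)\<close> codes, so the word length
  grows by a constant factor and the instance by a factor \<open>2 ^ O(b)\<close>.

  The time bound \<open>T\<close> has to work for all parameters, so the new word length may be chosen large enough for
  the input of the target problem to be larger than the time of the reduction.  A solver must read
  a constant fraction of its input: on an instance without solutions, putting the zero word into an
  unread cell would create one.  So the time of the reduction is dominated by that of the solver.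
\<close>

section \<open>Word RAM programs\<close>

text \<open>The reduction takes \<open>n * g * 2 ^ ((k + 1) * b)\<close> steps up to a constant
  factor. That is \<open>n ^ (1 + o(1))\<close>, but in general not \<open>n\<close> times a
  polylogarithmic factor, so even soft-O does not absorb it. The lower bound on the solver closes
  this gap and gives \<open>O(T)\<close> outright.

  The new word length is the length of the fields plus \<open>g + 2\<close>. The adversary instance
  spends two bits, so a solver reads at least \<open>n * 2 ^ (b' - 2)\<close> cells. The fields have
  at least \<open>2 * (k * b + 1)\<close> bits, which pay for \<open>2 ^ b * 2 ^ (k * b)\<close>,
  and \<open>2 ^ g\<close> pays for the factor \<open>g\<close>. The adversary also needs
  \<open>n\<close> distinct vectors; they exist because an instance of the source problem forces
  \<open>n \<le> 2 ^ (2 ^ b * g)\<close>. Since \<open>g = o(lg n)\<close>, the new length is still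
  \<open>o(lg n)\<close>.

  Two properties keep the reduction exact. A code fixes an entire tuple, so each accepted tuple
  yields exactly one tuple of equal codes. Every word occurs in some accepted tuple, so distinct
  sets stay distinct and each family keeps \<open>n\<close> vectors.\<close>

definition reads_within :: "nat \<Rightarrow> ram_prog \<Rightarrow> ram_state \<Rightarrow> nat \<Rightarrow> ram_state \<Rightarrow> nat set \<Rightarrow> bool" where
  "reads_within w P s t s' R \<longleftrightarrow> (\<forall>u. regs u = regs s \<longrightarrow> outs u = outs s \<longrightarrow>
     (\<forall>a\<in>R. mem u a = mem s a) \<longrightarrow>
     (\<exists>u'. exec w P u t u' \<and> regs u' = regs s' \<and> outs u' = outs s' \<and>
       (\<forall>a. mem u a = mem s a \<longrightarrow> mem u' a = mem s' a)))"

lemma reads_withinD: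
  assumes "reads_within w P s t s' R" "regs u = regs s" "outs u = outs s" "\<forall>a\<in>R. mem u a = mem s a"
  obtains u' where "exec w P u t u'" "regs u' = regs s'" "outs u' = outs s'"
    "\<forall>a. mem u a = mem s a \<longrightarrow> mem u' a = mem s' a"
  using assms unfolding reads_within_def by blast

text \<open>The last clause of \<open>reads_within\<close> preserves agreement cell by cell, so the
  cells that the second program needs still agree when it starts. \<open>X\<close> is left open to
  serve both \<open>Seq\<close> and \<open>While\<close>.\<close>

lemma reads_within_trans:
  assumes "reads_within w P s t s' R1" "reads_within w Q s' u s'' R2"
    and "\<And>v v' v'' :: ram_state. regs v = regs s \<Longrightarrow> exec w P v t v' \<Longrightarrow> exec w Q v' u v'' \<Longrightarrow> exec w X v x v''"
  shows "reads_within w X s x s'' (R1 \<union> R2)"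
  unfolding reads_within_def
proof (intro allI impI)
  fix v :: ram_state assume v: "regs v = regs s" "outs v = outs s" "\<forall>a\<in>R1 \<union> R2. mem v a = mem s a"
  obtain v' where v': "exec w P v t v'" "regs v' = regs s'" "outs v' = outs s'"
      "\<forall>a. mem v a = mem s a \<longrightarrow> mem v' a = mem s' a"
    using reads_withinD[OF assms(1) v(1,2)] v(3) by blast
  obtain v'' where v'': "exec w Q v' u v''" "regs v'' = regs s''" "outs v'' = outs s''"
      "\<forall>a. mem v' a = mem s' a \<longrightarrow> mem v'' a = mem s'' a"
    using reads_withinD[OF assms(2) v'(2,3)] v(3) v'(4) by blast
  show "\<exists>v''. exec w X v x v'' \<and> regs v'' = regs s'' \<and> outs v'' = outs s'' \<and>
        (\<forall>a. mem v a = mem s a \<longrightarrow> mem v'' a = mem s'' a)"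
    using assms(3)[OF v(1) v'(1) v''(1)] v'(4) v''(2-4) by blast
qed

text \<open>Only \<open>Load\<close> makes the run depend on memory, one cell per step. A store adds
  no dependency, since its address and value come from registers.\<close>

lemma exec_reads_few_cells:
  assumes "exec w P s t s'"
  shows "\<exists>R. finite R \<and> card R \<le> t \<and> reads_within w P s t s' R"
  using assms
proof (induction rule: exec.induct)
  case (Skip s)
  show ?case
    by (intro exI[of _ "{}"]) (auto simp: reads_within_def simp del: One_nat_def intro!: exI exec.Skip)
next
  case (Const r c s)
  show ?case
    by (intro exI[of _ "{}"]) (auto simp: reads_within_def simp del: One_nat_def intro!: exI exec.Const)
next
  case (BinOp p r x y s)
  show ?case
    by (intro exI[of _ "{}"]) (auto simp: reads_within_def simp del: One_nat_def intro!: exI exec.BinOp)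
next
  case (Load r a s)
  show ?case
    by (intro exI[of _ "{regs s a}"]) (auto simp: reads_within_def simp del: One_nat_def intro!: exI exec.Load)
next
  case (Store a r s)
  show ?case
    by (intro exI[of _ "{}"]) (auto simp: reads_within_def simp del: One_nat_def intro!: exI exec.Store)
next
  case (Output r s)
  show ?case
    by (intro exI[of _ "{}"]) (auto simp: reads_within_def simp del: One_nat_def intro!: exI exec.Output)
next
  case (Seq P s t s' Q u s'')
  then obtain R1 R2 where R: "finite R1" "card R1 \<le> t" "finite R2" "card R2 \<le> u"
    "reads_within w P s t s' R1" "reads_within w Q s' u s'' R2"
    by blast
  have "card (R1 \<union> R2) \<le> t + u"
    using card_Un_le[of R1 R2] R by linarith
  moreover have "reads_within w (Seq P Q) s (t + u) s'' (R1 \<union> R2)"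
    by (rule reads_within_trans[OF R(5,6)]) (rule exec.Seq)
  ultimately show ?case
    using R by (intro exI[of _ "R1 \<union> R2"]) simp
next
  case (CondTrue s r P t s' Q)
  then obtain R where R: "finite R" "card R \<le> t" "reads_within w P s t s' R"
    by blast
  have "reads_within w (Cond r P Q) s (t + 1) s' R"
    using R(3) CondTrue.hyps(1) unfolding reads_within_def by (metis exec.CondTrue)
  then show ?case
    using R by (intro exI[of _ R]) simp
next
  case (CondFalse s r Q t s' P)
  then obtain R where R: "finite R" "card R \<le> t" "reads_within w Q s t s' R"
    by blast
  have "reads_within w (Cond r P Q) s (t + 1) s' R"
    using R(3) CondFalse.hyps(1) unfolding reads_within_def by (metis exec.CondFalse)
  then show ?case
    using R by (intro exI[of _ R]) simp
next
  case (WhileFalse s r P)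
  then have "reads_within w (While r P) s 1 s {}"
    unfolding reads_within_def by (metis exec.WhileFalse)
  then show ?case
    by (intro exI[of _ "{}"]) simp
next
  case (WhileTrue s r P t s' u s'')
  then obtain R1 R2 where R: "finite R1" "card R1 \<le> t" "finite R2" "card R2 \<le> u"
    "reads_within w P s t s' R1" "reads_within w (While r P) s' u s'' R2"
    by blast
  have "card (R1 \<union> R2) \<le> t + u + 1"
    using card_Un_le[of R1 R2] R by linarith
  moreover have "reads_within w (While r P) s (t + u + 1) s'' (R1 \<union> R2)"
    by (rule reads_within_trans[OF R(5,6)], rule exec.WhileTrue) (use WhileTrue.hyps(1) in simp_all)
  ultimately show ?case
    using R by (intro exI[of _ "R1 \<union> R2"]) simp
qed

inductive_cases exec_SkipE: "exec w Skip s t s'"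
inductive_cases exec_ConstE: "exec w (Const r c) s t s'"
inductive_cases exec_BinOpE: "exec w (BinOp p r x y) s t s'"
inductive_cases exec_LoadE: "exec w (Load r a) s t s'"
inductive_cases exec_StoreE: "exec w (Store a r) s t s'"
inductive_cases exec_OutputE: "exec w (Output r) s t s'"
inductive_cases exec_SeqE: "exec w (Seq P Q) s t s'"
inductive_cases exec_CondE: "exec w (Cond r P Q) s t s'"
inductive_cases exec_WhileE: "exec w (While r P) s t s'"

text \<open>Identifies a run replayed on a modified input with the run that the solver guarantees
  there.\<close>

lemma exec_deterministic:
  "exec w P s t s' \<Longrightarrow> exec w P s u s'' \<Longrightarrow> u = t \<and> s'' = s'"
proof (induction arbitrary: u s'' rule: exec.induct)
  case (Seq P s t s' Q v s1)
  from Seq.prems obtain t2 s2 v2 where "exec w P s t2 s2" "exec w Q s2 v2 s''" "u = t2 + v2"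
    by (rule exec_SeqE)
  with Seq.IH show ?case by metis
next
  case (CondTrue s r P t s' Q)
  from CondTrue.prems obtain t2 where "exec w P s t2 s''" "u = t2 + 1"
    by (rule exec_CondE) (use CondTrue.hyps in simp_all)
  with CondTrue.IH show ?case by metis
next
  case (CondFalse s r Q t s' P)
  from CondFalse.prems obtain t2 where "exec w Q s t2 s''" "u = t2 + 1"
    by (rule exec_CondE) (use CondFalse.hyps in simp_all)
  with CondFalse.IH show ?case by metis
next
  case (WhileFalse s r P)
  from WhileFalse.prems show ?case
    by (rule exec_WhileE) (use WhileFalse.hyps in simp_all)
next
  case (WhileTrue s r P t s' v s1)
  from WhileTrue.prems obtain t2 s2 v2
    where "exec w P s t2 s2" "exec w (While r P) s2 v2 s''" "u = t2 + v2 + 1"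
    by (rule exec_WhileE) (use WhileTrue.hyps(1) in simp_all)
  with WhileTrue.IH show ?case by metis
qed (auto elim: exec_SkipE exec_ConstE exec_BinOpE exec_LoadE exec_StoreE exec_OutputE)

section \<open>Total correctness with step counts\<close>

definition wp :: "nat \<Rightarrow> ram_prog \<Rightarrow> (nat \<Rightarrow> (nat \<Rightarrow> nat) \<Rightarrow> (nat \<Rightarrow> nat) \<Rightarrow> bool) \<Rightarrow>
    (nat \<Rightarrow> nat) \<Rightarrow> (nat \<Rightarrow> nat) \<Rightarrow> bool" where
  "wp w P Q \<rho> \<mu> \<longleftrightarrow> (\<exists>t \<rho>' \<mu>'. exec w P \<lparr>regs = \<rho>, mem = \<mu>, outs = []\<rparr> t
     \<lparr>regs = \<rho>', mem = \<mu>', outs = []\<rparr> \<and> Q t \<rho>' \<mu>')"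

lemma wp_mono: "wp w P Q \<rho> \<mu> \<Longrightarrow> (\<And>t \<rho>' \<mu>'. Q t \<rho>' \<mu>' \<Longrightarrow> Q' t \<rho>' \<mu>') \<Longrightarrow> wp w P Q' \<rho> \<mu>"
  unfolding wp_def by blast

lemma wp_Skip: "Q 1 \<rho> \<mu> \<Longrightarrow> wp w Skip Q \<rho> \<mu>"
  unfolding wp_def using exec.Skip by blast

lemma wp_Const: "Q 1 (\<rho>(r := c mod 2 ^ w)) \<mu> \<Longrightarrow> wp w (Const r c) Q \<rho> \<mu>"
  unfolding wp_def
  using exec.Const[of w r c "\<lparr>regs = \<rho>, mem = \<mu>, outs = []\<rparr>"] by auto

lemma wp_BinOp: "Q 1 (\<rho>(r := binop_val w p (\<rho> x) (\<rho> y))) \<mu> \<Longrightarrow> wp w (BinOp p r x y) Q \<rho> \<mu>"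
  unfolding wp_def
  using exec.BinOp[of w p r x y "\<lparr>regs = \<rho>, mem = \<mu>, outs = []\<rparr>"] by auto

lemma wp_Load: "Q 1 (\<rho>(r := \<mu> (\<rho> a))) \<mu> \<Longrightarrow> wp w (Load r a) Q \<rho> \<mu>"
  unfolding wp_def
  using exec.Load[of w r a "\<lparr>regs = \<rho>, mem = \<mu>, outs = []\<rparr>"] by auto

lemma wp_Store: "Q 1 \<rho> (\<mu>(\<rho> a := \<rho> r)) \<Longrightarrow> wp w (Store a r) Q \<rho> \<mu>"
  unfolding wp_def
  using exec.Store[of w a r "\<lparr>regs = \<rho>, mem = \<mu>, outs = []\<rparr>"] by auto

lemma wp_Seq:
  "wp w P (\<lambda>t \<rho>' \<mu>'. wp w P' (\<lambda>u. Q (t + u)) \<rho>' \<mu>') \<rho> \<mu> \<Longrightarrow> wp w (Seq P P') Q \<rho> \<mu>"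
  unfolding wp_def using exec.Seq by blast

lemma wp_Cond:
  assumes "\<rho> r \<noteq> 0 \<Longrightarrow> wp w P (\<lambda>t. Q (t + 1)) \<rho> \<mu>" "\<rho> r = 0 \<Longrightarrow> wp w P' (\<lambda>t. Q (t + 1)) \<rho> \<mu>"
  shows "wp w (Cond r P P') Q \<rho> \<mu>"
proof (cases "\<rho> r = 0")
  case True
  then obtain t \<rho>' \<mu>' where "exec w P' \<lparr>regs = \<rho>, mem = \<mu>, outs = []\<rparr> t
      \<lparr>regs = \<rho>', mem = \<mu>', outs = []\<rparr>" "Q (t + 1) \<rho>' \<mu>'"
    using assms(2) unfolding wp_def by blast
  then show ?thesis
    unfolding wp_def using True exec.CondFalse by (metis ram_state.select_convs(1))
next
  case False
  then obtain t \<rho>' \<mu>' where "exec w P \<lparr>regs = \<rho>, mem = \<mu>, outs = []\<rparr> t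
      \<lparr>regs = \<rho>', mem = \<mu>', outs = []\<rparr>" "Q (t + 1) \<rho>' \<mu>'"
    using assms(1) unfolding wp_def by blast
  then show ?thesis
    unfolding wp_def using False exec.CondTrue by (metis ram_state.select_convs(1))
qed

text \<open>Every loop of the reduction counts one register down to zero. Indexing the invariant by
  that register yields termination and the time bound together.\<close>

lemma wp_While_countdown:
  assumes guard: "\<And>i \<rho> \<mu>. I i \<rho> \<mu> \<Longrightarrow> \<rho> r = i"
    and body: "\<And>i \<rho> \<mu>. I (Suc i) \<rho> \<mu> \<Longrightarrow> wp w P (\<lambda>t \<rho>' \<mu>'. t \<le> B \<and> I i \<rho>' \<mu>') \<rho> \<mu>"
    and "I i \<rho> \<mu>"
  shows "wp w (While r P) (\<lambda>t \<rho>' \<mu>'. t \<le> i * (B + 1) + 1 \<and> I 0 \<rho>' \<mu>') \<rho> \<mu>"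
  using assms(3)
proof (induction i arbitrary: \<rho> \<mu>)
  case 0
  then show ?case
    unfolding wp_def using guard[OF 0]
    by (intro exI[of _ 1] exI[of _ \<rho>] exI[of _ \<mu>]) (auto intro: exec.WhileFalse[simplified])
next
  case (Suc i)
  obtain t \<rho>' \<mu>' where 1: "exec w P \<lparr>regs = \<rho>, mem = \<mu>, outs = []\<rparr> t
      \<lparr>regs = \<rho>', mem = \<mu>', outs = []\<rparr>" "t \<le> B" "I i \<rho>' \<mu>'"
    using body[OF Suc.prems] unfolding wp_def by blast
  obtain u \<rho>'' \<mu>'' where 2: "exec w (While r P) \<lparr>regs = \<rho>', mem = \<mu>', outs = []\<rparr> u
      \<lparr>regs = \<rho>'', mem = \<mu>'', outs = []\<rparr>" "u \<le> i * (B + 1) + 1" "I 0 \<rho>'' \<mu>''"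
    using Suc.IH[OF 1(3)] unfolding wp_def by blast
  have "exec w (While r P) \<lparr>regs = \<rho>, mem = \<mu>, outs = []\<rparr> (t + u + 1)
      \<lparr>regs = \<rho>'', mem = \<mu>'', outs = []\<rparr>"
    using exec.WhileTrue[OF _ 1(1) 2(1)] guard[OF Suc.prems] by simp
  moreover have "t + u + 1 \<le> Suc i * (B + 1) + 1"
    using 1(2) 2(2) by simp
  ultimately show ?case
    unfolding wp_def using 2(3) by blast
qed

text \<open>An unrolled loop. It is only used with a number of rounds that depends on
  \<open>k\<close> alone, so the program stays independent of the instance.\<close>

primrec rep :: "nat \<Rightarrow> ram_prog \<Rightarrow> ram_prog" where
  "rep 0 P = Skip"
| "rep (Suc n) P = Seq P (rep n P)"

lemma wp_rep:
  assumes body: "\<And>i \<rho> \<mu>. i < m \<Longrightarrow> I i \<rho> \<mu> \<Longrightarrow> wp w P (\<lambda>t \<rho>' \<mu>'. t \<le> B \<and> I (Suc i) \<rho>' \<mu>') \<rho> \<mu>"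
    and "I 0 \<rho> \<mu>"
  shows "wp w (rep m P) (\<lambda>t \<rho>' \<mu>'. t \<le> m * B + 1 \<and> I m \<rho>' \<mu>') \<rho> \<mu>"
proof -
  \<comment> \<open>The invariant counts upwards while \<open>rep\<close> is peeled from the front,
    hence the induction on the number \<open>d\<close> of remaining rounds.\<close>
  have "wp w (rep d P) (\<lambda>t \<rho>' \<mu>'. t \<le> d * B + 1 \<and> I m \<rho>' \<mu>') \<rho> \<mu>" if "I (m - d) \<rho> \<mu>" "d \<le> m" for d
    using that
  proof (induction d arbitrary: \<rho> \<mu>)
    case 0
    then show ?case by (auto intro: wp_Skip)
  next
    case (Suc d)
    have "Suc (m - Suc d) = m - d"
      using Suc.prems by simp
    then have "wp w P (\<lambda>t \<rho>' \<mu>'. t \<le> B \<and> I (m - d) \<rho>' \<mu>') \<rho> \<mu>"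
      using body[of "m - Suc d" \<rho> \<mu>] Suc.prems by simp
    then show ?case
      using Suc.prems(2) by (auto intro!: wp_Seq elim!: wp_mono dest!: Suc.IH)
  qed
  from this[of m] assms(2) show ?thesis by simp
qed

section \<open>Bit vectors as numbers\<close>

abbreviation val :: "bitvec \<Rightarrow> nat" where
  "val \<equiv> horner_sum of_bool 2"

definition bits :: "nat \<Rightarrow> nat \<Rightarrow> bitvec" where
  "bits b x = map (bit x) [0..<b]"

lemma length_bits [simp]: "length (bits b x) = b"
  by (simp add: bits_def)

lemma nth_bits [simp]: "a < b \<Longrightarrow> bits b x ! a = bit x a"
  by (simp add: bits_def)

lemma val_bits: "x < 2 ^ b \<Longrightarrow> val (bits b x) = x"
  unfolding bits_def by (simp add: horner_sum_bit_eq_take_bit take_bit_nat_eq_self)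

lemma bits_val: "length u = b \<Longrightarrow> bits b (val u) = u"
  by (rule nth_equalityI) (simp_all add: bit_horner_sum_bit_iff)

lemma val_less: "val u < 2 ^ length u"
  by (induction u) auto

lemma inj_on_bits: "inj_on (bits b) {..<2 ^ b}"
  by (rule inj_on_inverseI[where g = val]) (simp add: val_bits)

lemma bits_0: "bits b 0 = replicate b False"
  by (rule nth_equalityI) simp_all

lemma bit_imp_less:
  fixes x :: nat
  assumes "x < 2 ^ b" "bit x a"
  shows "a < b"
  using assms by (metis bit_take_bit_iff take_bit_nat_eq_self)

lemma bit_split:
  fixes z q :: nat
  assumes "z < 2 ^ r"
  shows "bit (z + 2 ^ r * q) a \<longleftrightarrow> (if a < r then bit z a else bit q (a - r))"
proof -
  note z = bit_imp_less[OF assms]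
  have "and z (push_bit r q) = 0"
    by (rule bit_eqI) (auto simp: bit_simps dest: z)
  then have "z + push_bit r q = or z (push_bit r q)"
    by (rule disjunctive_add_eq_or)
  then have "bit (z + 2 ^ r * q) a \<longleftrightarrow> bit z a \<or> bit (push_bit r q) a"
    by (simp add: push_bit_eq_mult mult.commute bit_or_iff)
  then show ?thesis
    by (auto simp: bit_push_bit_iff dest: z)
qed

text \<open>\<open>v\<close> and its complement within the mask have no common bit, so they add up
  to the mask without carries.\<close>

lemma bit_complement:
  fixes v :: nat
  assumes "v < 2 ^ b"
  shows "bit (2 ^ b - 1 - v) a \<longleftrightarrow> a < b \<and> \<not> bit v a"
proof -
  note v = bit_imp_less[OF assms]
  have "and v (xor v (mask b)) = 0"
    by (rule bit_eqI) (auto simp: bit_simps dest: v)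
  then have "v + xor v (mask b) = xor v (xor v (mask b))"
    by (rule disjunctive_add_eq_xor)
  then have "2 ^ b - 1 - v = xor v (mask b)"
    by (simp add: mask_eq_exp_minus_1 flip: xor.assoc)
  then show ?thesis
    by (auto simp: bit_simps dest: v)
qed

lemma ov_pred_bits: "ov_pred b (map (bits b) ys) \<longleftrightarrow> (\<forall>a<b. \<exists>y\<in>set ys. \<not> bit y a)"
proof -
  have "ov_pred b (map (bits b) ys) \<longleftrightarrow> (\<forall>a<b. \<exists>j<length ys. \<not> bit (ys ! j) a)"
    unfolding ov_pred_def by (auto simp: Bex_def)
  then show ?thesis
    by (simp add: Bex_def in_set_conv_nth) blast
qed

lemma foldr_xor_bits:
  "foldr (map2 (\<noteq>)) (map (bits b) ys) (replicate b False) = bits b (foldr xor ys 0)"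
  by (induction ys) (auto intro!: nth_equalityI simp: bits_0 bit_xor_iff)

lemma xor_pred_bits:
  "xor_pred b (map (bits b) ys) \<longleftrightarrow> take_bit b (foldr xor ys 0) = 0"
  unfolding xor_pred_def foldr_xor_bits
  by (auto simp: list_eq_iff_nth_eq bit_eq_iff bit_simps)

lemma sum_pred_bits:
  assumes "\<forall>y\<in>set ys. y < 2 ^ b"
  shows "sum_pred b (map (bits b) ys) \<longleftrightarrow> sum_list ys mod 2 ^ b = 0"
proof -
  have "map (val \<circ> bits b) ys = ys"
    using assms by (intro map_idI) (auto simp: val_bits)
  then show ?thesis
    unfolding sum_pred_def by (simp add: comp_def)
qed

text \<open>Lets one program check any of the three source predicates. The fold starts with the
  first word rather than a neutral element, which would differ between the operations. For
  \<open>b \<le> w\<close> the wrap-around of the machine at \<open>2 ^ w\<close> is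
  harmless.\<close>

definition computed_by :: "(nat \<Rightarrow> bitvec list \<Rightarrow> bool) \<Rightarrow> binop \<Rightarrow> bool" where
  "computed_by f p \<longleftrightarrow> (\<forall>b w y ys. b \<le> w \<longrightarrow> y < 2 ^ b \<longrightarrow> (\<forall>d\<in>set ys. d < 2 ^ b) \<longrightarrow>
     (f b (map (bits b) (y # ys)) \<longleftrightarrow> foldl (\<lambda>a d. binop_val w p a d mod 2 ^ b) y ys = 0))"

lemma computed_by_ov: "computed_by ov_pred And"
  unfolding computed_by_def ov_pred_bits
proof (intro allI impI)
  fix b w y :: nat and ys :: "nat list" assume "y < 2 ^ b" "\<forall>d\<in>set ys. d < 2 ^ b"
  then have "foldl (\<lambda>a d. and a d mod 2 ^ b) y ys = take_bit b (foldl and y ys)"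
  proof (induction ys arbitrary: y)
    case (Cons d ys)
    then have "and y d mod 2 ^ b = and y d"
      by (simp flip: take_bit_eq_mod add: take_bit_nat_eq_self)
    moreover from this have "and y d < 2 ^ b"
      by (metis mod_less_divisor zero_less_numeral zero_less_power)
    ultimately show ?case
      using Cons.IH[of "and y d"] Cons.prems by simp
  qed (simp add: take_bit_nat_eq_self)
  moreover have "bit (foldl and y ys) a \<longleftrightarrow> (\<forall>d\<in>set (y # ys). bit d a)" for a
    by (induction ys arbitrary: y) (auto simp: bit_simps)
  ultimately show "(\<forall>a<b. \<exists>d\<in>set (y # ys). \<not> bit d a) \<longleftrightarrow>
      foldl (\<lambda>a d. binop_val w And a d mod 2 ^ b) y ys = 0"
    by (auto simp: bit_eq_iff bit_simps)
qed

lemma computed_by_xor: "computed_by xor_pred Xor"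
  unfolding computed_by_def xor_pred_bits
proof (intro allI impI)
  fix b w y :: nat and ys :: "nat list" assume "y < 2 ^ b" "\<forall>d\<in>set ys. d < 2 ^ b"
  then have "foldl (\<lambda>a d. xor a d mod 2 ^ b) y ys = take_bit b (foldr xor (y # ys) 0)"
  proof (induction ys arbitrary: y)
    case (Cons d ys)
    then have *: "xor y d mod 2 ^ b = xor y d"
      by (simp flip: take_bit_eq_mod add: take_bit_nat_eq_self)
    then have "xor y d < 2 ^ b"
      by (metis mod_less_divisor zero_less_numeral zero_less_power)
    then show ?case
      using Cons.IH[of "xor y d"] Cons.prems * by (simp add: xor.assoc del: take_bit_xor)
  qed (simp add: take_bit_nat_eq_self)
  then show "take_bit b (foldr xor (y # ys) 0) = 0 \<longleftrightarrow>
      foldl (\<lambda>a d. binop_val w Xor a d mod 2 ^ b) y ys = 0"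
    by simp
qed

lemma computed_by_sum: "computed_by sum_pred Add"
  unfolding computed_by_def
proof (intro allI impI)
  fix b w y :: nat and ys :: "nat list" assume y: "b \<le> w" "y < 2 ^ b" "\<forall>d\<in>set ys. d < 2 ^ b"
  \<comment> \<open>\<open>2 ^ b\<close> divides \<open>2 ^ w\<close>, so wrapping at the word
    length does not change residues modulo \<open>2 ^ b\<close>.\<close>
  have [simp]: "x mod 2 ^ w mod 2 ^ b = x mod 2 ^ b" for x :: nat
    using y(1) by (simp add: mod_mod_cancel le_imp_power_dvd)
  have "foldl (\<lambda>a d. (a + d) mod 2 ^ w mod 2 ^ b) y ys = sum_list (y # ys) mod 2 ^ b"
    using y(2) by (induction ys arbitrary: y) (simp_all add: mod_simps add.assoc)
  moreover have "sum_pred b (map (bits b) (y # ys)) \<longleftrightarrow> sum_list (y # ys) mod 2 ^ b = 0"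
    by (rule sum_pred_bits) (use y in auto)
  ultimately show "sum_pred b (map (bits b) (y # ys)) \<longleftrightarrow>
      foldl (\<lambda>a d. binop_val w Add a d mod 2 ^ b) y ys = 0"
    by simp
qed

text \<open>Guarantees that every word leaves a trace in the new instance. Words without an accepted
  tuple would vanish, and then distinct vectors could coincide and \<open>n\<close> would
  shrink.\<close>

definition extendable :: "nat \<Rightarrow> (nat \<Rightarrow> bitvec list \<Rightarrow> bool) \<Rightarrow> bool" where
  "extendable k f \<longleftrightarrow> (\<forall>b j x. j < k \<longrightarrow> x < 2 ^ b \<longrightarrow>
     (\<exists>ys. length ys = k \<and> (\<forall>y\<in>set ys. y < 2 ^ b) \<and> ys ! j = x \<and> f b (map (bits b) ys)))"

lemma set_update_replicate: "set ((replicate k z)[j := x]) \<subseteq> {x, z}"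
  using set_update_subset_insert[of "replicate k z" j x] by (auto simp: set_replicate_conv_if split: if_splits)

text \<open>Fill up with zeros: as \<open>k \<ge> 2\<close>, some position other than
  \<open>j\<close> holds a zero word, which is orthogonal to everything.\<close>

lemma extendable_ov:
  assumes "k \<ge> 2"
  shows "extendable k ov_pred"
  unfolding extendable_def ov_pred_bits
proof (intro allI impI)
  fix b j x :: nat assume j: "j < k" "x < 2 ^ b"
  define i where "i = (if j = 0 then 1 else 0::nat)"
  have i: "i < k" "i \<noteq> j"
    using assms unfolding i_def by auto
  then have "0 \<in> set ((replicate k 0)[j := x])"
    by (auto simp: in_set_conv_nth intro!: exI[of _ i])
  then show "\<exists>ys. length ys = k \<and> (\<forall>y\<in>set ys. y < 2 ^ b) \<and> ys ! j = x \<and>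
      (\<forall>a<b. \<exists>y\<in>set ys. \<not> bit y a)"
    using j set_update_replicate[of k 0 j x]
    by (intro exI[of _ "(replicate k 0)[j := x]"]) (auto intro!: bexI[of _ 0])
qed

lemma foldr_xor_update:
  fixes ys :: "nat list"
  assumes "j < length ys"
  shows "foldr xor (ys[j := x]) 0 = xor (xor (foldr xor ys 0) (ys ! j)) x"
  using assms
proof (induction ys arbitrary: j)
  case (Cons y ys)
  have "xor z (xor z x) = x" for x z :: nat
    by (simp flip: xor.assoc)
  then show ?case
    using Cons by (cases j) (simp_all add: ac_simps)
qed simp

lemma xor_eq_0: "xor x y = 0 \<longleftrightarrow> x = (y::nat)"
  by (auto simp: bit_eq_iff bit_simps)

text \<open>Put \<open>x\<close> at a second position as well; the two copies cancel.\<close>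

lemma extendable_xor:
  assumes "k \<ge> 2"
  shows "extendable k xor_pred"
  unfolding extendable_def xor_pred_bits
proof (intro allI impI)
  fix b j x :: nat assume j: "j < k" "x < 2 ^ b"
  define i where "i = (if j = 0 then 1 else 0::nat)"
  have i: "i < k" "i \<noteq> j"
    using assms unfolding i_def by auto
  have z: "foldr xor (replicate k 0) (0::nat) = 0" for k
    by (induction k) (simp_all del: foldr_replicate)
  have "set ((replicate k 0)[i := x, j := x]) \<subseteq> {0, x}"
    using set_update_replicate[of k 0 i x] set_update_subset_insert[of "(replicate k 0)[i := x]" j x]
    by auto
  then show "\<exists>ys. length ys = k \<and> (\<forall>y\<in>set ys. y < 2 ^ b) \<and> ys ! j = x \<and>
      take_bit b (foldr xor ys 0) = 0"
    using i j by (intro exI[of _ "(replicate k 0)[i := x, j := x]"]) (auto simp: foldr_xor_update z simp del: foldr_replicate)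
qed

lemma extendable_sum:
  assumes "k \<ge> 2"
  shows "extendable k sum_pred"
  unfolding extendable_def
proof (intro allI impI)
  fix b j x :: nat assume j: "j < k" "x < 2 ^ b"
  define i where "i = (if j = 0 then 1 else 0::nat)"
  have i: "i < k" "i \<noteq> j"
    using assms unfolding i_def by auto
  \<comment> \<open>The negative of \<open>x\<close>. The outer \<open>mod\<close> matters for
    \<open>x = 0\<close>, where \<open>2 ^ b\<close> is not a \<open>b\<close>-bit number.\<close>
  define y where "y = (2 ^ b - x) mod 2 ^ b"
  define ys where "ys = (replicate k 0)[i := y, j := x]"
  have "set ys \<subseteq> {0, x, y}"
    using set_update_replicate[of k 0 i y] set_update_subset_insert[of "(replicate k 0)[i := y]" j x]
    unfolding ys_def by auto
  then have ys: "\<forall>y\<in>set ys. y < 2 ^ b"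
    using j by (auto simp: y_def)
  have "sum_list ys = y + x"
    using i j unfolding ys_def by (simp add: sum_list_update sum_list_replicate)
  also have "\<dots> mod 2 ^ b = 0"
    using j by (simp add: y_def mod_simps)
  finally have "sum_pred b (map (bits b) ys)"
    using sum_pred_bits[OF ys] by simp
  then show "\<exists>ys. length ys = k \<and> (\<forall>y\<in>set ys. y < 2 ^ b) \<and> ys ! j = x \<and> sum_pred b (map (bits b) ys)"
    using ys i j by (intro exI[of _ ys]) (simp add: ys_def)
qed

section \<open>Testing equality\<close>

text \<open>The low and high halves are complementary, so that distinct codes are incomparable bitwise.\<close>

definition code :: "nat \<Rightarrow> nat \<Rightarrow> nat" where
  "code m y = y + 2 ^ m * (2 ^ m - 1 - y)"

lemma code_less:
  assumes "y < 2 ^ m"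
  shows "code m y < 2 ^ (2 * m)"
proof -
  have "code m y \<le> (2 ^ m - 1) + 2 ^ m * (2 ^ m - 1)"
    unfolding code_def using assms by (intro add_mono mult_le_mono) auto
  also have "\<dots> < 2 ^ m + 2 ^ m * (2 ^ m - 1)"
    by simp
  also have "\<dots> = 2 ^ (2 * m)"
    by (simp add: mult_2 power_add diff_mult_distrib2)
  finally show ?thesis .
qed

text \<open>Positivity keeps the negation \<open>2 ^ b - v\<close> of a shifted code within
  \<open>b\<close> bits.\<close>

lemma code_pos: "m > 0 \<Longrightarrow> code m y > 0"
  unfolding code_def using one_less_power[of "2::nat" m] by (cases "y = 0") auto

lemma bit_code:
  assumes "y < 2 ^ m" "a < m"
  shows "bit (code m y) a \<longleftrightarrow> bit y a" "bit (code m y) (a + m) \<longleftrightarrow> \<not> bit y a"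
  using assms by (simp_all only: code_def bit_split bit_complement) simp_all

text \<open>Containment of the low halves says that every bit of \<open>y\<close> is a bit of
  \<open>z\<close>; containment of the complemented high halves says the converse.\<close>

lemma code_subset:
  assumes "y < 2 ^ m" "z < 2 ^ m" "\<And>a. bit (code m y) a \<Longrightarrow> bit (code m z) a"
  shows "y = z"
proof (rule bit_eqI)
  fix a
  show "bit y a \<longleftrightarrow> bit z a"
  proof (cases "a < m")
    case True
    then show ?thesis
      using assms(3)[of a] assms(3)[of "a + m"] bit_code[OF assms(1) True] bit_code[OF assms(2) True]
      by blast
  next
    case False
    then show ?thesis
      using bit_imp_less assms(1,2) by blast
  qed
qed

lemma inj_on_code: "inj_on (code m) {..<2 ^ m}"
  by (auto simp: inj_on_def intro: code_subset)

section \<open>Numbers composed of disjoint bit fields\<close>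

lemma digits_less:
  fixes zs :: "nat list"
  assumes "\<forall>z\<in>set zs. z < W"
  shows "horner_sum (\<lambda>x. x) W zs < W ^ length zs"
  using assms
proof (induction zs)
  case (Cons z zs)
  then have "horner_sum (\<lambda>x. x) W zs + 1 \<le> W ^ length zs"
    by auto
  then have "W * (horner_sum (\<lambda>x. x) W zs + 1) \<le> W * W ^ length zs"
    by (rule mult_le_mono2)
  then show ?case
    using Cons.prems by auto
qed simp

lemma digits_subset:
  fixes zs ys :: "nat list"
  assumes "length zs = length ys" "\<forall>z\<in>set zs. z < 2 ^ r" "\<forall>y\<in>set ys. y < 2 ^ r"
    and "\<And>a. bit (horner_sum (\<lambda>x. x) (2 ^ r) zs) a \<Longrightarrow> bit (horner_sum (\<lambda>x. x) (2 ^ r) ys) a"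
  shows "list_all2 (\<lambda>z y. \<forall>a. bit z a \<longrightarrow> bit y a) zs ys"
  using assms
proof (induction zs ys rule: list_induct2)
  case (Cons z zs y ys)
  have "bit z a \<Longrightarrow> bit y a" for a
    using Cons.prems(3)[of a] Cons.prems(1,2) bit_imp_less[of z r a] by (auto simp: bit_split)
  moreover have "list_all2 (\<lambda>z y. \<forall>a. bit z a \<longrightarrow> bit y a) zs ys"
  proof (rule Cons.IH)
    show "bit (horner_sum (\<lambda>x. x) (2 ^ r) ys) a" if "bit (horner_sum (\<lambda>x. x) (2 ^ r) zs) a" for a
      using Cons.prems(3)[of "a + r"] Cons.prems(1,2) that by (auto simp: bit_split)
  qed (use Cons.prems in auto)
  ultimately show ?case by simp
qed simp

lemma foldr_xor_mult:
  "foldr xor (map (\<lambda>x. 2 ^ r * x) xs) 0 = 2 ^ r * (foldr xor xs 0 :: nat)"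
proof (induction xs)
  case (Cons x xs)
  then show ?case
    using push_bit_xor[of r x "foldr xor xs 0"] by (simp add: push_bit_eq_mult mult.commute)
qed simp

lemma map_shifted_Cons:
  "map (\<lambda>i. (z # zs) ! i * W ^ i) [0..<Suc l] = z # map (\<lambda>x. W * x) (map (\<lambda>i. zs ! i * (W::nat) ^ i) [0..<l])"
  by (simp add: upt_conv_Cons map_Suc_upt[symmetric] ac_simps del: upt_Suc)

text \<open>Shifted digits occupy disjoint fields, so xor adds them without carries.\<close>

lemma foldr_xor_digits:
  assumes "\<forall>z\<in>set zs. z < 2 ^ r"
  shows "foldr xor (map (\<lambda>i. zs ! i * (2 ^ r) ^ i) [0..<length zs]) 0 = horner_sum (\<lambda>x. x) (2 ^ r :: nat) zs"
  using assms
proof (induction zs)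
  case (Cons z zs)
  have "xor z (2 ^ r * q) = z + 2 ^ r * q" for q
  proof (rule disjunctive_add_eq_xor[symmetric], rule bit_eqI)
    show "bit (and z (2 ^ r * q)) a \<longleftrightarrow> bit 0 a" for a
      using Cons.prems bit_imp_less[of z r a]
      by (auto simp: bit_simps push_bit_eq_mult[symmetric] mult.commute[of "2 ^ r"])
  qed
  then show ?case
    using Cons by (simp only: length_Cons map_shifted_Cons foldr_Cons foldr_xor_mult comp_def) simp
qed simp

lemma bit_digits:
  assumes "\<forall>z\<in>set zs. z < 2 ^ r"
  shows "bit (horner_sum (\<lambda>x. x) (2 ^ r :: nat) zs) a \<longleftrightarrow>
    (\<exists>v\<in>set (map (\<lambda>i. zs ! i * (2 ^ r) ^ i) [0..<length zs]). bit v a)"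
  using assms
proof (induction zs arbitrary: a)
  case (Cons z zs)
  have z: "a < r" if "bit z a" for a
    using Cons.prems that bit_imp_less[of z r a] by simp
  have s: "bit (2 ^ r * x) a \<longleftrightarrow> r \<le> a \<and> bit x (a - r)" for x :: nat
    by (simp add: bit_simps push_bit_eq_mult[symmetric] mult.commute[of "2 ^ r"])
  show ?case
    using Cons z[of a] by (auto simp: bit_split map_shifted_Cons s simp del: upt_Suc)
qed simp

lemma horner_sum_digits:
  "horner_sum (\<lambda>x. x) W zs = sum_list (map (\<lambda>i. zs ! i * (W::nat) ^ i) [0..<length zs])"
  by (simp add: horner_sum_eq_sum sum_list_distinct_conv_sum_set atLeast0LessThan)

text \<open>
  The first word repeats its code in all fields, the others contribute their code to one field each.
\<close>

definition eq_words :: "nat \<Rightarrow> (nat \<Rightarrow> nat) \<Rightarrow> nat \<Rightarrow> nat list \<Rightarrow> nat list" where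
  "eq_words m e y0 ys = code m y0 * (\<Sum>i<length ys. (2 ^ (2 * m)) ^ i) #
     map (\<lambda>i. e (code m (ys ! i) * (2 ^ (2 * m)) ^ i)) [0..<length ys]"

text \<open>\<open>e\<close> is the identity for XOR, negation for SUM and complement for OV. Range
  and injectivity make the words of a later family faithful \<open>b\<close>-bit vectors. Zero is
  excluded since its negation \<open>2 ^ b\<close> does not fit; positive codes never produce
  it.\<close>

definition tests_equality :: "(nat \<Rightarrow> bitvec list \<Rightarrow> bool) \<Rightarrow> (nat \<Rightarrow> nat \<Rightarrow> nat) \<Rightarrow> bool" where
  "tests_equality f e \<longleftrightarrow>
    (\<forall>b v. 0 < v \<longrightarrow> v < 2 ^ b \<longrightarrow> e b v < 2 ^ b) \<and> (\<forall>b. inj_on (e b) {0<..<2 ^ b}) \<and>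
    (\<forall>m b y0 ys. 0 < m \<longrightarrow> 2 * m * length ys \<le> b \<longrightarrow> (\<forall>y\<in>set (y0 # ys). y < 2 ^ m) \<longrightarrow>
      (f b (map (bits b) (eq_words m (e b) y0 ys)) \<longleftrightarrow> (\<forall>y\<in>set ys. y = y0)))"

lemma shifted_less:
  assumes "z < 2 ^ r" "i < l" "r * l \<le> b"
  shows "z * (2 ^ r) ^ i < (2 ^ b :: nat)"
proof -
  have "z * (2 ^ r) ^ i < 2 ^ r * (2 ^ r) ^ i"
    using assms(1) by simp
  also have "\<dots> = 2 ^ (r * Suc i)"
    by (simp add: power_mult power_add)
  also have "\<dots> \<le> 2 ^ b"
    using assms(2,3) by (intro power_increasing order.trans[OF mult_le_mono2 assms(3)]) auto
  finally show ?thesis .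
qed

lemma repeated_eq_digits:
  "z * (\<Sum>i<l. W ^ i) = horner_sum (\<lambda>x. x) (W::nat) (replicate l z)"
  by (simp add: horner_sum_eq_sum atLeast0LessThan sum_distrib_left)

lemma repeated_less:
  assumes "z < 2 ^ r" "r * l \<le> b"
  shows "z * (\<Sum>i<l. (2 ^ r) ^ i) < (2 ^ b :: nat)"
proof -
  have "z * (\<Sum>i<l. (2 ^ r) ^ i) < (2 ^ r) ^ l"
    unfolding repeated_eq_digits using digits_less[of "replicate l z" "2 ^ r"] assms(1) by simp
  also have "\<dots> \<le> 2 ^ b"
    using assms(2) by (simp flip: power_mult)
  finally show ?thesis .
qed

text \<open>XOR and SUM compare the two numbers for equality, while OV only sees containment of
  their bits. Incomparability of the codes in each field makes both conditions mean the
  same.\<close>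

lemma digits_eq_iff:
  assumes "\<forall>y\<in>set (y0 # ys). y < 2 ^ m"
  shows "horner_sum (\<lambda>x. x) (2 ^ (2 * m)) (replicate (length ys) (code m y0)) =
      horner_sum (\<lambda>x. x) (2 ^ (2 * m)) (map (code m) ys) \<longleftrightarrow> (\<forall>y\<in>set ys. y = y0)" (is ?eq)
    and "(\<forall>a. bit (horner_sum (\<lambda>x. x) (2 ^ (2 * m)) (replicate (length ys) (code m y0))) a \<longrightarrow>
      bit (horner_sum (\<lambda>x. x) (2 ^ (2 * m)) (map (code m) ys)) a) \<longleftrightarrow> (\<forall>y\<in>set ys. y = y0)" (is ?sub)
proof -
  let ?N = "horner_sum (\<lambda>x. x) (2 ^ (2 * m) :: nat)"
  have sub: "\<forall>y\<in>set ys. y = y0"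
    if "\<And>a. bit (?N (replicate (length ys) (code m y0))) a \<Longrightarrow> bit (?N (map (code m) ys)) a"
  proof -
    have "list_all2 (\<lambda>z y. \<forall>a. bit z a \<longrightarrow> bit y a) (replicate (length ys) (code m y0)) (map (code m) ys)"
      by (rule digits_subset[OF _ _ _ that]) (use assms code_less in auto)
    then show ?thesis
      using assms by (auto simp: list_all2_conv_all_nth in_set_conv_nth intro!: code_subset[symmetric])
  qed
  have eq: "?N (replicate (length ys) (code m y0)) = ?N (map (code m) ys)" if "\<forall>y\<in>set ys. y = y0"
  proof -
    have "map (code m) ys = replicate (length ys) (code m y0)"
      using that by (metis map_replicate replicate_eqI)
    then show ?thesis by simp
  qed
  show ?eq
    by (rule iffI, rule sub, simp, rule eq)
  show ?sub
    by (rule iffI, rule sub, blast, simp add: eq)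
qed

text \<open>The later words assemble into one number by xor. The total is the xor of two numbers
  that both fit into \<open>b\<close> bits, and it vanishes exactly if they are equal.\<close>

lemma tests_equality_xor: "tests_equality xor_pred (\<lambda>b v. v)"
  unfolding tests_equality_def
proof (intro conjI allI impI)
  fix m b y0 :: nat and ys :: "nat list"
  assume b: "2 * m * length ys \<le> b" and y: "\<forall>y\<in>set (y0 # ys). y < 2 ^ m"
  let ?N = "horner_sum (\<lambda>x. x) (2 ^ (2 * m) :: nat)"
  have c: "\<forall>z\<in>set (map (code m) ys). z < 2 ^ (2 * m)"
    using y by (auto intro: code_less)
  have "map (\<lambda>i. code m (ys ! i) * (2 ^ (2 * m)) ^ i) [0..<length ys] =
     map (\<lambda>i. map (code m) ys ! i * (2 ^ (2 * m)) ^ i) [0..<length (map (code m) ys)]"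
    by simp
  then have "foldr xor (eq_words m (\<lambda>v. v) y0 ys) 0 =
      xor (?N (replicate (length ys) (code m y0))) (?N (map (code m) ys))"
    unfolding eq_words_def repeated_eq_digits using foldr_xor_digits[OF c]
    by (simp only: foldr_Cons comp_def)
  moreover have "take_bit b (?N (replicate (length ys) (code m y0))) = ?N (replicate (length ys) (code m y0))"
    using repeated_less[OF _ b] code_less y by (simp add: take_bit_nat_eq_self repeated_eq_digits)
  moreover have "take_bit b (?N (map (code m) ys)) = ?N (map (code m) ys)"
  proof -
    have "?N (map (code m) ys) < 2 ^ (2 * m * length ys)"
      using digits_less[OF c] by (simp add: power_mult)
    also have "\<dots> \<le> 2 ^ b"
      using b by (intro power_increasing) auto
    finally show ?thesis
      by (rule take_bit_nat_eq_self)
  qed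
  ultimately show "xor_pred b (map (bits b) (eq_words m (\<lambda>v. v) y0 ys)) \<longleftrightarrow> (\<forall>y\<in>set ys. y = y0)"
    unfolding xor_pred_bits using digits_eq_iff(1)[OF y] xor_eq_0 by (simp add: take_bit_xor)
qed auto

lemma eq_words_less:
  assumes e: "\<And>v. 0 < v \<Longrightarrow> v < 2 ^ b \<Longrightarrow> e v < 2 ^ b" and "0 < m"
    and "2 * m * length ys \<le> b" "\<forall>y\<in>set (y0 # ys). y < 2 ^ m"
  shows "\<forall>x\<in>set (eq_words m e y0 ys). x < 2 ^ b"
  unfolding eq_words_def
  using assms repeated_less[of "code m y0" "2 * m" "length ys" b]
  by (auto intro!: e shifted_less[of _ "2 * m" _ "length ys"] code_less code_pos)

lemma tests_equality_sum: "tests_equality sum_pred (\<lambda>b v. 2 ^ b - v)"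
  unfolding tests_equality_def
proof (intro conjI allI impI)
  fix m b y0 :: nat and ys :: "nat list"
  assume m: "0 < m" and b: "2 * m * length ys \<le> b" and y: "\<forall>y\<in>set (y0 # ys). y < 2 ^ m"
  let ?N = "horner_sum (\<lambda>x. x) (2 ^ (2 * m) :: nat)"
  let ?A = "?N (replicate (length ys) (code m y0))" and ?B = "?N (map (code m) ys)"
  have c: "\<forall>z\<in>set (map (code m) ys). z < 2 ^ (2 * m)"
    using y by (auto intro: code_less)
  have A: "?A < 2 ^ b"
    using repeated_less[OF _ b] code_less y by (simp add: repeated_eq_digits)
  have "?B < 2 ^ (2 * m * length ys)"
    using digits_less[OF c] by (simp add: power_mult)
  also have "\<dots> \<le> 2 ^ b"
    using b by (intro power_increasing) auto
  finally have B: "?B < 2 ^ b" .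
  let ?v = "\<lambda>i. code m (ys ! i) * (2 ^ (2 * m)) ^ i"
  \<comment> \<open>Over the integers each negated field contributes one extra \<open>2 ^ b\<close>.
    These multiples disappear modulo \<open>2 ^ b\<close> and leave the difference
    \<open>?A - ?B\<close>, where both numbers are below \<open>2 ^ b\<close>.\<close>
  have "int (sum_list (map (\<lambda>i. 2 ^ b - ?v i) [0..<l])) = int l * 2 ^ b - int (sum_list (map ?v [0..<l]))"
    if "l \<le> length ys" for l
    using that
  proof (induction l)
    case (Suc l)
    have "?v l < 2 ^ b"
      using Suc.prems y by (intro shifted_less[OF _ _ b] code_less) auto
    then show ?case
      using Suc by (simp add: of_nat_diff algebra_simps)
  qed simp
  moreover have "sum_list (map ?v [0..<length ys]) = ?B"
    unfolding horner_sum_digits by (intro arg_cong[of _ _ sum_list] map_cong) auto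
  ultimately have "int (sum_list (eq_words m (\<lambda>v. 2 ^ b - v) y0 ys)) =
      int ?A - int ?B + int (length ys) * 2 ^ b"
    unfolding eq_words_def repeated_eq_digits by simp
  then have "sum_list (eq_words m (\<lambda>v. 2 ^ b - v) y0 ys) mod 2 ^ b = 0 \<longleftrightarrow>
      (int ?A - int ?B + int (length ys) * 2 ^ b) mod 2 ^ b = 0"
    by (simp flip: dvd_eq_mod_eq_0 of_nat_dvd_iff[where ?'a = int])
  also have "\<dots> \<longleftrightarrow> (int ?A - int ?B) mod 2 ^ b = 0"
    by simp
  also have "\<dots> \<longleftrightarrow> ?A = ?B"
  proof
    assume "(int ?A - int ?B) mod 2 ^ b = 0"
    then have "int ?A mod 2 ^ b = int ?B mod 2 ^ b"
      by (simp add: mod_eq_dvd_iff dvd_eq_mod_eq_0)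
    then show "?A = ?B"
      using A B by simp
  qed simp
  also have "\<dots> \<longleftrightarrow> (\<forall>y\<in>set ys. y = y0)"
    by (rule digits_eq_iff(1)[OF y])
  finally show "sum_pred b (map (bits b) (eq_words m (\<lambda>v. 2 ^ b - v) y0 ys)) \<longleftrightarrow> (\<forall>y\<in>set ys. y = y0)"
    using sum_pred_bits[OF eq_words_less[OF _ m b y]] by simp
qed (auto simp: inj_on_def)

text \<open>A bit set in the repeated first word must be cleared by some later word. Since those are
  complemented, this happens exactly where some shifted code has a one, so orthogonality means that
  the bits of \<open>?A\<close> are among those of \<open>?B\<close>.\<close>

lemma tests_equality_ov: "tests_equality ov_pred (\<lambda>b v. 2 ^ b - 1 - v)"
  unfolding tests_equality_def
proof (intro conjI allI impI)
  fix m b y0 :: nat and ys :: "nat list"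
  assume b: "2 * m * length ys \<le> b" and y: "\<forall>y\<in>set (y0 # ys). y < 2 ^ m"
  let ?N = "horner_sum (\<lambda>x. x) (2 ^ (2 * m) :: nat)"
  let ?A = "?N (replicate (length ys) (code m y0))" and ?B = "?N (map (code m) ys)"
  let ?v = "\<lambda>i. code m (ys ! i) * (2 ^ (2 * m)) ^ i"
  have c: "\<forall>z\<in>set (map (code m) ys). z < 2 ^ (2 * m)"
    using y by (auto intro: code_less)
  have A: "a < b" if "bit ?A a" for a
  proof -
    have "?A < 2 ^ b"
      using repeated_less[OF _ b] code_less y by (simp add: repeated_eq_digits)
    then show ?thesis
      using that by (rule bit_imp_less)
  qed
  have v: "bit (2 ^ b - 1 - ?v i) a \<longleftrightarrow> a < b \<and> \<not> bit (?v i) a" if "i < length ys" for i a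
    by (intro bit_complement shifted_less[OF _ that b] code_less) (use y that in auto)
  have B: "bit ?B a \<longleftrightarrow> (\<exists>i<length ys. bit (?v i) a)" for a
    using bit_digits[OF c, of a] by auto
  have "ov_pred b (map (bits b) (eq_words m (\<lambda>v. 2 ^ b - 1 - v) y0 ys)) \<longleftrightarrow>
      (\<forall>a<b. bit ?A a \<longrightarrow> (\<exists>i<length ys. \<not> bit (2 ^ b - 1 - ?v i) a))"
    unfolding ov_pred_bits eq_words_def repeated_eq_digits
    by (simp add: atLeast0LessThan del: One_nat_def diff_diff_left) (auto simp: Bex_def)
  also have "\<dots> \<longleftrightarrow> (\<forall>a<b. bit ?A a \<longrightarrow> bit ?B a)"
    unfolding B using v by (intro all_cong imp_cong refl ex_cong1) metis
  also have "\<dots> \<longleftrightarrow> (\<forall>a. bit ?A a \<longrightarrow> bit ?B a)"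
    using A by blast
  also have "\<dots> \<longleftrightarrow> (\<forall>y\<in>set ys. y = y0)"
    by (rule digits_eq_iff(2)[OF y])
  finally show "ov_pred b (map (bits b) (eq_words m (\<lambda>v. 2 ^ b - 1 - v) y0 ys)) \<longleftrightarrow> (\<forall>y\<in>set ys. y = y0)" .
qed (auto simp: inj_on_def)

section \<open>The reduction\<close>

lemma in_listset_iff: "xs \<in> listset As \<longleftrightarrow> length xs = length As \<and> (\<forall>i<length As. xs ! i \<in> As ! i)"
proof (induction As arbitrary: xs)
  case (Cons A As)
  then show ?case
    by (cases xs) (auto simp: set_Cons_def nth_Cons split: nat.split)
qed simp

lemma finite_listset: "\<forall>A\<in>set As. finite A \<Longrightarrow> finite (listset As)"
proof (induction As)
  case (Cons A As)
  then have "listset (A # As) = (\<lambda>(x, xs). x # xs) ` (A \<times> listset As)"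
    by (auto simp: set_Cons_def)
  then show ?case
    using Cons by (metis finite_SigmaI finite_imageI list.set_intros)
qed simp

section \<open>Codes of tuples as numbers in base \<open>2 ^ b\<close>\<close>

definition digit :: "nat \<Rightarrow> nat \<Rightarrow> nat \<Rightarrow> nat" where
  "digit b j Y = Y div (2 ^ b) ^ j mod 2 ^ b"

lemma digit_less [simp]: "digit b j Y < 2 ^ b"
  by (simp add: digit_def)

lemma digit_Suc: "digit b (Suc j) Y = digit b j (Y div 2 ^ b)"
  by (simp add: digit_def div_mult2_eq)

lemma digit_horner_sum:
  assumes "\<forall>y\<in>set ys. y < 2 ^ b" "j < length ys"
  shows "digit b j (horner_sum (\<lambda>x. x) (2 ^ b) ys) = ys ! j"
  using assms
proof (induction ys arbitrary: j)
  case (Cons y ys)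
  then show ?case
    by (cases j) (simp_all add: digit_Suc, simp add: digit_def)
qed simp

lemma horner_sum_digit:
  "Y < 2 ^ (k * b) \<Longrightarrow> horner_sum (\<lambda>x. x) (2 ^ b) (map (\<lambda>j. digit b j Y) [0..<k]) = Y"
proof (induction k arbitrary: Y)
  case (Suc k)
  then have "Y div 2 ^ b < 2 ^ (k * b)"
    by (simp add: less_mult_imp_div_less power_add mult.commute)
  then have "horner_sum (\<lambda>x. x) (2 ^ b) (map (\<lambda>j. digit b j (Y div 2 ^ b)) [0..<k]) = Y div 2 ^ b"
    by (rule Suc.IH)
  moreover have "map (\<lambda>j. digit b j Y) [0..<Suc k] = Y mod 2 ^ b # map (\<lambda>j. digit b j (Y div 2 ^ b)) [0..<k]"
    by (simp add: upt_conv_Cons map_Suc_upt[symmetric] digit_Suc comp_def del: upt_Suc) (simp add: digit_def)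
  ultimately show ?case
    by (simp del: upt_Suc)
qed simp

locale reduction =
  fixes k :: nat and f f' :: "nat \<Rightarrow> bitvec list \<Rightarrow> bool" and p :: binop and e :: "nat \<Rightarrow> nat \<Rightarrow> nat"
    and g b :: nat
  assumes k: "k \<ge> 2"
    and computed: "computed_by f p"
    and extendable: "extendable k f"
    and tests_eq: "tests_equality f' e"
begin

text \<open>\<open>k * b\<close> bits suffice for a code; the additional one keeps \<open>m\<close>
  positive when \<open>b = 0\<close>, which \<open>code_pos\<close> requires.\<close>

definition m :: nat where
  "m = k * b + 1"

text \<open>
  The bits beyond the \<open>k - 1\<close> fields of the equality test make the lower bound on the time of a solver
  dominate the time of the reduction.
\<close>

definition b' :: nat where
  "b' = 2 * m * (k - 1) + g + 2"

definition words_of :: "nat \<Rightarrow> bitvec list" where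
  "words_of Y = map (\<lambda>j. bits b (digit b j Y)) [0..<k]"

definition sat :: "nat \<Rightarrow> bool" where
  "sat Y \<longleftrightarrow> f b (words_of Y)"

text \<open>The \<open>j\<close>-th entry of \<open>eq_words\<close> as a function of a single code,
  so that every family can be rewritten without looking at the others.\<close>

definition enc :: "nat \<Rightarrow> nat \<Rightarrow> nat" where
  "enc j Y = (if j = 0 then code m Y * (\<Sum>i<k - 1. (2 ^ (2 * m)) ^ i)
     else e b' (code m Y * (2 ^ (2 * m)) ^ (j - 1)))"

text \<open>
  A code \<open>Y\<close> describes a whole tuple of words.  A word \<open>x\<close> of the \<open>j\<close>-th family becomes all codes of
  accepted tuples with \<open>x\<close> at position \<open>j\<close>, so that accepted tuples correspond to \<open>k\<close> equal codes.
\<close>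

definition new_set :: "nat \<Rightarrow> bitvec set \<Rightarrow> bitvec set" where
  "new_set j S = (\<lambda>Y. bits b' (enc j Y)) ` {Y. Y < 2 ^ (k * b) \<and> sat Y \<and> bits b (digit b j Y) \<in> S}"

text \<open>The reversed range is the order in which a loop counting down produces the codes. It
  fixes the exact memory image that the program has to build.\<close>

definition new_list :: "nat \<Rightarrow> bitvec list \<Rightarrow> bitvec list" where
  "new_list j xs = concat (map (\<lambda>x. map (\<lambda>Y. bits b' (enc j Y))
     (filter (\<lambda>Y. sat Y \<and> digit b j Y = val x) (rev [0..<2 ^ (k * b)]))) xs)"

definition new_family :: "fvec set list \<Rightarrow> fvec set list" where
  "new_family V = map (\<lambda>j. map (new_set j) ` (V ! j)) [0..<k]"

definition new_lists :: "bitvec list list list list \<Rightarrow> bitvec list list list list" where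
  "new_lists I = map (\<lambda>j. map (map (new_list j)) (I ! j)) [0..<k]"

lemma m_pos: "m > 0"
  by (simp add: m_def)

lemma fields_fit: "2 * m * (k - 1) \<le> b'"
  by (simp add: b'_def)

lemma less_code_range: "Y < 2 ^ (k * b) \<Longrightarrow> Y < (2 ^ m :: nat)"
  by (rule less_le_trans[of _ "2 ^ (k * b)"]) (simp_all add: m_def)

lemma field_bounds:
  assumes "Y < 2 ^ (k * b)" "j < k" "j \<noteq> 0"
  shows "0 < code m Y * (2 ^ (2 * m)) ^ (j - 1)" "code m Y * (2 ^ (2 * m)) ^ (j - 1) < 2 ^ b'"
  using shifted_less[OF code_less[OF less_code_range[OF assms(1)]] _ fields_fit, of "j - 1"]
    code_pos[OF m_pos, of Y] assms(2,3)
  by simp_all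

lemma repeated_bound:
  assumes "Y < 2 ^ (k * b)"
  shows "code m Y * (\<Sum>i<k - 1. (2 ^ (2 * m)) ^ i) < 2 ^ b'"
  by (rule repeated_less[OF code_less[OF less_code_range[OF assms]] fields_fit])

lemma enc_less: "Y < 2 ^ (k * b) \<Longrightarrow> j < k \<Longrightarrow> enc j Y < 2 ^ b'"
  unfolding enc_def using tests_eq field_bounds repeated_bound
  by (simp add: tests_equality_def del: One_nat_def)

lemma inj_on_enc: "j < k \<Longrightarrow> inj_on (enc j) {..<2 ^ (k * b)}"
proof -
  assume j: "j < k"
  have c: "inj_on (code m) {..<2 ^ (k * b)}"
    by (rule inj_on_subset[OF inj_on_code]) (simp add: subset_iff less_code_range)
  show ?thesis
  proof (cases "j = 0")
    case True
    have "(\<Sum>i<k - 1. (2 ^ (2 * m)) ^ i) \<noteq> (0::nat)"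
      using k by (auto simp: set_eq_iff intro!: exI[of _ 0])
    then show ?thesis
      using c True by (auto simp: inj_on_def enc_def)
  next
    case False
    have inj: "inj_on (e b') {0<..<2 ^ b'}"
      using tests_eq by (simp add: tests_equality_def)
    have inj': "inj_on (\<lambda>Y. code m Y * (2 ^ (2 * m)) ^ (j - 1)) {..<2 ^ (k * b)}"
      using c by (simp add: inj_on_def)
    have "(\<lambda>Y. code m Y * (2 ^ (2 * m)) ^ (j - 1)) ` {..<2 ^ (k * b)} \<subseteq> {0<..<2 ^ b'}"
      using field_bounds[OF _ j False] by auto
    then have "inj_on (e b' \<circ> (\<lambda>Y. code m Y * (2 ^ (2 * m)) ^ (j - 1))) {..<2 ^ (k * b)}"
      using comp_inj_on[OF inj' inj_on_subset[OF inj]] by blast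
    then show ?thesis
      using False by (simp add: enc_def[abs_def] comp_def)
  qed
qed

lemma inj_on_word: "j < k \<Longrightarrow> inj_on (\<lambda>Y. bits b' (enc j Y)) {..<2 ^ (k * b)}"
  using comp_inj_on[OF inj_on_enc inj_on_subset[OF inj_on_bits[of b']], of j] enc_less[of _ j]
  by (auto simp: comp_def image_subset_iff)

lemma words_of_bij:
  "bij_betw words_of {..<2 ^ (k * b)} {ws. length ws = k \<and> (\<forall>u\<in>set ws. length u = b)}"
proof (rule bij_betwI')
  fix Y Z :: nat assume "Y \<in> {..<2 ^ (k * b)}" "Z \<in> {..<2 ^ (k * b)}"
  then have *: "Y < 2 ^ (k * b)" "Z < 2 ^ (k * b)" by auto
  have "map val (words_of X) = map (\<lambda>j. digit b j X) [0..<k]" for X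
    by (simp add: words_of_def val_bits)
  then show "words_of Y = words_of Z \<longleftrightarrow> Y = Z"
    using horner_sum_digit[OF *(1)] horner_sum_digit[OF *(2)] by metis
next
  show "words_of Y \<in> {ws. length ws = k \<and> (\<forall>u\<in>set ws. length u = b)}" for Y
    by (auto simp: words_of_def)
next
  fix ws :: "bitvec list" assume "ws \<in> {ws. length ws = k \<and> (\<forall>u\<in>set ws. length u = b)}"
  then have ws: "length ws = k" "\<And>i. i < k \<Longrightarrow> length (ws ! i) = b"
    by auto
  define Y where "Y = horner_sum (\<lambda>x. x) (2 ^ b) (map val ws)"
  have less: "\<forall>y\<in>set (map val ws). y < 2 ^ b"
    using ws val_less by (metis (no_types, lifting) in_set_conv_nth length_map nth_map)
  have "Y < (2 ^ b) ^ k"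
    unfolding Y_def using digits_less[OF less] ws by simp
  moreover have "words_of Y = ws"
    using ws digit_horner_sum[OF less]
    by (intro nth_equalityI) (simp_all add: words_of_def Y_def bits_val)
  ultimately show "\<exists>Y\<in>{..<2 ^ (k * b)}. ws = words_of Y"
    by (metis lessThan_iff mult.commute power_mult)
qed

lemma words_of_surj:
  assumes "length ws = k" "\<forall>u\<in>set ws. length u = b"
  obtains Y where "Y < 2 ^ (k * b)" "words_of Y = ws"
proof -
  have "ws \<in> words_of ` {..<2 ^ (k * b)}"
    unfolding bij_betw_imp_surj_on[OF words_of_bij] using assms by simp
  with that show ?thesis by blast
qed

text \<open>Both the old and the new inner sum are brought to this number of codes;
  \<open>sum_new_words\<close> is the counterpart.\<close>

lemma sum_words:
  assumes "length Ss = k" "\<forall>S\<in>set Ss. S \<subseteq> {u. length u = b}"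
  shows "(\<Sum>ws\<in>listset Ss. of_bool (f b ws)) =
    card {Y. Y < 2 ^ (k * b) \<and> sat Y \<and> (\<forall>j<k. bits b (digit b j Y) \<in> Ss ! j)}"
proof -
  have "finite (listset Ss)"
  proof (rule finite_listset, rule ballI)
    fix S assume "S \<in> set Ss"
    then have "S \<subseteq> {u. length u = b}" using assms by blast
    moreover have "finite {u :: bitvec. length u = b}"
      using finite_lists_length_eq[of "UNIV :: bool set" b] by simp
    ultimately show "finite S" by (rule finite_subset)
  qed
  then have "(\<Sum>ws\<in>listset Ss. of_bool (f b ws)) = card (listset Ss \<inter> {ws. f b ws})"
    by simp
  also have "listset Ss \<inter> {ws. f b ws} =
      words_of ` {Y. Y < 2 ^ (k * b) \<and> sat Y \<and> (\<forall>j<k. bits b (digit b j Y) \<in> Ss ! j)}" (is "?L = ?R")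
  proof (intro equalityI subsetI)
    fix ws assume ws: "ws \<in> ?L"
    then have *: "length ws = k" "\<forall>j<k. ws ! j \<in> Ss ! j" "f b ws"
      using assms by (auto simp: in_listset_iff)
    then have "\<forall>u\<in>set ws. length u = b"
      using assms by (fastforce simp: in_set_conv_nth subset_iff)
    with *(1) obtain Y where "Y < 2 ^ (k * b)" "words_of Y = ws"
      by (rule words_of_surj)
    moreover from this *(1,2) have "\<forall>j<k. bits b (digit b j Y) \<in> Ss ! j"
      by (auto simp: words_of_def)
    ultimately show "ws \<in> ?R"
      using *(3) by (intro image_eqI[of _ _ Y]) (simp_all add: sat_def)
  qed (use assms in \<open>auto simp: in_listset_iff sat_def words_of_def\<close>)
  also have "card \<dots> = card {Y. Y < 2 ^ (k * b) \<and> sat Y \<and> (\<forall>j<k. bits b (digit b j Y) \<in> Ss ! j)}"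
    by (intro card_image inj_on_subset[OF bij_betw_imp_inj_on[OF words_of_bij]] subsetI) simp
  finally show ?thesis .
qed

lemma enc_tests_equality:
  assumes "\<forall>j<k. F j < 2 ^ (k * b)"
  shows "f' b' (map (\<lambda>j. bits b' (enc j (F j))) [0..<k]) \<longleftrightarrow> (\<forall>j<k. F j = F 0)"
proof -
  define ys where "ys = map (\<lambda>i. F (Suc i)) [0..<k - 1]"
  obtain l where l: "k = Suc l"
    using k by (cases k) auto
  have "[0..<k] = 0 # map Suc [0..<k - 1]"
    by (simp add: l upt_conv_Cons map_Suc_upt del: upt_Suc)
  then have "map (\<lambda>j. enc j (F j)) [0..<k] = eq_words m (e b') (F 0) ys"
    by (simp add: eq_words_def ys_def enc_def comp_def)
  then have "map (\<lambda>j. bits b' (enc j (F j))) [0..<k] = map (bits b') (eq_words m (e b') (F 0) ys)"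
    by (metis (no_types, lifting) comp_apply map_eq_conv map_map)
  moreover have "\<forall>y\<in>set (F 0 # ys). y < 2 ^ m"
    using assms k less_code_range by (simp add: ys_def)
  ultimately have "f' b' (map (\<lambda>j. bits b' (enc j (F j))) [0..<k]) \<longleftrightarrow> (\<forall>y\<in>set ys. y = F 0)"
    using tests_eq m_pos fields_fit unfolding tests_equality_def by (simp add: ys_def)
  also have "\<dots> \<longleftrightarrow> (\<forall>i<l. F (Suc i) = F 0)"
    by (auto simp: ys_def l)
  also have "\<dots> \<longleftrightarrow> (\<forall>j<k. F j = F 0)"
    by (simp add: l All_less_Suc2)
  finally show ?thesis .
qed

lemma finite_new_set: "finite (new_set j S)"
  by (simp add: new_set_def)

text \<open>New words that pass the equality test all come from one code, so the accepted tuples are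
  the diagonal images of codes. Each code with all its components in the given sets contributes
  exactly one of them.\<close>

lemma sum_new_words:
  assumes "length Ss = k"
  shows "(\<Sum>ws\<in>listset (map (\<lambda>j. new_set j (Ss ! j)) [0..<k]). of_bool (f' b' ws)) =
    card {Y. Y < 2 ^ (k * b) \<and> sat Y \<and> (\<forall>j<k. bits b (digit b j Y) \<in> Ss ! j)}"
proof -
  let ?h = "\<lambda>Y. map (\<lambda>j. bits b' (enc j Y)) [0..<k]"
  let ?N = "listset (map (\<lambda>j. new_set j (Ss ! j)) [0..<k])"
  have "finite ?N"
    by (rule finite_listset) (auto simp: finite_new_set)
  then have "(\<Sum>ws\<in>?N. of_bool (f' b' ws)) = card (?N \<inter> {ws. f' b' ws})"
    by simp
  also have "?N \<inter> {ws. f' b' ws} =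
      ?h ` {Y. Y < 2 ^ (k * b) \<and> sat Y \<and> (\<forall>j<k. bits b (digit b j Y) \<in> Ss ! j)}" (is "?L = ?R")
  proof (intro equalityI subsetI)
    fix ws assume ws: "ws \<in> ?L"
    then have len: "length ws = k" and "\<forall>j<k. ws ! j \<in> new_set j (Ss ! j)" and f': "f' b' ws"
      by (auto simp: in_listset_iff)
    then have "\<forall>j<k. \<exists>Y. Y < 2 ^ (k * b) \<and> sat Y \<and> bits b (digit b j Y) \<in> Ss ! j \<and> ws ! j = bits b' (enc j Y)"
      by (auto simp: new_set_def image_iff)
    then obtain F where F: "\<And>j. j < k \<Longrightarrow> F j < 2 ^ (k * b) \<and> sat (F j) \<and>
        bits b (digit b j (F j)) \<in> Ss ! j \<and> ws ! j = bits b' (enc j (F j))"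
      by metis
    then have "ws = map (\<lambda>j. bits b' (enc j (F j))) [0..<k]"
      using len by (intro nth_equalityI) auto
    moreover from this have F0: "F j = F 0" if "j < k" for j
      using f' enc_tests_equality[of F] F that by blast
    ultimately have "ws = ?h (F 0)"
      using len by (intro nth_equalityI) (simp_all add: F0[symmetric])
    moreover have "bits b (digit b j (F 0)) \<in> Ss ! j" if "j < k" for j
      using F[OF that] F0[OF that] by simp
    moreover have "0 < k" using k by simp
    ultimately show "ws \<in> ?R"
      using F[of 0] by blast
  next
    fix ws assume "ws \<in> ?R"
    then obtain Y where "Y < 2 ^ (k * b)" "sat Y" "\<forall>j<k. bits b (digit b j Y) \<in> Ss ! j" "ws = ?h Y"
      by blast
    then show "ws \<in> ?L"
      using enc_tests_equality[of "\<lambda>_. Y"] by (auto simp: in_listset_iff new_set_def)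
  qed
  also have "card \<dots> = card {Y. Y < 2 ^ (k * b) \<and> sat Y \<and> (\<forall>j<k. bits b (digit b j Y) \<in> Ss ! j)}"
  proof (rule card_image, rule inj_onI)
    fix Y Z assume *: "Y \<in> {Y. Y < 2 ^ (k * b) \<and> sat Y \<and> (\<forall>j<k. bits b (digit b j Y) \<in> Ss ! j)}"
      "Z \<in> {Y. Y < 2 ^ (k * b) \<and> sat Y \<and> (\<forall>j<k. bits b (digit b j Y) \<in> Ss ! j)}" "?h Y = ?h Z"
    \<comment> \<open>The word at position 0 alone already determines the code.\<close>
    have "?h Y ! 0 = ?h Z ! 0"
      by (simp only: *(3))
    then have "bits b' (enc 0 Y) = bits b' (enc 0 Z)"
      using k by simp
    then show "Y = Z"
      using inj_onD[OF inj_on_word[of 0], of Y Z] * k by simp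
  qed
  finally show ?thesis .
qed

text \<open>By extendability a word \<open>u\<close> of \<open>S\<close> has an accepted code with
  \<open>u\<close> at position \<open>j\<close>. As encoding is injective, this code shows up in the
  image of another set only if that set contains \<open>u\<close> too.\<close>

lemma inj_on_new_set:
  assumes j: "j < k"
  shows "inj_on (new_set j) (Pow {u. length u = b})"
proof (rule inj_onI)
  have sub: "S \<subseteq> S'" if S: "S \<subseteq> {u. length u = b}" and eq: "new_set j S = new_set j S'" for S S'
  proof
    fix u assume u: "u \<in> S"
    then have "length u = b" using S by blast
    then have "val u < 2 ^ b" using val_less[of u] by simp
    then obtain ys where ys: "length ys = k" "\<forall>y\<in>set ys. y < 2 ^ b" "ys ! j = val u" "f b (map (bits b) ys)"
      using extendable j unfolding extendable_def by meson
    have "length (map (bits b) ys) = k" "\<forall>u\<in>set (map (bits b) ys). length u = b"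
      using ys(1) by auto
    then obtain Y where Y: "Y < 2 ^ (k * b)" "words_of Y = map (bits b) ys"
      by (rule words_of_surj)
    have "bits b (digit b j Y) = words_of Y ! j"
      using j by (simp add: words_of_def)
    also have "\<dots> = u"
      using Y(2) ys(1,3) j \<open>length u = b\<close> by (simp add: bits_val)
    finally have dj: "bits b (digit b j Y) = u" .
    then have "bits b' (enc j Y) \<in> new_set j S"
      using Y ys(4) u unfolding new_set_def by (auto simp: sat_def)
    then obtain Z where "Z < 2 ^ (k * b)" "bits b (digit b j Z) \<in> S'" "bits b' (enc j Y) = bits b' (enc j Z)"
      unfolding eq by (auto simp: new_set_def)
    moreover from this have "Y = Z"
      using inj_onD[OF inj_on_word[OF j], of Y Z] Y(1) by simp
    ultimately show "u \<in> S'"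
      using dj by simp
  qed
  show "S = S'" if "S \<in> Pow {u. length u = b}" "S' \<in> Pow {u. length u = b}" "new_set j S = new_set j S'" for S S'
    using sub[of S S'] sub[of S' S] that by simp
qed

lemma inj_on_new_fvec:
  assumes "j < k"
  shows "inj_on (map (new_set j)) (factored_vectors g b)"
proof (rule inj_onI)
  fix v v' assume v: "v \<in> factored_vectors g b" "v' \<in> factored_vectors g b" "map (new_set j) v = map (new_set j) v'"
  then have "inj_on (new_set j) (set v \<union> set v')"
    by (intro inj_on_subset[OF inj_on_new_set[OF assms]]) (auto simp: factored_vectors_def)
  then show "v = v'"
    using v(3) by (simp add: inj_on_map_eq_map)
qed

context
  fixes n :: nat and V :: "fvec set list"
  assumes V: "factored_instance k n g b V"
begin

lemma V_length: "length V = k"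
  and V_nth: "j < k \<Longrightarrow> V ! j \<subseteq> factored_vectors g b \<and> finite (V ! j) \<and> card (V ! j) = n"
  using V unfolding factored_instance_def by auto

lemma new_family_instance: "factored_instance k n g b' (new_family V)"
proof -
  have "map (new_set j) ` (V ! j) \<subseteq> factored_vectors g b'" if "j < k" for j
    using V_nth[OF that] by (auto simp: factored_vectors_def new_set_def)
  moreover have "card (map (new_set j) ` (V ! j)) = n" if "j < k" for j
    using V_nth[OF that] inj_on_new_fvec[OF that] by (metis card_image inj_on_subset)
  ultimately show ?thesis
    using V_nth unfolding factored_instance_def new_family_def by auto
qed

lemma factored_count_new_family: "factored_count (f' b') g (new_family V) = factored_count (f b) g V"
proof -
  let ?\<Phi> = "\<lambda>vs. map (\<lambda>j. map (new_set j) (vs ! j)) [0..<k]"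
  have "listset (new_family V) = ?\<Phi> ` listset V"
  proof (intro equalityI subsetI)
    fix vs' assume "vs' \<in> listset (new_family V)"
    then have len: "length vs' = k" and "\<forall>j<k. \<exists>v\<in>V ! j. vs' ! j = map (new_set j) v"
      by (auto simp: in_listset_iff new_family_def)
    then obtain F where F: "\<And>j. j < k \<Longrightarrow> F j \<in> V ! j \<and> vs' ! j = map (new_set j) (F j)"
      by metis
    then have "vs' = ?\<Phi> (map F [0..<k])" "map F [0..<k] \<in> listset V"
      using len V_length by (auto simp: in_listset_iff intro!: nth_equalityI)
    then show "vs' \<in> ?\<Phi> ` listset V" by blast
  qed (auto simp: in_listset_iff new_family_def V_length)
  moreover have "inj_on ?\<Phi> (listset V)"
  proof (rule inj_onI)
    fix vs us assume vs: "vs \<in> listset V" "us \<in> listset V" "?\<Phi> vs = ?\<Phi> us"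
    have "vs ! j = us ! j" if "j < k" for j
    proof -
      have "map (new_set j) (vs ! j) = map (new_set j) (us ! j)"
        using vs(3) that by simp
      moreover have "vs ! j \<in> factored_vectors g b" "us ! j \<in> factored_vectors g b"
        using vs(1,2) that V_nth[OF that] V_length by (auto simp: in_listset_iff)
      ultimately show ?thesis
        using inj_onD[OF inj_on_new_fvec[OF that]] by blast
    qed
    then show "vs = us"
      using vs(1,2) V_length by (intro nth_equalityI) (auto simp: in_listset_iff)
  qed
  ultimately have "factored_count (f' b') g (new_family V) =
      (\<Sum>vs\<in>listset V. \<Prod>i<g. \<Sum>ws\<in>listset (map (\<lambda>v. v ! i) (?\<Phi> vs)). of_bool (f' b' ws))"
    unfolding factored_count_def by (simp add: sum.reindex)
  also have "\<dots> = factored_count (f b) g V"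
    unfolding factored_count_def
  proof (rule sum.cong[OF refl], rule prod.cong[OF refl])
    fix vs i assume vs: "vs \<in> listset V" and i: "i \<in> {..<g}"
    have len: "length vs = k"
      using vs V_length by (simp add: in_listset_iff)
    have mem: "vs ! j \<in> factored_vectors g b" if "j < k" for j
      using vs V_length V_nth[OF that] that by (auto simp: in_listset_iff)
    define Ss where "Ss = map (\<lambda>v. v ! i) vs"
    have eq: "map (\<lambda>v. v ! i) (?\<Phi> vs) = map (\<lambda>j. new_set j (Ss ! j)) [0..<k]"
      using mem i len by (auto simp: Ss_def factored_vectors_def)
    have len': "length Ss = k"
      by (simp add: Ss_def len)
    have sub: "\<forall>S\<in>set Ss. S \<subseteq> {u. length u = b}"
    proof
      fix S assume "S \<in> set Ss"
      then obtain j where "j < k" "S = vs ! j ! i"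
        using len by (auto simp: Ss_def in_set_conv_nth)
      then show "S \<subseteq> {u. length u = b}"
        using mem[of j] i by (auto simp: factored_vectors_def dest: nth_mem)
    qed
    show "(\<Sum>ws\<in>listset (map (\<lambda>v. v ! i) (?\<Phi> vs)). of_bool (f' b' ws)) =
        (\<Sum>ws\<in>listset (map (\<lambda>v. v ! i) vs). of_bool (f b ws) :: nat)"
      unfolding eq Ss_def[symmetric] sum_words[OF len' sub] sum_new_words[OF len'] ..
  qed
  finally show ?thesis .
qed

end

lemma set_new_list:
  assumes "\<forall>x\<in>set xs. length x = b"
  shows "set (new_list j xs) = new_set j (set xs)"
proof -
  have "digit b j Y = val x \<longleftrightarrow> bits b (digit b j Y) = x" if "x \<in> set xs" for Y x
    using assms that by (metis bits_val digit_less val_bits)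
  then show ?thesis
    unfolding new_list_def new_set_def by auto
qed

lemma distinct_new_list:
  assumes "j < k" "distinct xs" "\<forall>x\<in>set xs. length x = b"
  shows "distinct (new_list j xs)"
  using assms(2,3)
proof (induction xs)
  case Nil
  then show ?case by (simp add: new_list_def)
next
  case (Cons x xs)
  let ?l = "map (\<lambda>Y. bits b' (enc j Y)) (filter (\<lambda>Y. sat Y \<and> digit b j Y = val x) (rev [0..<2 ^ (k * b)]))"
  have "new_list j (x # xs) = ?l @ new_list j xs"
    by (simp add: new_list_def)
  moreover have "distinct ?l"
    unfolding distinct_map
    by (auto intro: inj_on_subset[OF inj_on_word[OF assms(1)]])
  \<comment> \<open>Digit \<open>j\<close> of a code determines the word that generated it, so lists
    for different words share no code.\<close>
  moreover have "set ?l \<inter> set (new_list j xs) = {}"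
  proof -
    have "Y = Z" if "Y < 2 ^ (k * b)" "Z < 2 ^ (k * b)" "bits b' (enc j Y) = bits b' (enc j Z)" for Y Z
      using inj_onD[OF inj_on_word[OF assms(1)] that(3)] that by simp
    moreover have "val x \<noteq> val u" if "u \<in> set xs" for u
      using Cons.prems that by (metis bits_val distinct.simps(2) list.set_intros)
    moreover have "\<exists>u\<in>set xs. \<exists>Z<2 ^ (k * b). digit b j Z = val u \<and> y = bits b' (enc j Z)"
      if "y \<in> set (new_list j xs)" for y
      using that by (auto simp: new_list_def)
    ultimately show ?thesis
      by (auto simp: disjoint_iff) (metis (no_types))
  qed
  ultimately show ?case
    using Cons by simp
qed

lemma new_lists_represent:
  assumes V: "factored_instance k n g b V" and I: "list_all2 lists_fvecs I V"
  shows "list_all2 lists_fvecs (new_lists I) (new_family V)"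
proof -
  have len: "length I = k" "length V = k"
    using V I by (auto simp: factored_instance_def dest: list_all2_lengthD)
  have "lists_fvecs (map (map (new_list j)) (I ! j)) (map (new_set j) ` (V ! j))" if j: "j < k" for j
  proof -
    have "lists_fvecs (I ! j) (V ! j)"
      using I j len by (simp add: list_all2_conv_all_nth)
    then obtain vs where vs: "distinct vs" "set vs = V ! j" "list_all2 lists_fvec (I ! j) vs"
      by (auto simp: lists_fvecs_def)
    have sub: "set vs \<subseteq> factored_vectors g b"
      using V_nth[OF V j] vs(2) by simp
    have "lists_fvec (map (new_list j) xss) (map (new_set j) v)" if "lists_fvec xss v" "v \<in> set vs" for xss v
    proof -
      have xss: "\<forall>xs\<in>set xss. distinct xs" "v = map set xss"
        using that(1) by (auto simp: lists_fvec_def)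
      have "\<forall>xs\<in>set xss. \<forall>x\<in>set xs. length x = b"
        using xss(2) subsetD[OF sub that(2)] by (auto simp: factored_vectors_def)
      then show ?thesis
        using xss distinct_new_list[OF j] set_new_list by (auto simp: lists_fvec_def)
    qed
    then have "list_all2 lists_fvec (map (map (new_list j)) (I ! j)) (map (map (new_set j)) vs)"
      using vs(3) by (auto simp: list_all2_conv_all_nth)
    moreover have "distinct (map (map (new_set j)) vs)"
      using vs(1) inj_on_subset[OF inj_on_new_fvec[OF j] sub] by (simp add: distinct_map)
    ultimately show ?thesis
      unfolding lists_fvecs_def using vs(2)
      by (intro exI[of _ "map (map (new_set j)) vs"]) simp
  qed
  then show ?thesis
    by (simp add: new_lists_def new_family_def list_all2_conv_all_nth)
qed

end

section \<open>Every solver reads most of its input\<close>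

text \<open>
  If the words of the first family start with \<open>True\<close> and all others with \<open>q\<close>, no tuple
  is accepted; putting the zero word into a single set of the first family creates a witness.
\<close>

definition separates :: "nat \<Rightarrow> (nat \<Rightarrow> bitvec list \<Rightarrow> bool) \<Rightarrow> bool \<Rightarrow> bool" where
  "separates k f q \<longleftrightarrow> (\<forall>b\<ge>2.
     (\<forall>ws. length ws = k \<longrightarrow> (\<forall>u\<in>set ws. length u = b) \<longrightarrow> ws ! 0 ! 0 \<longrightarrow>
       (\<forall>j. 0 < j \<longrightarrow> j < k \<longrightarrow> ws ! j ! 0 = q) \<longrightarrow> \<not> f b ws) \<and>
     f b (replicate k (replicate b False)) \<and>
     f b (replicate b False # replicate (k - 1) (q # replicate (b - 1) False)))"

lemma val_replicate_False [simp]: "val (replicate b False) = 0"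
  by (induction b) auto

text \<open>If all words start with a one, column 0 violates orthogonality; a single zero word
  clears every column.\<close>

lemma separates_ov:
  assumes "k \<ge> 2"
  shows "separates k ov_pred True"
  unfolding separates_def
proof (intro allI impI conjI)
  fix b :: nat and ws :: "bitvec list"
  assume "2 \<le> b" and ws: "length ws = k" "ws ! 0 ! 0" "\<forall>j. 0 < j \<longrightarrow> j < k \<longrightarrow> ws ! j ! 0 = True"
  have "ws ! j ! 0" if "j < k" for j
    using ws(2,3) that by (cases "j = 0") auto
  then have "(\<Prod>j<length ws. of_bool (ws ! j ! 0)) \<noteq> (0::nat)"
    using ws(1) by simp
  then show "\<not> ov_pred b ws"
    using \<open>2 \<le> b\<close> unfolding ov_pred_def by (auto intro!: bexI[of _ 0])
next
  fix b :: nat assume "2 \<le> b"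
  show "ov_pred b (replicate k (replicate b False))"
    using assms by (auto simp: ov_pred_def intro!: bexI[of _ 0])
  show "ov_pred b (replicate b False # replicate (k - 1) (True # replicate (b - 1) False))"
    using assms by (auto simp: ov_pred_def intro!: bexI[of _ 0])
qed

lemma foldr_map2_neq_replicate:
  "foldr (map2 (\<noteq>)) (replicate l (replicate b False)) (replicate b False) = replicate b False"
proof -
  have "map2 (\<noteq>) (replicate b False) (replicate b False) = replicate b False"
    by (induction b) auto
  then show ?thesis
    by (induction l) (simp_all del: foldr_replicate)
qed

lemma foldr_map2_neq_hd:
  assumes "\<forall>u\<in>set ws. length u = b \<and> \<not> u ! 0" "b > 0"
  shows "length (foldr (map2 (\<noteq>)) ws (replicate b False)) = b \<and>
    \<not> foldr (map2 (\<noteq>)) ws (replicate b False) ! 0"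
  using assms by (induction ws) auto

text \<open>Only the first word has a one at index 0, so it survives in the xor.\<close>

lemma separates_xor:
  assumes "k \<ge> 2"
  shows "separates k xor_pred False"
  unfolding separates_def
proof (intro allI impI conjI)
  fix b :: nat and ws :: "bitvec list"
  assume b: "2 \<le> b" and ws: "length ws = k" "\<forall>u\<in>set ws. length u = b" "ws ! 0 ! 0"
    "\<forall>j. 0 < j \<longrightarrow> j < k \<longrightarrow> ws ! j ! 0 = False"
  obtain u us where us: "ws = u # us"
    using ws(1) assms by (cases ws) auto
  have "\<not> x ! 0" if x: "x \<in> set us" for x
  proof -
    obtain i where "i < length us" "x = us ! i"
      using x by (auto simp: in_set_conv_nth)
    then show ?thesis
      using ws(4)[rule_format, of "Suc i"] ws(1) us by auto
  qed
  then have "foldr (map2 (\<noteq>)) ws (replicate b False) ! 0"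
    using foldr_map2_neq_hd[of us b] ws(2,3) us b by simp
  then show "\<not> xor_pred b ws"
    using b unfolding xor_pred_def by (metis nth_replicate pos2 order_less_le_trans)
next
  fix b :: nat assume "2 \<le> b"
  then have "False # replicate (b - 1) False = replicate b False"
    by (cases b) auto
  moreover have "replicate b False # replicate (k - 1) (replicate b False) = replicate k (replicate b False)"
    using assms by (cases k) auto
  moreover show "xor_pred b (replicate k (replicate b False))"
    by (simp only: xor_pred_def foldr_map2_neq_replicate)
  ultimately show "xor_pred b (replicate b False # replicate (k - 1) (False # replicate (b - 1) False))"
    by simp
qed

text \<open>Index 0 is the least significant bit, so exactly one summand is odd. An odd sum is
  nonzero modulo the even number \<open>2 ^ b\<close>.\<close>

lemma separates_sum:
  assumes "k \<ge> 2"
  shows "separates k sum_pred False"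
  unfolding separates_def
proof (intro allI impI conjI)
  fix b :: nat and ws :: "bitvec list"
  assume b: "2 \<le> b" and ws: "length ws = k" "\<forall>u\<in>set ws. length u = b" "ws ! 0 ! 0"
    "\<forall>j. 0 < j \<longrightarrow> j < k \<longrightarrow> ws ! j ! 0 = False"
  obtain u us where us: "ws = u # us"
    using ws(1) assms by (cases ws) auto
  have parity: "even (val x) \<longleftrightarrow> \<not> x ! 0" if "length x = b" for x
    using that b by (cases x) auto
  have "even (val x)" if x: "x \<in> set us" for x
  proof -
    obtain i where "i < length us" "x = us ! i"
      using x by (auto simp: in_set_conv_nth)
    then show ?thesis
      using ws(4)[rule_format, of "Suc i"] ws(1,2) us parity by auto
  qed
  then have "even (sum_list (map val us))"
    by (induction us) auto
  then have "odd (sum_list (map val ws))"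
    using ws(2,3) us parity by simp
  then show "\<not> sum_pred b ws"
    using b unfolding sum_pred_def
    by (metis dvd_power dvd_trans mod_0_imp_dvd order_less_le_trans pos2)
next
  fix b :: nat assume "2 \<le> b"
  then have "False # replicate (b - 1) False = replicate b False"
    by (cases b) auto
  then show "sum_pred b (replicate b False # replicate (k - 1) (False # replicate (b - 1) False))"
    by (simp add: sum_pred_def sum_list_replicate)
  show "sum_pred b (replicate k (replicate b False))"
    by (simp add: sum_pred_def sum_list_replicate)
qed

lemma factored_count_pos_iff:
  assumes "\<forall>U\<in>set V. finite U" "\<forall>U\<in>set V. \<forall>v\<in>U. \<forall>i<g. finite (v ! i)"
  shows "factored_count f g V > 0 \<longleftrightarrow>
    (\<exists>vs\<in>listset V. \<forall>i<g. \<exists>ws\<in>listset (map (\<lambda>v. v ! i) vs). f ws)"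
proof -
  have "finite (listset V)"
    using assms(1) by (rule finite_listset)
  moreover have "finite (listset (map (\<lambda>v. v ! i) vs))" if "vs \<in> listset V" "i < g" for vs i
    using that assms(2) by (intro finite_listset) (fastforce simp: in_listset_iff in_set_conv_nth)
  ultimately show ?thesis
    unfolding factored_count_def
    by (simp add: neq0_conv[symmetric] sum_eq_0_iff Ball_def Bex_def del: neq0_conv) blast
qed

lemma lists_fvecs_singletons:
  assumes "\<forall>xs\<in>set xss. distinct xs" "distinct (map set xss)"
  shows "lists_fvecs (map (\<lambda>xs. xs # replicate l [z]) xss) ((\<lambda>xs. set xs # replicate l {z}) ` set xss)"
  unfolding lists_fvecs_def
proof (intro exI conjI)
  show "distinct (map (\<lambda>xs. set xs # replicate l {z}) xss)"
    using assms(2) by (auto simp: distinct_map inj_on_def)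
  show "list_all2 lists_fvec (map (\<lambda>xs. xs # replicate l [z]) xss) (map (\<lambda>xs. set xs # replicate l {z}) xss)"
    using assms(1) by (auto simp: list_all2_conv_all_nth lists_fvec_def)
qed simp

lemma card_singletons:
  assumes "distinct (map set xss)"
  shows "card ((\<lambda>xs. set xs # replicate l {z}) ` set xss) = length xss"
proof -
  have "distinct (map (\<lambda>xs. set xs # replicate l {z}) xss)"
    using assms by (auto simp: distinct_map inj_on_def)
  from distinct_card[OF this] show ?thesis by simp
qed

text \<open>An adversary argument: an instance with count zero has \<open>n * 2 ^ (b - 2)\<close>
  cells such that clearing any one of them makes the count positive. Two bits are spent, one for
  \<open>separates\<close> and one to mark the words that tell the vectors apart. The bound on
  \<open>n\<close> supplies enough subsets of the remaining cube.\<close>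

lemma reads_lower_bound:
  assumes k: "k \<ge> 2" and f: "separates k f q" and g: "g \<ge> 1" and b: "b \<ge> 2"
    and n: "n \<le> 2 ^ 2 ^ (b - 2)"
    and solver: "\<And>V I. factored_instance k n g b V \<Longrightarrow> list_all2 lists_fvecs I V \<Longrightarrow>
      computes_within w P (encode_instance n g b I) (factored_count (f b) g V) t"
  shows "n * 2 ^ (b - 2) \<le> t"
proof (rule ccontr)
  assume "\<not> n * 2 ^ (b - 2) \<le> t"
  then have t: "t < n * 2 ^ (b - 2)" by simp
  define zero where "zero = replicate b False"
  define cube where "cube = List.n_lists (b - 2) [False, True]"
  have cube: "distinct cube" "length cube = 2 ^ (b - 2)" "set cube = {x. length x = b - 2}"
    unfolding cube_def by (auto simp: distinct_n_lists length_n_lists set_n_lists numeral_2_eq_2)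
  obtain As where As: "As \<subseteq> Pow (set cube)" "card As = n"
    using n cube obtain_subset_with_card_n[of n "Pow (set cube)"]
    by (metis card_Pow distinct_card List.finite_set)
  then obtain Ss where Ss: "set Ss = As" "distinct Ss"
    using finite_distinct_list[of As] finite_subset[of As "Pow (set cube)"] by auto
  have len_Ss: "length Ss = n"
    using Ss As distinct_card by metis
  \<comment> \<open>The copy of the cube marked \<open>False\<close> comes first and is the same for
    all \<open>S\<close>; it supplies \<open>2 ^ (b - 2)\<close> critical cells per vector. The
    words marked \<open>True\<close> encode \<open>S\<close> and make the vectors distinct.\<close>
  define xs where "xs = (\<lambda>c S. map (\<lambda>x. c # False # x) cube @ map (\<lambda>x. c # True # x) (filter (\<lambda>x. x \<in> S) cube))"
  have set_xs: "set (xs c S) = (\<lambda>x. c # False # x) ` set cube \<union> (\<lambda>x. c # True # x) ` (set cube \<inter> S)" for c S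
    by (auto simp: xs_def)
  have distinct_xs: "distinct (xs c S)" for c S
    using cube(1) by (auto simp: xs_def distinct_map inj_on_def)
  have length_word: "length u = b" "u ! 0 = c" if "u \<in> set (xs c S)" for u c S
    using that cube(3) b by (auto simp: set_xs)
  have distinct_sets: "distinct (map set (map (xs c) Ss))" for c
  proof -
    have "S = S'" if "S \<subseteq> set cube" "S' \<subseteq> set cube" "set (xs c S) = set (xs c S')" for S S'
    proof -
      have "S = {x. c # True # x \<in> set (xs c S)}" if "S \<subseteq> set cube" for S
        using that by (auto simp: set_xs)
      with that show ?thesis by metis
    qed
    then show ?thesis
      using Ss As by (auto simp: distinct_map inj_on_def)
  qed
  \<comment> \<open>All coordinates but the first are \<open>{zero}\<close>, where the all-zero
    tuple is accepted. Whether the count is positive is thus decided in the first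
    coordinate.\<close>
  define fam where "fam = map (\<lambda>ys. ys # replicate (g - 1) [zero])"
  define vecs where "vecs = (\<lambda>yss. (\<lambda>ys. set ys # replicate (g - 1) {zero}) ` set yss)"
  define hss where "hss = map (xs q) Ss"
  define I where "I = (\<lambda>yss. fam yss # replicate (k - 1) (fam hss))"
  define V where "V = (\<lambda>yss. vecs yss # replicate (k - 1) (vecs hss))"
  define good where "good = (\<lambda>yss :: bitvec list list. length yss = n \<and> (\<forall>ys\<in>set yss. distinct ys \<and> (\<forall>u\<in>set ys. length u = b)) \<and>
     distinct (map set yss))"
  have zero_len: "length zero = b" by (simp add: zero_def)
  have good_hss: "good hss"
    using distinct_xs length_word distinct_sets len_Ss unfolding good_def hss_def by auto
  have inst: "factored_instance k n g b (V yss)" "list_all2 lists_fvecs (I yss) (V yss)" if "good yss" for yss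
  proof -
    have "vecs zss \<subseteq> factored_vectors g b" if "good zss" for zss
      using that g zero_len by (auto simp: vecs_def good_def factored_vectors_def)
    moreover have "card (vecs zss) = n" if "good zss" for zss
      using that unfolding vecs_def good_def by (auto simp: card_singletons)
    moreover have "finite (vecs zss)" for zss
      by (simp add: vecs_def)
    ultimately show "factored_instance k n g b (V yss)"
      using that good_hss k by (auto simp: factored_instance_def V_def)
    have "lists_fvecs (fam zss) (vecs zss)" if "good zss" for zss
      using that unfolding fam_def vecs_def good_def by (intro lists_fvecs_singletons) auto
    then show "list_all2 lists_fvecs (I yss) (V yss)"
      using that good_hss by (auto simp: I_def V_def list_all2_conv_all_nth nth_Cons split: nat.split)
  qed
  have count: "factored_count (f b) g (V yss) > 0 \<longleftrightarrow>
    (\<exists>vs\<in>listset (V yss). \<forall>i<g. \<exists>ws\<in>listset (map (\<lambda>v. v ! i) vs). f b ws)" for yss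
    by (rule factored_count_pos_iff) (auto simp: V_def vecs_def nth_Cons split: nat.split)
  have comp: "computes_within w P (encode_instance n g b (I yss)) (factored_count (f b) g (V yss)) t"
    if "good yss" for yss
    using solver inst that by blast

  define xss where "xss = map (xs True) Ss"
  have good_xss: "good xss"
    using distinct_xs length_word distinct_sets len_Ss unfolding good_def xss_def by auto
  have len_xss: "length xss = n" by (simp add: xss_def len_Ss)
  have xss_nth: "\<exists>S. xss ! i = xs True S" if "i < n" for i
    using that len_Ss by (auto simp: xss_def)
  have len_xss_nth: "2 ^ (b - 2) \<le> length (xss ! i)" if "i < n" for i
    using xss_nth[OF that] cube(2) by (auto simp: xs_def)
  have "\<not> factored_count (f b) g (V xss) > 0"
  proof
    assume "factored_count (f b) g (V xss) > 0"
    then obtain vs ws where vs: "vs \<in> listset (V xss)" and ws: "ws \<in> listset (map (\<lambda>v. v ! 0) vs)" "f b ws"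
      using count g by (metis less_le_trans zero_less_one)
    have len: "length vs = k" "length ws = k"
      using vs ws k by (auto simp: in_listset_iff V_def simp del: listset.simps)
    have vs_nth: "vs ! j \<in> (if j = 0 then vecs xss else vecs hss)" if "j < k" for j
      using vs that by (cases j) (auto simp: in_listset_iff V_def simp del: listset.simps)
    have "\<exists>S. ws ! j \<in> set (xs (if j = 0 then True else q) S)" if "j < k" for j
    proof -
      have "ws ! j \<in> vs ! j ! 0"
        using ws(1) len that by (auto simp: in_listset_iff)
      then show ?thesis
        using vs_nth[OF that] by (auto simp: vecs_def xss_def hss_def split: if_splits)
    qed
    then have wsj: "length (ws ! j) = b" "ws ! j ! 0 = (if j = 0 then True else q)" if "j < k" for j
      using length_word that by metis+
    have "\<forall>u\<in>set ws. length u = b"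
      using wsj(1) len by (auto simp: in_set_conv_nth)
    moreover have "ws ! 0 ! 0" "\<forall>j. 0 < j \<longrightarrow> j < k \<longrightarrow> ws ! j ! 0 = q"
      using wsj(2) k by auto
    ultimately have "\<not> f b ws"
      using f b len unfolding separates_def by blast
    with ws show False by simp
  qed
  then have count0: "factored_count (f b) g (V xss) = 0" by simp

  \<comment> \<open>\<open>zero\<close> is absent from the set and is encoded as 0, so the
    substitution preserves the cardinality and changes a single cell.\<close>
  define modified where "modified = (\<lambda>i j. xss[i := (xss ! i)[j := zero]])"
  have zero_notin: "zero \<notin> set (xss ! i)" if "i < n" for i
    using xss_nth[OF that] length_word(2)[of zero True] b by (auto simp: zero_def)
  have good_mod: "good (modified i j)" if i: "i < n" "j < 2 ^ (b - 2)" for i j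
  proof -
    have "distinct ((xss ! i)[j := zero])"
      using good_xss i len_xss zero_notin[OF i(1)] by (intro distinct_list_update) (auto simp: good_def)
    moreover have "\<forall>u\<in>set ((xss ! i)[j := zero]). length u = b"
      using xss_nth[OF i(1)] length_word(1) zero_len set_update_subset_insert[of "xss ! i" j zero]
      by (metis insert_iff subsetD)
    moreover have "distinct (map set (modified i j))"
    proof -
      have "zero \<in> set ((xss ! i)[j := zero])"
        using i len_xss_nth[OF i(1)] by (intro set_update_memI) simp
      moreover have "zero \<notin> set ys" if "ys \<in> set xss" for ys
      proof -
        obtain l where "l < n" "ys = xss ! l"
          using \<open>ys \<in> set xss\<close> len_xss by (auto simp: in_set_conv_nth)
        then show ?thesis
          using zero_notin by blast
      qed
      \<comment> \<open>The modified set is the only one that contains \<open>zero\<close>, so the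
        vectors remain distinct.\<close>
      ultimately have "set ((xss ! i)[j := zero]) \<notin> set (map set xss)"
        by auto
      then show ?thesis
        unfolding modified_def map_update
        using good_xss by (intro distinct_list_update) (auto simp: good_def)
    qed
    ultimately show ?thesis
      using good_xss set_update_subset_insert[of xss i "(xss ! i)[j := zero]"]
      unfolding good_def modified_def by auto
  qed
  have count_mod: "factored_count (f b) g (V (modified i j)) > 0" if i: "i < n" "j < 2 ^ (b - 2)" for i j
  proof -
    let ?ys = "(xss ! i)[j := zero]"
    have ys: "?ys \<in> set (modified i j)" "zero \<in> set ?ys"
      using i len_xss len_xss_nth[OF i(1)] unfolding modified_def by (auto intro!: set_update_memI)
    define h where "h = q # replicate (b - 1) False"
    have hs: "hss ! i \<in> set hss" "h \<in> set (hss ! i)"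
    proof -
      have "h = q # False # replicate (b - 2) False"
        using b by (simp add: h_def numeral_2_eq_2 flip: replicate_Suc)
      then show "h \<in> set (hss ! i)"
        using i len_Ss cube(3) by (auto simp: hss_def set_xs)
    qed (use i len_Ss in \<open>auto simp: hss_def\<close>)
    define vs where "vs = (set ?ys # replicate (g - 1) {zero}) #
      replicate (k - 1) (set (hss ! i) # replicate (g - 1) {zero})"
    have "vs \<in> listset (V (modified i j))"
      using ys hs unfolding vs_def V_def vecs_def by (auto simp: in_listset_iff nth_Cons simp del: listset.simps split: nat.split)
    moreover have "\<exists>ws\<in>listset (map (\<lambda>v. v ! i') vs). f b ws" if "i' < g" for i'
    proof (cases i')
      case 0
      have "zero # replicate (k - 1) h \<in> listset (map (\<lambda>v. v ! i') vs)"
        using 0 ys hs by (auto simp: vs_def in_listset_iff nth_Cons simp del: listset.simps split: nat.split)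
      moreover have "f b (zero # replicate (k - 1) h)"
        using f b unfolding separates_def zero_def h_def by blast
      ultimately show ?thesis by blast
    next
      case (Suc i'')
      have "replicate k zero \<in> listset (map (\<lambda>v. v ! i') vs)"
        using Suc \<open>i' < g\<close> k by (auto simp: vs_def in_listset_iff nth_Cons simp del: listset.simps split: nat.split)
      moreover have "f b (replicate k zero)"
        using f b unfolding separates_def zero_def by blast
      ultimately show ?thesis by blast
    qed
    ultimately show ?thesis
      unfolding count by blast
  qed

  define block where "block = (\<lambda>yss. concat (map encode_set (concat (fam yss))))"
  define post where "post = concat (map encode_set (concat (concat (replicate (k - 1) (fam hss)))))"
  have enc: "encode_instance n g b (I yss) = [n, g, b] @ block yss @ post" for yss
    by (simp add: encode_instance_def I_def block_def post_def)
  have block_append: "block (yss @ zss) = block yss @ block zss" for yss zss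
    by (simp add: block_def fam_def)
  have block_single: "block [ys] = encode_set ys @ concat (map encode_set (replicate (g - 1) [zero]))" for ys
    by (simp add: block_def fam_def)
  \<comment> \<open>The 3 skips the header \<open>n, g, b\<close>, and the 1 skips the cardinality
    of the set.\<close>
  define pos where "pos = (\<lambda>(i, j). 3 + length (block (take i xss)) + 1 + j)"
  have enc_mod: "encode_instance n g b (I (modified i j)) = (encode_instance n g b (I xss))[pos (i, j) := 0]"
    if i: "i < n" "j < 2 ^ (b - 2)" for i j
  proof -
    have split: "xss = take i xss @ [xss ! i] @ drop (Suc i) xss"
      using i len_xss by (simp add: id_take_nth_drop)
    have split_mod: "modified i j = take i xss @ [(xss ! i)[j := zero]] @ drop (Suc i) xss"
      using i len_xss by (simp add: modified_def upd_conv_take_nth_drop)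
    have "encode_set ((xss ! i)[j := zero]) = (encode_set (xss ! i))[Suc j := 0]"
      by (simp add: encode_set_def map_update zero_def)
    moreover have "Suc j < length (encode_set (xss ! i))"
      using len_xss_nth[OF i(1)] i(2) by (simp add: encode_set_def)
    moreover define pre where "pre = [n, g, b] @ block (take i xss)"
    moreover define rest where "rest = concat (map encode_set (replicate (g - 1) [zero])) @ block (drop (Suc i) xss) @ post"
    moreover have "encode_instance n g b (I xss) = pre @ encode_set (xss ! i) @ rest"
      unfolding enc pre_def rest_def by (subst split) (simp only: block_append block_single append_assoc)
    moreover have "encode_instance n g b (I (modified i j)) = pre @ encode_set ((xss ! i)[j := zero]) @ rest"
      unfolding enc pre_def rest_def split_mod by (simp only: block_append block_single append_assoc)
    moreover have "pos (i, j) = length pre + Suc j"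
      by (simp add: pos_def pre_def)
    ultimately show ?thesis
      by (simp only: list_update_append) simp
  qed
  have "inj_on pos ({..<n} \<times> {..<2 ^ (b - 2)})"
  proof -
    have less: "pos (i, j) < pos (i', j')" if "i < i'" "i' < n" "j < 2 ^ (b - 2)" for i i' j j'
    proof -
      have "take i' xss = take i xss @ [xss ! i] @ drop (Suc i) (take i' xss)"
        using that len_xss id_take_nth_drop[of i "take i' xss"] by (simp add: min_def)
      then have "block (take i' xss) = block (take i xss) @ block [xss ! i] @ block (drop (Suc i) (take i' xss))"
        by (metis block_append)
      then have "length (block (take i xss)) + length (encode_set (xss ! i)) \<le> length (block (take i' xss))"
        by (simp add: block_single)
      then show ?thesis
        using len_xss_nth[of i] that unfolding pos_def by (simp add: encode_set_def)
    qed
    show ?thesis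
    proof (rule inj_onI)
      fix x y assume xy: "x \<in> {..<n} \<times> {..<2 ^ (b - 2)}" "y \<in> {..<n} \<times> {..<2 ^ (b - 2)}" "pos x = pos y"
      obtain i j i' j' where [simp]: "x = (i, j)" "y = (i', j')" by (cases x, cases y)
      have "i = i'"
        using less[of i i' j j'] less[of i' i j' j] xy by (cases i i' rule: linorder_cases) auto
      then show "x = y"
        using xy(3) by (simp add: pos_def)
    qed
  qed
  then have card_pos: "card (pos ` ({..<n} \<times> {..<2 ^ (b - 2)})) = n * 2 ^ (b - 2)"
    by (simp add: card_image card_cartesian_product)

  obtain t1 s1 where run: "exec w P (init_state w (encode_instance n g b (I xss))) t1 s1" "t1 \<le> t"
    and out: "horner_sum (\<lambda>x. x) (2 ^ w) (outs s1) = 0"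
    using comp[OF good_xss] unfolding computes_within_def count0 by blast
  obtain R where R: "finite R" "card R \<le> t1"
      "reads_within w P (init_state w (encode_instance n g b (I xss))) t1 s1 R"
    using exec_reads_few_cells[OF run(1)] by blast
  have "\<not> pos ` ({..<n} \<times> {..<2 ^ (b - 2)}) \<subseteq> R"
  proof
    assume "pos ` ({..<n} \<times> {..<2 ^ (b - 2)}) \<subseteq> R"
    from card_mono[OF R(1) this] show False
      unfolding card_pos using R(2) run(2) t by linarith
  qed
  then obtain i j where ij: "i < n" "j < 2 ^ (b - 2)" "pos (i, j) \<notin> R"
    by auto
  \<comment> \<open>The cell at \<open>pos (i, j)\<close> is never read, so the run on the original
    instance replays on the modified one and outputs 0 there as well.\<close>
  obtain u where u: "exec w P (init_state w (encode_instance n g b (I (modified i j)))) t1 u" "outs u = outs s1"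
  proof (rule reads_withinD[OF R(3), of "init_state w (encode_instance n g b (I (modified i j)))"])
    show "\<forall>a\<in>R. mem (init_state w (encode_instance n g b (I (modified i j)))) a =
        mem (init_state w (encode_instance n g b (I xss))) a"
    proof
      fix a assume "a \<in> R"
      then have "pos (i, j) \<noteq> a"
        using ij(3) by blast
      then show "mem (init_state w (encode_instance n g b (I (modified i j)))) a =
          mem (init_state w (encode_instance n g b (I xss))) a"
        unfolding enc_mod[OF ij(1,2)] by (simp add: init_state_def)
    qed
  qed (use that in \<open>simp_all add: init_state_def\<close>)
  obtain t2 u' where "exec w P (init_state w (encode_instance n g b (I (modified i j)))) t2 u'"
    "horner_sum (\<lambda>x. x) (2 ^ w) (outs u') = factored_count (f b) g (V (modified i j))"
    using comp[OF good_mod[OF ij(1,2)]] unfolding computes_within_def by blast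
  then show False
    using exec_deterministic[OF u(1)] u(2) out count_mod[OF ij(1,2)] by simp
qed

section \<open>The program\<close>

fun seqs :: "ram_prog list \<Rightarrow> ram_prog" where
  "seqs [] = Skip"
| "seqs [P] = P"
| "seqs (P # Ps) = Seq P (seqs Ps)"

text \<open>
  Registers 2 to 12 hold constants: \<open>n\<close>, \<open>g\<close>, \<open>b\<close>, \<open>1\<close>, \<open>2\<^sup>b\<close>, \<open>2\<^sup>k\<^sup>b\<close>, \<open>H = 2\<^sup>m\<close>, \<open>W = H\<^sup>2\<close>, the new
  word length, its power of two, and the address at which the new instance is built.
\<close>

abbreviation (input) "rN \<equiv> 2 :: nat"
abbreviation (input) "rG \<equiv> 3 :: nat"
abbreviation (input) "rB \<equiv> 4 :: nat"
abbreviation (input) "rOne \<equiv> 5 :: nat"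
abbreviation (input) "rBase \<equiv> 6 :: nat"
abbreviation (input) "rLim \<equiv> 7 :: nat"
abbreviation (input) "rH \<equiv> 8 :: nat"
abbreviation (input) "rW \<equiv> 9 :: nat"
abbreviation (input) "rOut \<equiv> 10 :: nat"
abbreviation (input) "rPow \<equiv> 11 :: nat"
abbreviation (input) "rD \<equiv> 12 :: nat"
abbreviation (input) "rP \<equiv> 13 :: nat"
abbreviation (input) "rQ \<equiv> 14 :: nat"
abbreviation (input) "rM \<equiv> 15 :: nat"
abbreviation (input) "rJ \<equiv> 16 :: nat"
abbreviation (input) "rCnt \<equiv> 17 :: nat"
abbreviation (input) "rHd \<equiv> 18 :: nat"
abbreviation (input) "rSz \<equiv> 19 :: nat"
abbreviation (input) "rX \<equiv> 20 :: nat"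
abbreviation (input) "rY \<equiv> 21 :: nat"
abbreviation (input) "rT \<equiv> 22 :: nat"
abbreviation (input) "rAcc \<equiv> 23 :: nat"
abbreviation (input) "rDig \<equiv> 24 :: nat"
abbreviation (input) "rV \<equiv> 25 :: nat"

abbreviation Copy :: "nat \<Rightarrow> nat \<Rightarrow> ram_prog" where
  "Copy r x \<equiv> BinOp Or r x x"

definition fold_step :: "binop \<Rightarrow> ram_prog" where
  "fold_step p = seqs [BinOp Mod rDig rT rBase, BinOp Div rT rT rBase, BinOp p rAcc rAcc rDig,
     BinOp Mod rAcc rAcc rBase]"

definition check_sat :: "nat \<Rightarrow> binop \<Rightarrow> ram_prog" where
  "check_sat k p = seqs [BinOp Mod rAcc rY rBase, BinOp Div rT rY rBase, rep (k - 1) (fold_step p)]"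

text \<open>The first four instructions assemble \<open>code m Y\<close> from
  \<open>H = 2 ^ m\<close>. The multiplier in \<open>rM\<close> repeats it in all fields or moves it
  to one field, and \<open>fin\<close> applies \<open>e\<close>.\<close>

definition emit :: "ram_prog \<Rightarrow> ram_prog" where
  "emit fin = seqs [BinOp Sub rV rH rOne, BinOp Sub rV rV rY, BinOp Mul rV rV rH, BinOp Add rV rV rY,
     BinOp Mul rV rV rM, fin, Store rQ rV, BinOp Add rQ rQ rOne]"

text \<open>Decrementing first turns the counter values \<open>2 ^ (k * b), ..., 1\<close> into the
  codes \<open>2 ^ (k * b) - 1, ..., 0\<close>. A zero in \<open>rAcc\<close> signals an accepted
  tuple.\<close>

definition try_code :: "nat \<Rightarrow> binop \<Rightarrow> ram_prog \<Rightarrow> ram_prog" where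
  "try_code k p fin = seqs [BinOp Sub rY rY rOne, check_sat k p, BinOp Div rDig rY rJ,
     BinOp Mod rDig rDig rBase, BinOp Eq rDig rDig rX,
     Cond rAcc Skip (Cond rDig (emit fin) Skip)]"

definition do_word :: "nat \<Rightarrow> binop \<Rightarrow> ram_prog \<Rightarrow> ram_prog" where
  "do_word k p fin = seqs [Load rX rP, BinOp Add rP rP rOne, Copy rY rLim,
     While rY (try_code k p fin), BinOp Sub rSz rSz rOne]"

text \<open>The cardinality of a new set is known only after its words have been written. Its cell
  is skipped at first and later filled from the distance that the output pointer has moved.\<close>

definition do_set :: "nat \<Rightarrow> binop \<Rightarrow> ram_prog \<Rightarrow> ram_prog" where
  "do_set k p fin = seqs [Copy rHd rQ, BinOp Add rQ rQ rOne, Load rSz rP, BinOp Add rP rP rOne,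
     While rSz (do_word k p fin), BinOp Sub rV rQ rHd, BinOp Sub rV rV rOne, Store rHd rV,
     BinOp Sub rCnt rCnt rOne]"

definition do_family :: "nat \<Rightarrow> binop \<Rightarrow> ram_prog \<Rightarrow> ram_prog" where
  "do_family k p fin = seqs [BinOp Mul rCnt rN rG, While rCnt (do_set k p fin)]"

text \<open>Family 0 is special: its multiplier is a geometric sum and its words are not passed
  through \<open>e\<close>. For the later families the multiplier runs through the powers of
  \<open>W\<close>, starting with 1.\<close>

definition do_families :: "nat \<Rightarrow> binop \<Rightarrow> ram_prog \<Rightarrow> ram_prog" where
  "do_families k p fin = seqs [
     rep (k - 1) (Seq (BinOp Mul rM rM rW) (BinOp Add rM rM rOne)), do_family k p Skip,
     Const rM 1, Copy rJ rBase,
     rep (k - 1) (seqs [do_family k p fin, BinOp Mul rM rM rW, BinOp Mul rJ rJ rBase])]"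

text \<open>\<open>rD\<close> bounds the length of the input, since a set has at most
  \<open>2 ^ b\<close> words; building the new instance from there on leaves the input intact.
  \<open>rM\<close> is not set because it starts as 0.\<close>

definition setup_regs :: "nat \<Rightarrow> ram_prog" where
  "setup_regs k = seqs [Const rOne 1, Load rN rX, BinOp Add rX rX rOne, Load rG rX,
     BinOp Add rX rX rOne, Load rB rX, BinOp Add rP rX rOne,
     BinOp Shl rBase rOne rB, Const rT k, BinOp Mul rT rT rB, BinOp Shl rLim rOne rT,
     BinOp Add rT rT rOne, BinOp Shl rH rOne rT, BinOp Mul rW rH rH,
     Const rOut (2 * (k - 1)), BinOp Mul rOut rOut rT, BinOp Add rOut rOut rG, Const rT 2,
     BinOp Add rOut rOut rT, BinOp Shl rPow rOne rOut,
     BinOp Mul rD rN rG, Const rT k, BinOp Mul rD rD rT, BinOp Add rT rBase rOne,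
     BinOp Mul rD rD rT, BinOp Add rD rD rP, Copy rJ rOne]"

definition write_header :: ram_prog where
  "write_header = seqs [Copy rQ rD, Store rQ rN, BinOp Add rQ rQ rOne, Store rQ rG,
     BinOp Add rQ rQ rOne, Store rQ rOut, BinOp Add rQ rQ rOne]"

definition shift_cell :: ram_prog where
  "shift_cell = seqs [BinOp Add rY rX rD, Load rV rY, Store rX rV, BinOp Add rX rX rOne,
     BinOp Sub rCnt rCnt rOne]"

text \<open>
  Shifting all cells up to the end of the new instance also clears what lies behind its final
  position, because the memory beyond the copy is still zero.
\<close>

definition move_down :: ram_prog where
  "move_down = seqs [Copy rCnt rQ, Const rX 0, While rCnt shift_cell]"

text \<open>The solver is only known to work from an initial state, in which all registers are
  zero.\<close>

definition clear_regs :: ram_prog where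
  "clear_regs = seqs (map (\<lambda>r. Const r 0) [2..<26])"

definition transform :: "nat \<Rightarrow> binop \<Rightarrow> ram_prog \<Rightarrow> ram_prog" where
  "transform k p fin = seqs [setup_regs k, write_header, do_families k p fin, move_down, clear_regs]"

section \<open>Straight-line code and arithmetic without overflow\<close>

lemmas wp_straight = wp_Seq wp_BinOp wp_Const wp_Load wp_Store wp_Skip

lemma wp_Cons:
  "Ps \<noteq> [] \<Longrightarrow> wp w P (\<lambda>t \<rho>' \<mu>'. wp w (seqs Ps) (\<lambda>u. Q (t + u)) \<rho>' \<mu>') \<rho> \<mu> \<Longrightarrow> wp w (seqs (P # Ps)) Q \<rho> \<mu>"
  by (cases Ps) (auto intro: wp_Seq simp: seqs.simps)

lemma wp_instr_Cons:
  assumes "Ps \<noteq> []"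
  shows "wp w (seqs Ps) (\<lambda>u. Q (1 + u)) (\<rho>(r := binop_val w p (\<rho> x) (\<rho> y))) \<mu> \<Longrightarrow>
      wp w (seqs (BinOp p r x y # Ps)) Q \<rho> \<mu>"
    and "wp w (seqs Ps) (\<lambda>u. Q (1 + u)) (\<rho>(r := c mod 2 ^ w)) \<mu> \<Longrightarrow> wp w (seqs (Const r c # Ps)) Q \<rho> \<mu>"
    and "wp w (seqs Ps) (\<lambda>u. Q (1 + u)) (\<rho>(r := \<mu> (\<rho> x))) \<mu> \<Longrightarrow> wp w (seqs (Load r x # Ps)) Q \<rho> \<mu>"
    and "wp w (seqs Ps) (\<lambda>u. Q (1 + u)) \<rho> (\<mu>(\<rho> x := \<rho> r)) \<Longrightarrow> wp w (seqs (Store x r # Ps)) Q \<rho> \<mu>"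
  using assms by (auto intro!: wp_Cons wp_BinOp wp_Const wp_Load wp_Store)

declare binop_val.simps(1,2,3,9) [simp del]
declare seqs.simps(3) [simp del]

lemma binop_val_Sub: "y \<le> x \<Longrightarrow> x < 2 ^ w \<Longrightarrow> binop_val w Sub x y = x - y"
proof -
  assume *: "y \<le> x" "x < 2 ^ w"
  then have "x + (2 ^ w - y) = (x - y) + 2 ^ w"
    by simp
  then show ?thesis
    unfolding binop_val.simps using * by (simp only: mod_add_self2) simp
qed

lemma binop_val_Add: "x + y < 2 ^ w \<Longrightarrow> binop_val w Add x y = x + y"
  and binop_val_Mul: "x * y < 2 ^ w \<Longrightarrow> binop_val w Mul x y = x * y"
  by (simp_all add: binop_val.simps)

lemma binop_val_Shl: "y < w \<Longrightarrow> binop_val w Shl 1 y = 2 ^ y"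
  by (simp add: binop_val.simps)

text \<open>The machine counterpart of \<open>e\<close>. The condition \<open>b < w\<close> makes
  \<open>2 ^ b\<close> itself fit into a word.\<close>

definition finishes :: "ram_prog \<Rightarrow> (nat \<Rightarrow> nat \<Rightarrow> nat) \<Rightarrow> bool" where
  "finishes fin e \<longleftrightarrow> (\<forall>w b \<rho> \<mu>. b < w \<longrightarrow> \<rho> rPow = 2 ^ b \<longrightarrow> \<rho> rOne = 1 \<longrightarrow> 0 < \<rho> rV \<longrightarrow> \<rho> rV < 2 ^ b \<longrightarrow>
     wp w fin (\<lambda>t \<rho>' \<mu>'. t \<le> 2 \<and> \<rho>' = \<rho>(rV := e b (\<rho> rV)) \<and> \<mu>' = \<mu>) \<rho> \<mu>)"

lemma finishes_xor: "finishes Skip (\<lambda>b v. v)"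
  unfolding finishes_def by (auto intro!: wp_Skip)

lemma finishes_sum: "finishes (BinOp Sub rV rPow rV) (\<lambda>b v. 2 ^ b - v)"
  unfolding finishes_def by (auto intro!: wp_BinOp simp: binop_val_Sub)

lemma finishes_ov: "finishes (seqs [BinOp Sub rV rPow rV, BinOp Sub rV rV rOne]) (\<lambda>b v. 2 ^ b - 1 - v)"
  unfolding finishes_def seqs.simps
proof (intro allI impI)
  fix w b :: nat and \<rho> \<mu> :: "nat \<Rightarrow> nat"
  assume *: "b < w" "\<rho> rPow = 2 ^ b" "\<rho> rOne = 1" "0 < \<rho> rV" "\<rho> rV < 2 ^ b"
  then have "(2::nat) ^ b < 2 ^ w" by simp
  then have "binop_val w Sub (2 ^ b) (\<rho> rV) = 2 ^ b - \<rho> rV"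
    "binop_val w Sub (2 ^ b - \<rho> rV) 1 = 2 ^ b - 1 - \<rho> rV"
    using * by (simp_all add: binop_val_Sub less_imp_diff_less)
  with * show "wp w (Seq (BinOp Sub rV rPow rV) (BinOp Sub rV rV rOne))
      (\<lambda>t \<rho>' \<mu>'. t \<le> 2 \<and> \<rho>' = \<rho>(rV := 2 ^ b - 1 - \<rho> rV) \<and> \<mu>' = \<mu>) \<rho> \<mu>"
    by (auto intro!: wp_straight)
qed

context reduction
begin

definition fold_acc :: "nat \<Rightarrow> nat \<Rightarrow> nat list \<Rightarrow> nat" where
  "fold_acc w = foldl (\<lambda>a d. binop_val w p a d mod 2 ^ b)"

lemma fold_acc_sat:
  assumes "b \<le> w"
  shows "fold_acc w (digit b 0 Y) (map (\<lambda>j. digit b j Y) [1..<k]) = 0 \<longleftrightarrow> sat Y"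
proof -
  have "[0..<k] = 0 # [1..<k]"
    using k by (simp add: upt_conv_Cons)
  then have "words_of Y = map (bits b) (digit b 0 Y # map (\<lambda>j. digit b j Y) [1..<k])"
    by (simp add: words_of_def)
  moreover have "\<forall>d\<in>set (map (\<lambda>j. digit b j Y) [1..<k]). d < 2 ^ b"
    by auto
  ultimately show ?thesis
    unfolding sat_def fold_acc_def
    using computed assms digit_less[of b 0 Y] unfolding computed_by_def by metis
qed

lemma wp_check_sat:
  assumes "b \<le> w" "\<rho> rBase = 2 ^ b"
  shows "wp w (check_sat k p) (\<lambda>t \<rho>' \<mu>'. t \<le> 4 * k \<and> (\<rho>' rAcc = 0 \<longleftrightarrow> sat (\<rho> rY)) \<and> \<mu>' = \<mu> \<and>
    (\<forall>r. r \<notin> {rT, rAcc, rDig} \<longrightarrow> \<rho>' r = \<rho> r)) \<rho> \<mu>"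
proof -
  define Y where "Y = \<rho> rY"
  \<comment> \<open>After \<open>i\<close> rounds \<open>i + 1\<close> digits are consumed, because
    digit 0 initializes the accumulator before the loop.\<close>
  define Inv where "Inv = (\<lambda>i \<rho>' \<mu>'. \<rho>' rT = Y div (2 ^ b) ^ Suc i \<and>
    \<rho>' rAcc = fold_acc w (digit b 0 Y) (map (\<lambda>j. digit b j Y) [1..<Suc i]) \<and> \<mu>' = \<mu> \<and>
    (\<forall>r. r \<notin> {rT, rAcc, rDig} \<longrightarrow> \<rho>' r = \<rho> r))"
  have body: "wp w (fold_step p) (\<lambda>t \<rho>' \<mu>'. t \<le> 4 \<and> Inv (Suc i) \<rho>' \<mu>') \<rho>' \<mu>'" if "Inv i \<rho>' \<mu>'" for i \<rho>' \<mu>'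
  proof -
    have "\<rho>' rBase = 2 ^ b"
      using that assms unfolding Inv_def by auto
    moreover have "Y div (2 ^ b) ^ Suc i div 2 ^ b = Y div (2 ^ b) ^ Suc (Suc i)"
      by (simp only: power_Suc2 div_mult2_eq)
    moreover have "fold_acc w (digit b 0 Y) (map (\<lambda>j. digit b j Y) [1..<Suc (Suc i)]) =
        binop_val w p (fold_acc w (digit b 0 Y) (map (\<lambda>j. digit b j Y) [1..<Suc i]))
          (Y div (2 ^ b) ^ Suc i mod 2 ^ b) mod 2 ^ b"
      by (simp add: fold_acc_def digit_def)
    ultimately show ?thesis
      using that unfolding Inv_def fold_step_def
      by (auto intro!: wp_straight simp: seqs.simps simp del: power_Suc upt_Suc)
  qed
  have "wp w (rep (k - 1) (fold_step p)) (\<lambda>t \<rho>' \<mu>'. t \<le> (k - 1) * 4 + 1 \<and> Inv (k - 1) \<rho>' \<mu>')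
      (\<rho>(rAcc := \<rho> rY mod 2 ^ b, rT := \<rho> rY div 2 ^ b)) \<mu>"
    by (rule wp_rep[where I = Inv and B = 4, OF body]) (auto simp: Inv_def Y_def fold_acc_def digit_def)
  then show ?thesis
    unfolding check_sat_def
    using k fold_acc_sat[OF assms(1), of Y] Suc_diff_1[of k]
    by (auto simp: Inv_def Y_def assms seqs.simps simp del: upt_Suc intro!: wp_straight elim!: wp_mono)
qed

end

text \<open>The factor 3 in \<open>size_w\<close> leaves room for addresses up to
  \<open>D + length out + D\<close>, which the final shift reaches; each of the three summands is at
  most the bracket.\<close>

locale ram_reduction = reduction +
  fixes fin :: ram_prog and w n :: nat
  assumes finishes: "finishes fin e"
    and b'_w: "b' < w"
    and n_w: "n < 2 ^ w"
    and size_w: "3 * (k * (n * g) * (1 + 2 ^ b * 2 ^ (k * b)) + 3) < 2 ^ w"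
begin

definition D :: nat where
  "D = k * (n * g) * (1 + 2 ^ b) + 3"

definition M :: "nat \<Rightarrow> nat" where
  "M j = (if j = 0 then \<Sum>i<k - 1. (2 ^ (2 * m)) ^ i else (2 ^ (2 * m)) ^ (j - 1))"

definition const_regs :: "(nat \<Rightarrow> nat) \<Rightarrow> bool" where
  "const_regs \<rho> \<longleftrightarrow> \<rho> rN = n \<and> \<rho> rG = g \<and> \<rho> rOne = 1 \<and> \<rho> rBase = 2 ^ b \<and> \<rho> rLim = 2 ^ (k * b) \<and>
     \<rho> rH = 2 ^ m \<and> \<rho> rW = 2 ^ (2 * m) \<and> \<rho> rOut = b' \<and> \<rho> rPow = 2 ^ b' \<and> \<rho> rD = D"

text \<open>Cells between the end of the input and \<open>D\<close> are left open. The zeros behind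
  the output serve twice: for reserving header cells and for clearing memory in the final
  shift.\<close>

definition repr :: "nat list \<Rightarrow> nat list \<Rightarrow> (nat \<Rightarrow> nat) \<Rightarrow> bool" where
  "repr xs out \<mu> \<longleftrightarrow> length xs \<le> D \<and> (\<forall>a<length xs. \<mu> a = xs ! a) \<and>
     (\<forall>i<length out. \<mu> (D + i) = out ! i) \<and> (\<forall>a\<ge>D + length out. \<mu> a = 0)"

lemma repr_append: "repr xs out \<mu> \<Longrightarrow> repr xs (out @ [v]) (\<mu>(D + length out := v))"
  unfolding repr_def by (auto simp: nth_append)

text \<open>Reserving the header cell of a set needs no store, as the memory behind the output is
  still zero.\<close>

lemma repr_append_0: "repr xs out \<mu> \<Longrightarrow> repr xs (out @ [0]) \<mu>"
  unfolding repr_def by (auto simp: nth_append less_Suc_eq)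

lemma repr_update: "repr xs out \<mu> \<Longrightarrow> i < length out \<Longrightarrow> repr xs (out[i := v]) (\<mu>(D + i := v))"
  unfolding repr_def by (auto simp: nth_list_update)

lemma m_le: "2 * m \<le> b'"
proof -
  have "2 * m * 1 \<le> 2 * m * (k - 1)"
    using k by (intro mult_le_mono2) simp
  with fields_fit show ?thesis by linarith
qed

lemma exp_less: "i \<le> b' \<Longrightarrow> (2::nat) ^ i < 2 ^ w"
  using b'_w by simp

lemma b_le: "b \<le> m" "k * b \<le> m" "m \<le> b'" "b \<le> w"
proof -
  have "1 * b \<le> k * b"
    using k by (intro mult_le_mono1) simp
  then show "b \<le> m" "k * b \<le> m" "m \<le> b'" "b \<le> w"
    using m_le b'_w m_def by linarith+
qed

lemma const_regsD:
  assumes "const_regs \<rho>"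
  shows "\<rho> rN = n" "\<rho> rG = g" "\<rho> rOne = 1" "\<rho> rBase = 2 ^ b" "\<rho> rLim = 2 ^ (k * b)"
    "\<rho> rH = 2 ^ m" "\<rho> rW = 2 ^ (2 * m)" "\<rho> rOut = b'" "\<rho> rPow = 2 ^ b'" "\<rho> rD = D"
  using assms unfolding const_regs_def by auto

lemma const_regs_cong:
  assumes "const_regs \<rho>" "\<And>r. r \<in> {rN, rG, rOne, rBase, rLim, rH, rW, rOut, rPow, rD} \<Longrightarrow> \<rho>' r = \<rho> r"
  shows "const_regs \<rho>'"
  using assms unfolding const_regs_def by auto

lemma wp_fin:
  assumes "F = Skip \<and> j = 0 \<or> F = fin \<and> 0 < j \<and> j < k" "const_regs \<rho>" "Y < 2 ^ (k * b)" "\<rho> rV = code m Y * M j"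
  shows "wp w F (\<lambda>t \<rho>' \<mu>'. t \<le> 2 \<and> \<rho>' = \<rho>(rV := enc j Y) \<and> \<mu>' = \<mu>) \<rho> \<mu>"
proof (cases "j = 0")
  case True
  then have "\<rho>(rV := enc j Y) = \<rho>"
    using assms(4) by (auto simp: enc_def M_def)
  then show ?thesis
    using assms(1) True by (auto intro: wp_Skip)
next
  case False
  then have "0 < \<rho> rV" "\<rho> rV < 2 ^ b'"
    using field_bounds[OF assms(3), of j] assms(1,4) by (auto simp: M_def)
  then have "wp w fin (\<lambda>t \<rho>' \<mu>'. t \<le> 2 \<and> \<rho>' = \<rho>(rV := e b' (\<rho> rV)) \<and> \<mu>' = \<mu>) \<rho> \<mu>"
    using finishes b'_w assms(2) unfolding finishes_def const_regs_def by blast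
  then show ?thesis
    using False assms(1,4) by (simp add: enc_def M_def)
qed

lemma code_mult_M_less: "Y < 2 ^ (k * b) \<Longrightarrow> j < k \<Longrightarrow> code m Y * M j < 2 ^ b'"
  unfolding M_def using field_bounds[of Y j] repeated_bound[of Y] by auto

lemma wp_emit:
  assumes F: "F = Skip \<and> j = 0 \<or> F = fin \<and> 0 < j \<and> j < k" and c: "const_regs \<rho>" "\<rho> rM = M j"
    and Y: "\<rho> rY = Y" "Y < 2 ^ (k * b)"
    and r: "repr xs out \<mu>" "\<rho> rQ = D + length out" "D + length out + 1 < 2 ^ w"
  shows "wp w (emit F) (\<lambda>t \<rho>' \<mu>'. t \<le> 9 \<and> repr xs (out @ [enc j Y]) \<mu>' \<and>
    \<rho>' rQ = D + length (out @ [enc j Y]) \<and> (\<forall>r. r \<notin> {rV, rQ} \<longrightarrow> \<rho>' r = \<rho> r)) \<rho> \<mu>"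
proof -
  have j: "j < k"
    using F k by auto
  have Ym: "Y < 2 ^ m"
    by (rule less_code_range[OF Y(2)])
  have 1: "binop_val w Sub (2 ^ m) 1 = 2 ^ m - 1"
    using exp_less[of m] b_le by (simp add: binop_val_Sub)
  have 2: "binop_val w Sub (2 ^ m - 1) Y = 2 ^ m - 1 - Y"
    using exp_less[OF b_le(3)] Ym by (intro binop_val_Sub) linarith+
  have code: "code m Y < 2 ^ w"
    using code_less[OF Ym] exp_less[OF m_le] by linarith
  then have 3: "binop_val w Mul (2 ^ m - 1 - Y) (2 ^ m) = 2 ^ m * (2 ^ m - 1 - Y)"
    unfolding code_def by (simp add: mult.commute binop_val.simps)
  have 4: "binop_val w Add (2 ^ m * (2 ^ m - 1 - Y)) Y = code m Y"
    using code unfolding code_def by (simp add: add.commute binop_val.simps)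
  have 5: "binop_val w Mul (code m Y) (M j) = code m Y * M j"
    using code_mult_M_less[OF Y(2) j] exp_less[of b'] by (intro binop_val_Mul) linarith
  let ?\<rho> = "\<rho>(rV := code m Y * M j)"
  have "wp w F (\<lambda>t \<rho>' \<mu>'. t \<le> 2 \<and> \<rho>' = ?\<rho>(rV := enc j Y) \<and> \<mu>' = \<mu>) ?\<rho> \<mu>"
    by (rule wp_fin[OF F]) (use c Y in \<open>auto intro: const_regs_cong\<close>)
  then have tail: "wp w (seqs [F, Store rQ rV, BinOp Add rQ rQ rOne]) (\<lambda>t \<rho>' \<mu>'. t \<le> 4 \<and> repr xs (out @ [enc j Y]) \<mu>' \<and>
    \<rho>' rQ = D + length (out @ [enc j Y]) \<and> (\<forall>r. r \<notin> {rV, rQ} \<longrightarrow> \<rho>' r = \<rho> r)) ?\<rho> \<mu>"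
    using r const_regsD(3)[OF c(1)]
    by (auto intro!: wp_straight elim!: wp_mono simp: repr_append seqs.simps binop_val_Add)
  show ?thesis
    unfolding emit_def
    by ((rule wp_Cons, simp, rule wp_BinOp)+,
      simp add: const_regsD[OF c(1)] c(2) Y(1) 1[simplified] 2[simplified] 3[simplified] 4[simplified] 5, rule wp_mono[OF tail], simp)
qed

definition hits :: "nat \<Rightarrow> nat \<Rightarrow> nat \<Rightarrow> nat list" where
  "hits j x Y = (if sat Y \<and> digit b j Y = x then [enc j Y] else [])"

definition gen :: "nat \<Rightarrow> nat \<Rightarrow> nat list" where
  "gen j x = map (enc j) (filter (\<lambda>Y. sat Y \<and> digit b j Y = x) (rev [0..<2 ^ (k * b)]))"

lemma length_gen: "length (gen j x) \<le> 2 ^ (k * b)"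
  unfolding gen_def using length_filter_le[of _ "rev [0..<2 ^ (k * b)]"] by simp

lemma wp_try_code:
  assumes F: "F = Skip \<and> j = 0 \<or> F = fin \<and> 0 < j \<and> j < k"
    and c: "const_regs \<rho>" "\<rho> rM = M j" "\<rho> rJ = (2 ^ b) ^ j" and Y: "\<rho> rY = Suc Y" "Y < 2 ^ (k * b)"
    and r: "repr xs out \<mu>" "\<rho> rQ = D + length out" "D + length out + 1 < 2 ^ w"
  shows "wp w (try_code k p F) (\<lambda>t \<rho>' \<mu>'. t \<le> 4 * k + 15 \<and> \<rho>' rY = Y \<and>
     repr xs (out @ hits j (\<rho> rX) Y) \<mu>' \<and>
     \<rho>' rQ = D + length (out @ hits j (\<rho> rX) Y) \<and>
     (\<forall>r. r \<notin> {rY, rT, rAcc, rDig, rV, rQ} \<longrightarrow> \<rho>' r = \<rho> r)) \<rho> \<mu>" (is "wp _ _ ?Q _ _")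
proof -
  have 1: "binop_val w Sub (Suc Y) 1 = Y"
    using Y(2) exp_less[OF order_trans[OF b_le(2,3)]] by (subst binop_val_Sub) linarith+
  have tail: "wp w (seqs [BinOp Div rDig rY rJ, BinOp Mod rDig rDig rBase, BinOp Eq rDig rDig rX,
     Cond rAcc Skip (Cond rDig (emit F) Skip)]) (\<lambda>t. ?Q (1 + (t' + t))) \<rho>' \<mu>"
    if \<rho>': "t' \<le> 4 * k" "\<rho>' rAcc = 0 \<longleftrightarrow> sat Y" "\<rho>' rY = Y" "\<forall>r. r \<notin> {rY, rT, rAcc, rDig} \<longrightarrow> \<rho>' r = \<rho> r"
    for t' \<rho>'
  proof -
    let ?\<rho> = "\<rho>'(rDig := of_bool (digit b j Y = \<rho> rX))"
    have eqs: "\<rho>' rBase = 2 ^ b" "\<rho>' rJ = (2 ^ b) ^ j" "\<rho>' rX = \<rho> rX" "\<rho>' rQ = D + length out"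
      using \<rho>' c(3) const_regsD(4)[OF c(1)] r by auto
    have "wp w (emit F) (\<lambda>t \<rho>' \<mu>'. t \<le> 9 \<and> repr xs (out @ [enc j Y]) \<mu>' \<and>
       \<rho>' rQ = D + length (out @ [enc j Y]) \<and> (\<forall>r. r \<notin> {rV, rQ} \<longrightarrow> \<rho>' r = ?\<rho> r)) ?\<rho> \<mu>"
      by (rule wp_emit[OF F]) (use \<rho>' c r Y in \<open>auto intro: const_regs_cong\<close>)
    then have "wp w (Cond rAcc Skip (Cond rDig (emit F) Skip)) (\<lambda>t. ?Q (t' + t + 4)) ?\<rho> \<mu>"
      using \<rho>' r eqs by (auto intro!: wp_Cond wp_Skip elim!: wp_mono simp: hits_def)
    then show ?thesis
      using \<rho>' eqs by (auto intro!: wp_straight elim!: wp_mono simp: digit_def seqs.simps)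
  qed
  have "wp w (check_sat k p) (\<lambda>t \<rho>' \<mu>'. t \<le> 4 * k \<and> (\<rho>' rAcc = 0 \<longleftrightarrow> sat ((\<rho>(rY := Y)) rY)) \<and> \<mu>' = \<mu> \<and>
    (\<forall>r. r \<notin> {rT, rAcc, rDig} \<longrightarrow> \<rho>' r = (\<rho>(rY := Y)) r)) (\<rho>(rY := Y)) \<mu>"
    by (rule wp_check_sat) (use const_regsD(4)[OF c(1)] b_le in auto)
  from wp_Cons[OF _ wp_mono[OF this]] have chk: "wp w (seqs [check_sat k p, BinOp Div rDig rY rJ, BinOp Mod rDig rDig rBase, BinOp Eq rDig rDig rX,
     Cond rAcc Skip (Cond rDig (emit F) Skip)]) (\<lambda>t. ?Q (1 + t)) (\<rho>(rY := Y)) \<mu>"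
    using tail by simp
  show ?thesis
    unfolding try_code_def
    by (rule wp_Cons, simp, rule wp_BinOp) (use chk in \<open>simp add: 1[simplified] Y(1) const_regsD[OF c(1)]\<close>)
qed

lemma wp_codes:
  assumes F: "F = Skip \<and> j = 0 \<or> F = fin \<and> 0 < j \<and> j < k"
    and c: "const_regs \<rho>" "\<rho> rM = M j" "\<rho> rJ = (2 ^ b) ^ j" and Y: "\<rho> rY = 2 ^ (k * b)"
    and r: "repr xs out \<mu>" "\<rho> rQ = D + length out" "D + length out + 2 ^ (k * b) < 2 ^ w"
  shows "wp w (While rY (try_code k p F)) (\<lambda>t \<rho>' \<mu>'. t \<le> 2 ^ (k * b) * (4 * k + 16) + 1 \<and>
     repr xs (out @ gen j (\<rho> rX)) \<mu>' \<and> \<rho>' rQ = D + length (out @ gen j (\<rho> rX)) \<and>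
     (\<forall>r. r \<notin> {rY, rT, rAcc, rDig, rV, rQ} \<longrightarrow> \<rho>' r = \<rho> r)) \<rho> \<mu>"
proof -
  define L :: nat where "L = 2 ^ (k * b)"
  \<comment> \<open>Output of the codes from \<open>i\<close> upwards, largest first: these have
    been tried when the counter is \<open>i\<close>.\<close>
  define part where "part = (\<lambda>i. map (enc j) (filter (\<lambda>Y. sat Y \<and> digit b j Y = \<rho> rX) (rev [i..<L])))"
  have len_part: "length (part i) \<le> L - i" for i
    unfolding part_def using length_filter_le[of _ "rev [i..<L]"] by simp
  have part_step: "part i = part (Suc i) @ hits j (\<rho> rX) i" if "i < L" for i
    using that by (simp add: part_def hits_def upt_conv_Cons)
  define Inv where "Inv = (\<lambda>i \<rho>' \<mu>'. \<rho>' rY = i \<and> i \<le> L \<and> repr xs (out @ part i) \<mu>' \<and>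
    \<rho>' rQ = D + length (out @ part i) \<and> (\<forall>r. r \<notin> {rY, rT, rAcc, rDig, rV, rQ} \<longrightarrow> \<rho>' r = \<rho> r))"
  have body: "wp w (try_code k p F) (\<lambda>t \<rho>'' \<mu>''. t \<le> 4 * k + 15 \<and> Inv i \<rho>'' \<mu>'') \<rho>' \<mu>'"
    if I: "Inv (Suc i) \<rho>' \<mu>'" for i \<rho>' \<mu>'
  proof -
    have i: "i < L" "\<rho>' rX = \<rho> rX" "\<rho>' rY = Suc i"
      using I unfolding Inv_def by auto
    have "const_regs \<rho>'"
      by (rule const_regs_cong[OF c(1)]) (use I in \<open>auto simp: Inv_def\<close>)
    moreover have "D + length (out @ part (Suc i)) + 1 < 2 ^ w"
      using r(3) len_part[of "Suc i"] i(1) unfolding L_def[symmetric] by simp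
    ultimately show ?thesis
      using wp_try_code[OF F, of \<rho>' i xs "out @ part (Suc i)" \<mu>'] I c(2,3) i part_step[OF i(1)]
      unfolding Inv_def L_def by (auto elim!: wp_mono)
  qed
  have "wp w (While rY (try_code k p F)) (\<lambda>t \<rho>' \<mu>'. t \<le> L * (4 * k + 15 + 1) + 1 \<and> Inv 0 \<rho>' \<mu>') \<rho> \<mu>"
  proof (rule wp_While_countdown[where I = Inv, OF _ body])
    show "Inv L \<rho> \<mu>"
      using r Y unfolding Inv_def part_def L_def by simp
  qed (simp_all add: Inv_def)
  then show ?thesis
    by (rule wp_mono) (auto simp: Inv_def part_def gen_def L_def add.commute)
qed

lemma length_concat_gen: "length (concat (map (gen j) zs)) \<le> length zs * 2 ^ (k * b)"
  by (induction zs) (use length_gen in \<open>auto intro: add_mono\<close>)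

definition word_time :: nat where
  "word_time = 2 ^ (k * b) * (4 * k + 16) + 5"

lemma wp_words:
  assumes F: "F = Skip \<and> j = 0 \<or> F = fin \<and> 0 < j \<and> j < k"
    and c: "const_regs \<rho>" "\<rho> rM = M j" "\<rho> rJ = (2 ^ b) ^ j"
    and zs: "\<rho> rSz = length zs" "\<rho> rP = p0" "p0 + length zs \<le> length xs"
      "\<And>i. i < length zs \<Longrightarrow> xs ! (p0 + i) = zs ! i"
    and r: "repr xs out \<mu>" "\<rho> rQ = D + length out" "D + length out + length zs * 2 ^ (k * b) < 2 ^ w"
  shows "wp w (While rSz (do_word k p F)) (\<lambda>t \<rho>' \<mu>'. t \<le> length zs * (word_time + 1) + 1 \<and>
     repr xs (out @ concat (map (gen j) zs)) \<mu>' \<and> \<rho>' rQ = D + length (out @ concat (map (gen j) zs)) \<and>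
     \<rho>' rP = p0 + length zs \<and>
     (\<forall>r. r \<notin> {rP, rSz, rX, rY, rT, rAcc, rDig, rV, rQ} \<longrightarrow> \<rho>' r = \<rho> r)) \<rho> \<mu>"
proof -
  define l where "l = length zs"
  define part where "part = (\<lambda>i. concat (map (gen j) (take (l - i) zs)))"
  have len_part: "length (part i) \<le> (l - i) * 2 ^ (k * b)" for i
    using length_concat_gen[of j "take (l - i) zs"] by (simp add: part_def l_def)
  have part_step: "part i = part (Suc i) @ gen j (zs ! (l - Suc i))" if "i < l" for i
  proof -
    have "l - i = Suc (l - Suc i)" "l - Suc i < length zs"
      using that by (auto simp: l_def)
    then show ?thesis
      by (simp add: part_def take_Suc_conv_app_nth)
  qed
  define Inv where "Inv = (\<lambda>i \<rho>' \<mu>'. \<rho>' rSz = i \<and> i \<le> l \<and> \<rho>' rP = p0 + (l - i) \<and> repr xs (out @ part i) \<mu>' \<and>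
    \<rho>' rQ = D + length (out @ part i) \<and>
    (\<forall>r. r \<notin> {rP, rSz, rX, rY, rT, rAcc, rDig, rV, rQ} \<longrightarrow> \<rho>' r = \<rho> r))"
  have D_w: "D < 2 ^ w" and l_w: "l < 2 ^ w"
    using r(1,3) zs(3) by (auto simp: repr_def l_def)
  have body: "wp w (do_word k p F) (\<lambda>t \<rho>'' \<mu>''. t \<le> word_time \<and> Inv i \<rho>'' \<mu>'') \<rho>' \<mu>'"
    if I: "Inv (Suc i) \<rho>' \<mu>'" for i \<rho>' \<mu>'
  proof -
    have i: "i < l" "\<rho>' rSz = Suc i" "\<rho>' rP = p0 + (l - Suc i)"
      using I unfolding Inv_def by auto
    have c': "const_regs \<rho>'"
      by (rule const_regs_cong[OF c(1)]) (use I in \<open>auto simp: Inv_def\<close>)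
    define x where "x = zs ! (l - Suc i)"
    have "p0 + (l - Suc i) < length xs" "xs ! (p0 + (l - Suc i)) = x"
      using zs(3) zs(4)[of "l - Suc i"] i(1) by (auto simp: x_def l_def)
    then have "\<mu>' (\<rho>' rP) = x"
      using I i(3) unfolding Inv_def repr_def by auto
    moreover have "binop_val w Add (\<rho>' rP) 1 = p0 + (l - i)"
      using i zs(3) r(1) D_w by (subst binop_val_Add) (auto simp: repr_def l_def)
    moreover have sub: "binop_val w Sub (Suc i) 1 = i"
      using i l_w by (subst binop_val_Sub) auto
    moreover define \<rho>1 where "\<rho>1 = \<rho>'(rX := x, rP := p0 + (l - i), rY := 2 ^ (k * b))"
    moreover have "wp w (While rY (try_code k p F)) (\<lambda>t \<rho>'' \<mu>''. t \<le> 2 ^ (k * b) * (4 * k + 16) + 1 \<and>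
       repr xs ((out @ part (Suc i)) @ gen j (\<rho>1 rX)) \<mu>'' \<and>
       \<rho>'' rQ = D + length ((out @ part (Suc i)) @ gen j (\<rho>1 rX)) \<and>
       (\<forall>r. r \<notin> {rY, rT, rAcc, rDig, rV, rQ} \<longrightarrow> \<rho>'' r = \<rho>1 r)) \<rho>1 \<mu>'"
    proof (rule wp_codes[OF F])
      show "const_regs \<rho>1"
        by (rule const_regs_cong[OF c']) (auto simp: \<rho>1_def)
      have "Suc (l - Suc i) * 2 ^ (k * b) \<le> l * 2 ^ (k * b)"
        using i(1) by (intro mult_le_mono1) simp
      then show "D + length (out @ part (Suc i)) + 2 ^ (k * b) < 2 ^ w"
        using r(3) len_part[of "Suc i"] unfolding l_def[symmetric] by simp
    qed (use I c in \<open>auto simp: Inv_def \<rho>1_def\<close>)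
    then have "wp w (seqs [While rY (try_code k p F), BinOp Sub rSz rSz rOne])
        (\<lambda>t \<rho>'' \<mu>''. 1 + (1 + (1 + t)) \<le> word_time \<and> Inv i \<rho>'' \<mu>'') \<rho>1 \<mu>'"
      unfolding seqs.simps using I i(1) sub const_regsD(3)[OF c']
      by (auto intro!: wp_Seq wp_BinOp elim!: wp_mono
          simp: Inv_def \<rho>1_def part_step[OF i(1)] word_time_def x_def)
    ultimately show ?thesis
      unfolding do_word_def
      by (intro wp_instr_Cons)
        (simp_all add: const_regsD[OF c'] i)
  qed
  have "wp w (While rSz (do_word k p F)) (\<lambda>t \<rho>' \<mu>'. t \<le> l * (word_time + 1) + 1 \<and> Inv 0 \<rho>' \<mu>') \<rho> \<mu>"
  proof (rule wp_While_countdown[where I = Inv, OF _ body])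
    show "Inv l \<rho> \<mu>"
      using r zs unfolding Inv_def part_def l_def by simp
  qed (simp_all add: Inv_def)
  then show ?thesis
    by (rule wp_mono) (auto simp: Inv_def part_def l_def)
qed

definition set_cells :: "nat list \<Rightarrow> nat list" where
  "set_cells zs = length zs # zs"

definition new_cells :: "nat \<Rightarrow> nat list \<Rightarrow> nat list" where
  "new_cells j zs = set_cells (concat (map (gen j) zs))"

definition set_time :: nat where
  "set_time = 2 ^ b * (word_time + 1) + 9"

lemma wp_do_set:
  assumes F: "F = Skip \<and> j = 0 \<or> F = fin \<and> 0 < j \<and> j < k"
    and c: "const_regs \<rho>" "\<rho> rM = M j" "\<rho> rJ = (2 ^ b) ^ j"
    and xs: "xs = pre @ set_cells zs @ post" "\<rho> rP = length pre" "length zs \<le> 2 ^ b"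
    and cnt: "\<rho> rCnt = Suc i" "Suc i < 2 ^ w"
    and r: "repr xs out \<mu>" "\<rho> rQ = D + length out" "D + length out + (1 + 2 ^ b * 2 ^ (k * b)) < 2 ^ w"
  shows "wp w (do_set k p F) (\<lambda>t \<rho>' \<mu>'. t \<le> set_time \<and>
     repr xs (out @ new_cells j zs) \<mu>' \<and> \<rho>' rQ = D + length (out @ new_cells j zs) \<and>
     \<rho>' rP = length pre + length (set_cells zs) \<and> \<rho>' rCnt = i \<and>
     (\<forall>r. r \<notin> {rCnt, rHd, rP, rSz, rX, rY, rT, rAcc, rDig, rV, rQ} \<longrightarrow> \<rho>' r = \<rho> r)) \<rho> \<mu>"
proof -
  have D_w: "length xs \<le> D" "D < 2 ^ w"
    using r by (auto simp: repr_def)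
  define q where "q = D + length out"
  define ys where "ys = concat (map (gen j) zs)"
  have ys: "length ys \<le> 2 ^ b * 2 ^ (k * b)"
    unfolding ys_def using length_concat_gen[of j zs] mult_le_mono1[OF xs(3), of "2 ^ (k * b)"] by linarith
  define \<rho>1 where "\<rho>1 = \<rho>(rHd := q, rQ := q + 1, rSz := length zs, rP := length pre + 1)"
  have "\<mu> (length pre) = length zs"
    using r(1) xs(1) unfolding repr_def by (auto simp: set_cells_def nth_append)
  moreover have "binop_val w Add q 1 = q + 1" "binop_val w Add (length pre) 1 = length pre + 1"
    using r(3) D_w xs(1) by (auto simp: q_def set_cells_def binop_val_Add)
  ultimately have eqs: "\<mu> (length pre) = length zs" "binop_val w Add q 1 = q + 1"
    "binop_val w Add (length pre) 1 = length pre + 1"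
    by auto
  have words: "wp w (While rSz (do_word k p F)) (\<lambda>t \<rho>' \<mu>'. t \<le> length zs * (word_time + 1) + 1 \<and>
     repr xs ((out @ [0]) @ concat (map (gen j) zs)) \<mu>' \<and> \<rho>' rQ = D + length ((out @ [0]) @ concat (map (gen j) zs)) \<and>
     \<rho>' rP = (length pre + 1) + length zs \<and>
     (\<forall>r. r \<notin> {rP, rSz, rX, rY, rT, rAcc, rDig, rV, rQ} \<longrightarrow> \<rho>' r = \<rho>1 r)) \<rho>1 \<mu>"
  proof (rule wp_words[OF F])
    show "const_regs \<rho>1"
      by (rule const_regs_cong[OF c(1)]) (auto simp: \<rho>1_def)
    show "D + length (out @ [0]) + length zs * 2 ^ (k * b) < 2 ^ w"
      using r(3) mult_le_mono1[OF xs(3), of "2 ^ (k * b)"] length_append_singleton[of out 0] by linarith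
    show "xs ! (length pre + 1 + i) = zs ! i" if "i < length zs" for i
      using that xs(1) by (simp add: set_cells_def nth_append)
  qed (use c xs r repr_append_0[OF r(1)] in \<open>auto simp: \<rho>1_def q_def set_cells_def\<close>)
  have fin_part: "wp w (seqs [BinOp Sub rV rQ rHd, BinOp Sub rV rV rOne, Store rHd rV, BinOp Sub rCnt rCnt rOne])
     (\<lambda>u \<rho>'' \<mu>''. 1 + (1 + (1 + (1 + (t + u)))) \<le> set_time \<and>
     repr xs (out @ new_cells j zs) \<mu>'' \<and> \<rho>'' rQ = D + length (out @ new_cells j zs) \<and>
     \<rho>'' rP = length pre + length (set_cells zs) \<and> \<rho>'' rCnt = i \<and>
     (\<forall>r. r \<notin> {rCnt, rHd, rP, rSz, rX, rY, rT, rAcc, rDig, rV, rQ} \<longrightarrow> \<rho>'' r = \<rho> r)) \<rho>' \<mu>'"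
    if t: "t \<le> length zs * (word_time + 1) + 1"
      and r': "repr xs ((out @ [0]) @ ys) \<mu>'" "\<rho>' rQ = D + length ((out @ [0]) @ ys)"
      and f: "\<rho>' rP = (length pre + 1) + length zs"
        "\<forall>r. r \<notin> {rP, rSz, rX, rY, rT, rAcc, rDig, rV, rQ} \<longrightarrow> \<rho>' r = \<rho>1 r" for t \<rho>' \<mu>'
  proof -
    have "\<rho>' rHd = q" "\<rho>' rCnt = Suc i" "\<rho>' rOne = 1" "\<rho>' rQ = q + 1 + length ys"
      using f(2) cnt const_regsD(3)[OF c(1)] r'(2) by (auto simp: \<rho>1_def q_def)
    moreover have "binop_val w Sub (q + 1 + length ys) q = Suc (length ys)"
      "binop_val w Sub (Suc (length ys)) 1 = length ys" "binop_val w Sub (Suc i) 1 = i"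
      using r(3) cnt(2) ys by (auto simp: q_def binop_val_Sub)
    moreover have "repr xs (((out @ [0]) @ ys)[length out := length ys]) (\<mu>'(D + length out := length ys))"
      by (rule repr_update[OF r'(1)]) simp
    then have "repr xs (out @ new_cells j zs) (\<mu>'(q := length ys))"
      by (simp add: new_cells_def set_cells_def ys_def q_def)
    moreover have "D + length (out @ new_cells j zs) = q + 1 + length ys"
      by (simp add: new_cells_def set_cells_def ys_def q_def)
    moreover have "4 + (t + 4) \<le> set_time"
      using t mult_le_mono1[OF xs(3), of "word_time + 1"] unfolding set_time_def by linarith
    ultimately show ?thesis
      using f unfolding seqs.simps
      by (intro wp_straight) (auto simp: \<rho>1_def set_cells_def)
  qed
  have "wp w (seqs [While rSz (do_word k p F), BinOp Sub rV rQ rHd, BinOp Sub rV rV rOne, Store rHd rV,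
      BinOp Sub rCnt rCnt rOne])
     (\<lambda>u \<rho>'' \<mu>''. 1 + (1 + (1 + (1 + u))) \<le> set_time \<and>
     repr xs (out @ new_cells j zs) \<mu>'' \<and> \<rho>'' rQ = D + length (out @ new_cells j zs) \<and>
     \<rho>'' rP = length pre + length (set_cells zs) \<and> \<rho>'' rCnt = i \<and>
     (\<forall>r. r \<notin> {rCnt, rHd, rP, rSz, rX, rY, rT, rAcc, rDig, rV, rQ} \<longrightarrow> \<rho>'' r = \<rho> r)) \<rho>1 \<mu>"
    by (rule wp_Cons, simp, rule wp_mono[OF words], rule fin_part) (auto simp: ys_def)
  then show ?thesis
    unfolding do_set_def
    by (intro wp_instr_Cons)
      (simp_all add: const_regsD[OF c(1)] xs(2) eqs[simplified] r(2) q_def[symmetric] \<rho>1_def)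
qed

abbreviation (input) work_regs :: "nat set" where
  "work_regs \<equiv> {rCnt, rHd, rP, rSz, rX, rY, rT, rAcc, rDig, rV, rQ}"

lemma length_new_cells:
  assumes "length zs \<le> 2 ^ b"
  shows "length (new_cells j zs) \<le> 1 + 2 ^ b * 2 ^ (k * b)"
  using order_trans[OF length_concat_gen[of j zs] mult_le_mono1[OF assms, of "2 ^ (k * b)"]]
  by (simp add: new_cells_def set_cells_def)

lemma length_concat_new_cells:
  assumes "\<forall>zs\<in>set Z. length zs \<le> 2 ^ b"
  shows "length (concat (map (new_cells j) Z)) \<le> length Z * (1 + 2 ^ b * 2 ^ (k * b))"
  using assms
proof (induction Z)
  case (Cons zs Z)
  then show ?case
    using length_new_cells[of zs j] by simp
qed simp

lemma D_le: "D \<le> k * (n * g) * (1 + 2 ^ b * 2 ^ (k * b)) + 3"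
proof -
  have "(1 + 2 ^ b * 1 :: nat) \<le> 1 + 2 ^ b * 2 ^ (k * b)"
    by (intro add_mono mult_le_mono) auto
  then have "k * (n * g) * (1 + 2 ^ b * 1) \<le> k * (n * g) * (1 + 2 ^ b * 2 ^ (k * b))"
    by (rule mult_le_mono2)
  then show ?thesis
    unfolding D_def mult_1_right by linarith
qed

definition family_time :: nat where
  "family_time = n * g * (set_time + 1) + 2"

lemma wp_do_family:
  assumes F: "F = Skip \<and> j = 0 \<or> F = fin \<and> 0 < j \<and> j < k"
    and c: "const_regs \<rho>" "\<rho> rM = M j" "\<rho> rJ = (2 ^ b) ^ j"
    and xs: "xs = pre @ concat (map set_cells Z) @ post" "\<rho> rP = length pre"
    and Z: "length Z = n * g" "\<forall>zs\<in>set Z. length zs \<le> 2 ^ b"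
    and r: "repr xs out \<mu>" "\<rho> rQ = D + length out" "D + length out + n * g * (1 + 2 ^ b * 2 ^ (k * b)) < 2 ^ w"
  shows "wp w (do_family k p F) (\<lambda>t \<rho>' \<mu>'. t \<le> family_time \<and>
     repr xs (out @ concat (map (new_cells j) Z)) \<mu>' \<and> \<rho>' rQ = D + length (out @ concat (map (new_cells j) Z)) \<and>
     \<rho>' rP = length pre + length (concat (map set_cells Z)) \<and>
     (\<forall>r. r \<notin> work_regs \<longrightarrow> \<rho>' r = \<rho> r)) \<rho> \<mu>"
proof -
  define l where "l = n * g"
  have l: "length Z = l" using Z(1) by (simp add: l_def)
  define S :: nat where "S = 1 + 2 ^ b * 2 ^ (k * b)"
  have lS: "D + length out + l * S < 2 ^ w" "l \<le> l * S"
    using r(3) by (simp_all add: l_def S_def)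
  then have l_w: "l < 2 ^ w" by linarith
  define dn where "dn = (\<lambda>i. take (l - i) Z)"
  have step: "dn i = dn (Suc i) @ [Z ! (l - Suc i)]" if "i < l" for i
  proof -
    have "l - i = Suc (l - Suc i)" "l - Suc i < length Z"
      using that l by auto
    then show ?thesis
      by (simp add: dn_def take_Suc_conv_app_nth)
  qed
  define Inv where "Inv = (\<lambda>i \<rho>' \<mu>'. \<rho>' rCnt = i \<and> i \<le> l \<and>
    \<rho>' rP = length (pre @ concat (map set_cells (dn i))) \<and>
    repr xs (out @ concat (map (new_cells j) (dn i))) \<mu>' \<and>
    \<rho>' rQ = D + length (out @ concat (map (new_cells j) (dn i))) \<and> (\<forall>r. r \<notin> work_regs \<longrightarrow> \<rho>' r = \<rho> r))"
  have body: "wp w (do_set k p F) (\<lambda>t \<rho>'' \<mu>''. t \<le> set_time \<and> Inv i \<rho>'' \<mu>'') \<rho>' \<mu>'"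
    if I: "Inv (Suc i) \<rho>' \<mu>'" for i \<rho>' \<mu>'
  proof -
    have i: "i < l" using I unfolding Inv_def by auto
    define zs where "zs = Z ! (l - Suc i)"
    have zs: "zs \<in> set Z"
      using i l by (auto simp: zs_def)
    have "Z = dn (Suc i) @ [zs] @ drop (l - i) Z"
      using step[OF i] append_take_drop_id[of "l - i" Z] by (simp add: dn_def zs_def)
    from arg_cong[OF this, of "\<lambda>Z. concat (map set_cells Z)"] have xs': "xs = (pre @ concat (map set_cells (dn (Suc i)))) @ set_cells zs @
        (concat (map set_cells (drop (l - i) Z)) @ post)"
      unfolding xs(1) by simp
    have c': "const_regs \<rho>'"
      by (rule const_regs_cong[OF c(1)]) (use I in \<open>auto simp: Inv_def\<close>)
    have "length (concat (map (new_cells j) (dn (Suc i)))) \<le> length (dn (Suc i)) * S"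
      unfolding S_def using Z(2) by (intro length_concat_new_cells) (auto simp: dn_def dest: in_set_takeD)
    moreover have "Suc (length (dn (Suc i))) * S \<le> l * S"
      using i l by (intro mult_le_mono1) (simp add: dn_def)
    ultimately have room: "D + length (out @ concat (map (new_cells j) (dn (Suc i)))) + S < 2 ^ w"
      using lS(1) by simp
    have "wp w (do_set k p F) (\<lambda>t \<rho>'' \<mu>''. t \<le> set_time \<and>
     repr xs ((out @ concat (map (new_cells j) (dn (Suc i)))) @ new_cells j zs) \<mu>'' \<and>
     \<rho>'' rQ = D + length ((out @ concat (map (new_cells j) (dn (Suc i)))) @ new_cells j zs) \<and>
     \<rho>'' rP = length (pre @ concat (map set_cells (dn (Suc i)))) + length (set_cells zs) \<and> \<rho>'' rCnt = i \<and>
     (\<forall>r. r \<notin> work_regs \<longrightarrow> \<rho>'' r = \<rho>' r)) \<rho>' \<mu>'"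
      by (rule wp_do_set[OF F c' _ _ xs']) (use I c zs Z(2) i l_w room in \<open>auto simp: Inv_def S_def\<close>)
    then show ?thesis
      using I i unfolding Inv_def step[OF i] by (auto elim!: wp_mono simp: zs_def)
  qed
  have "wp w (While rCnt (do_set k p F)) (\<lambda>t \<rho>' \<mu>'. t \<le> l * (set_time + 1) + 1 \<and> Inv 0 \<rho>' \<mu>') (\<rho>(rCnt := l)) \<mu>"
  proof (rule wp_While_countdown[where I = Inv, OF _ body])
    show "Inv l (\<rho>(rCnt := l)) \<mu>"
      using r xs unfolding Inv_def dn_def by simp
  qed (simp_all add: Inv_def)
  then have loop: "wp w (seqs [While rCnt (do_set k p F)])
      (\<lambda>t \<rho>' \<mu>'. 1 + t \<le> family_time \<and>
     repr xs (out @ concat (map (new_cells j) Z)) \<mu>' \<and> \<rho>' rQ = D + length (out @ concat (map (new_cells j) Z)) \<and>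
     \<rho>' rP = length pre + length (concat (map set_cells Z)) \<and>
     (\<forall>r. r \<notin> work_regs \<longrightarrow> \<rho>' r = \<rho> r)) (\<rho>(rCnt := l)) \<mu>"
    using l by (auto elim!: wp_mono simp: Inv_def dn_def family_time_def l_def)
  have "binop_val w Mul n g = l"
    using l_w unfolding l_def by (rule binop_val_Mul)
  then show ?thesis
    unfolding do_family_def using loop const_regsD(1,2)[OF c(1)] by (intro wp_instr_Cons) simp_all
qed

text \<open>The case \<open>j = k\<close> is included because the loop over the families computes
  one multiplier beyond the last family.\<close>

lemma M_less: "j \<le> k \<Longrightarrow> M j < 2 ^ w"
proof (cases "j = 0")
  case True
  have "(1::nat) < 2 ^ (2 * m)"
    using m_pos by (intro one_less_power) auto
  from repeated_less[OF this fields_fit] have "M 0 < 2 ^ b'"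
    by (simp add: M_def)
  then show ?thesis
    using exp_less[of b'] True by (simp only:) linarith
next
  case False
  assume "j \<le> k"
  then have "2 * m * (j - 1) \<le> 2 * m * (k - 1)"
    by (intro mult_le_mono2) simp
  then have "2 * m * (j - 1) \<le> b'"
    using fields_fit by linarith
  then show ?thesis
    using False exp_less by (simp add: M_def flip: power_mult)
qed

text \<open>Horner's rule for the number with all digits 1 in base \<open>W\<close>. Partial sums
  stay below the final one, so nothing overflows.\<close>

lemma wp_multiplier:
  assumes "const_regs \<rho>" "\<rho> rM = 0"
  shows "wp w (rep (k - 1) (Seq (BinOp Mul rM rM rW) (BinOp Add rM rM rOne)))
    (\<lambda>t \<rho>' \<mu>'. t \<le> 2 * k \<and> \<rho>' rM = M 0 \<and> \<mu>' = \<mu> \<and> (\<forall>r. r \<noteq> rM \<longrightarrow> \<rho>' r = \<rho> r)) \<rho> \<mu>"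
proof -
  let ?W = "2 ^ (2 * m) :: nat"
  define Inv where "Inv = (\<lambda>i \<rho>' \<mu>'. \<rho>' rM = (\<Sum>t<i. ?W ^ t) \<and> \<mu>' = \<mu> \<and> (\<forall>r. r \<noteq> rM \<longrightarrow> \<rho>' r = \<rho> r))"
  have body: "wp w (Seq (BinOp Mul rM rM rW) (BinOp Add rM rM rOne))
      (\<lambda>t \<rho>'' \<mu>''. t \<le> 2 \<and> Inv (Suc i) \<rho>'' \<mu>'') \<rho>' \<mu>'" if "i < k - 1" and I: "Inv i \<rho>' \<mu>'" for i \<rho>' \<mu>'
  proof -
    have eq: "(\<Sum>t<Suc i. ?W ^ t) = (\<Sum>t<i. ?W ^ t) * ?W + 1"
      by (simp add: sum.lessThan_Suc_shift sum_distrib_left sum_distrib_right mult.commute del: sum.lessThan_Suc)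
    have "(\<Sum>t<Suc i. ?W ^ t) \<le> (\<Sum>t<k - 1. ?W ^ t)"
      using that(1) by (intro sum_mono2) auto
    then have "(\<Sum>t<Suc i. ?W ^ t) \<le> M 0"
      by (simp only: M_def if_True simp_thms)
    then have "(\<Sum>t<i. ?W ^ t) * ?W + 1 < 2 ^ w"
      unfolding eq using M_less[of 0] by linarith
    then have "binop_val w Mul (\<Sum>t<i. ?W ^ t) ?W = (\<Sum>t<i. ?W ^ t) * ?W"
      "binop_val w Add ((\<Sum>t<i. ?W ^ t) * ?W) 1 = (\<Sum>t<Suc i. ?W ^ t)"
      unfolding eq by (auto intro!: binop_val_Mul binop_val_Add simp del: One_nat_def)
    moreover have "\<rho>' rW = ?W" "\<rho>' rOne = 1" "\<rho>' rM = (\<Sum>t<i. ?W ^ t)"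
      using I const_regsD(3,7)[OF assms(1)] unfolding Inv_def by auto
    ultimately show ?thesis
      using I by (intro wp_straight) (simp add: Inv_def del: sum.lessThan_Suc)
  qed
  have "wp w (rep (k - 1) (Seq (BinOp Mul rM rM rW) (BinOp Add rM rM rOne)))
      (\<lambda>t \<rho>' \<mu>'. t \<le> (k - 1) * 2 + 1 \<and> Inv (k - 1) \<rho>' \<mu>') \<rho> \<mu>"
    by (rule wp_rep[where I = Inv, OF body]) (use assms in \<open>auto simp: Inv_def\<close>)
  then show ?thesis
    using k by (auto elim!: wp_mono simp: Inv_def M_def)
qed

definition in_cells :: "nat list list list \<Rightarrow> nat \<Rightarrow> nat list" where
  "in_cells Zs j = concat (map (\<lambda>i. concat (map set_cells (Zs ! i))) [0..<j])"

definition out_cells :: "nat list list list \<Rightarrow> nat \<Rightarrow> nat list" where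
  "out_cells Zs j = concat (map (\<lambda>i. concat (map (new_cells i) (Zs ! i))) [0..<j])"

lemma in_cells_Suc: "in_cells Zs (Suc j) = in_cells Zs j @ concat (map set_cells (Zs ! j))"
  and out_cells_Suc: "out_cells Zs (Suc j) = out_cells Zs j @ concat (map (new_cells j) (Zs ! j))"
  by (simp_all add: in_cells_def out_cells_def)

lemma length_out_cells:
  assumes "\<And>i. i < j \<Longrightarrow> length (Zs ! i) = n * g \<and> (\<forall>zs\<in>set (Zs ! i). length zs \<le> 2 ^ b)"
  shows "length (out_cells Zs j) \<le> j * (n * g * (1 + 2 ^ b * 2 ^ (k * b)))"
  using assms
proof (induction j)
  case (Suc j)
  have "length (out_cells Zs j) \<le> j * (n * g * (1 + 2 ^ b * 2 ^ (k * b)))"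
    by (rule Suc.IH, rule Suc.prems) simp
  then show ?case
    using length_concat_new_cells[of "Zs ! j" j] Suc.prems[of j] by (simp add: out_cells_Suc)
qed (simp add: out_cells_def)

definition families_time :: nat where
  "families_time = 2 * k + family_time + 3 + (k - 1) * (family_time + 2)"

lemma wp_do_families:
  assumes Zs: "\<And>j. j < k \<Longrightarrow> length (Zs ! j) = n * g \<and> (\<forall>zs\<in>set (Zs ! j). length zs \<le> 2 ^ b)"
    and xs: "xs = [n, g, b] @ in_cells Zs k" "\<rho> rP = 3"
    and c: "const_regs \<rho>" "\<rho> rM = 0" "\<rho> rJ = 1"
    and r: "repr xs [n, g, b'] \<mu>" "\<rho> rQ = D + 3"
  shows "wp w (do_families k p fin) (\<lambda>t \<rho>' \<mu>'. t \<le> families_time \<and>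
     repr xs ([n, g, b'] @ out_cells Zs k) \<mu>' \<and> \<rho>' rQ = D + length ([n, g, b'] @ out_cells Zs k) \<and>
     (\<forall>r. r \<notin> insert rM (insert rJ work_regs) \<longrightarrow> \<rho>' r = \<rho> r)) \<rho> \<mu>"
proof -
  define S where "S = n * g * (1 + 2 ^ b * 2 ^ (k * b))"
  have len_out: "length (out_cells Zs j) \<le> j * S" if "j \<le> k" for j
    unfolding S_def by (rule length_out_cells, rule Zs) (use that in simp)
  have D_le_S: "D \<le> k * S + 3"
    using D_le unfolding S_def by (simp only: mult.assoc)
  have size_w': "3 * (k * S + 3) < 2 ^ w"
    using size_w unfolding S_def by (simp only: mult.assoc)
  have room: "D + length ([n, g, b'] @ out_cells Zs j) + S < 2 ^ w" if "j < k" for j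
  proof -
    have "Suc j * S \<le> k * S"
      using that by (intro mult_le_mono1) simp
    then show ?thesis
      using len_out[of j] that D_le_S size_w' by simp
  qed
  have split: "xs = ([n, g, b] @ in_cells Zs j) @ concat (map set_cells (Zs ! j)) @
      concat (map (\<lambda>i. concat (map set_cells (Zs ! i))) [Suc j..<k])" if "j < k" for j
  proof -
    have "[0..<k] = [0..<j] @ [j] @ [Suc j..<k]"
      using that upt_add_eq_append[of 0 j "k - j"] upt_conv_Cons[of j k] by simp
    then show ?thesis
      by (simp add: xs(1) in_cells_def)
  qed
  define Inv where "Inv = (\<lambda>j \<rho>' \<mu>'. \<rho>' rM = M j \<and> \<rho>' rJ = (2 ^ b) ^ j \<and>
     \<rho>' rP = length ([n, g, b] @ in_cells Zs j) \<and> repr xs ([n, g, b'] @ out_cells Zs j) \<mu>' \<and>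
     \<rho>' rQ = D + length ([n, g, b'] @ out_cells Zs j) \<and>
     (\<forall>r. r \<notin> insert rM (insert rJ work_regs) \<longrightarrow> \<rho>' r = \<rho> r))"
  \<comment> \<open>The invariant for the next family is stated for updated \<open>rM\<close> and
    \<open>rJ\<close>, because family 0 and the later ones advance these two registers
    differently.\<close>
  have family: "wp w (do_family k p F) (\<lambda>t \<rho>'' \<mu>''. t \<le> family_time \<and> Inv (Suc j) (\<rho>''(rM := M (Suc j), rJ := (2 ^ b) ^ Suc j)) \<mu>'' \<and>
      (\<forall>r. r \<notin> work_regs \<longrightarrow> \<rho>'' r = \<rho>' r)) \<rho>' \<mu>'"
    if F: "F = Skip \<and> j = 0 \<or> F = fin \<and> 0 < j \<and> j < k" and I: "Inv j \<rho>' \<mu>'" for F j \<rho>' \<mu>'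
  proof -
    have j: "j < k" using F k by auto
    have c': "const_regs \<rho>'"
      by (rule const_regs_cong[OF c(1)]) (use I in \<open>auto simp: Inv_def\<close>)
    have "wp w (do_family k p F) (\<lambda>t \<rho>'' \<mu>''. t \<le> family_time \<and>
     repr xs (([n, g, b'] @ out_cells Zs j) @ concat (map (new_cells j) (Zs ! j))) \<mu>'' \<and>
     \<rho>'' rQ = D + length (([n, g, b'] @ out_cells Zs j) @ concat (map (new_cells j) (Zs ! j))) \<and>
     \<rho>'' rP = length ([n, g, b] @ in_cells Zs j) + length (concat (map set_cells (Zs ! j))) \<and>
     (\<forall>r. r \<notin> work_regs \<longrightarrow> \<rho>'' r = \<rho>' r)) \<rho>' \<mu>'"
      by (rule wp_do_family[OF F c' _ _ split[OF j]]) (use I Zs[OF j] room[OF j] in \<open>auto simp: Inv_def S_def\<close>)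
    then show ?thesis
      by (rule wp_mono) (use I in \<open>auto simp: Inv_def in_cells_Suc out_cells_Suc\<close>)
  qed
  have body: "wp w (seqs [do_family k p fin, BinOp Mul rM rM rW, BinOp Mul rJ rJ rBase])
      (\<lambda>t \<rho>'' \<mu>''. t \<le> family_time + 2 \<and> Inv (Suc (Suc i)) \<rho>'' \<mu>'') \<rho>' \<mu>'"
    if i: "i < k - 1" and I: "Inv (Suc i) \<rho>' \<mu>'" for i \<rho>' \<mu>'
  proof -
    have "\<rho>' rM = M (Suc i)" "\<rho>' rJ = (2 ^ b) ^ Suc i" "\<rho>' rW = 2 ^ (2 * m)" "\<rho>' rBase = 2 ^ b"
      using I const_regsD(4,7)[OF c(1)] by (auto simp: Inv_def)
    moreover have "binop_val w Mul (M (Suc i)) (2 ^ (2 * m)) = M (Suc (Suc i))"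
      using M_less[of "Suc (Suc i)"] i by (subst binop_val_Mul) (auto simp: M_def mult.commute)
    moreover have "binop_val w Mul ((2 ^ b) ^ Suc i) (2 ^ b) = (2 ^ b) ^ Suc (Suc i)"
    proof -
      have "b * Suc (Suc i) \<le> b * k"
        using i by (intro mult_le_mono2) simp
      then have "b * Suc (Suc i) \<le> b'"
        using b_le(2,3) by (simp only: mult.commute[of b k])
      then have "(2::nat) ^ (b * Suc (Suc i)) < 2 ^ w"
        by (rule exp_less)
      then show ?thesis
        by (subst binop_val_Mul) (simp_all add: power_mult[symmetric] power_add[symmetric])
    qed
    ultimately show ?thesis
      using i by (intro wp_Cons wp_mono[OF family[OF _ I, of fin]])
        (auto intro!: wp_straight simp: seqs.simps simp del: power_Suc)
  qed
  have fams: "wp w (rep (k - 1) (seqs [do_family k p fin, BinOp Mul rM rM rW, BinOp Mul rJ rJ rBase]))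
      (\<lambda>t \<rho>'' \<mu>''. t \<le> (k - 1) * (family_time + 2) + 1 \<and> Inv (Suc (k - 1)) \<rho>'' \<mu>'') \<rho>' \<mu>'"
    if "Inv (Suc 0) \<rho>' \<mu>'" for \<rho>' \<mu>'
    by (rule wp_rep[where I = "\<lambda>i. Inv (Suc i)", OF body]) (use that in auto)
  have w0: "0 < w"
    using b'_w by simp
  have tail: "wp w (seqs [Const rM 1, Copy rJ rBase,
     rep (k - 1) (seqs [do_family k p fin, BinOp Mul rM rM rW, BinOp Mul rJ rJ rBase])])
      (\<lambda>t \<rho>'' \<mu>''. 2 * k + (family_time + t) \<le> families_time \<and>
       Inv (Suc (k - 1)) \<rho>'' \<mu>'') \<rho>' \<mu>'"
    if "Inv (Suc 0) (\<rho>'(rM := M (Suc 0), rJ := (2 ^ b) ^ Suc 0)) \<mu>'" "\<rho>' rBase = 2 ^ b" for \<rho>' \<mu>'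
  proof -
    have "Inv (Suc 0) (\<rho>'(rM := 1, rJ := 2 ^ b)) \<mu>'"
      using that(1) by (simp add: M_def)
    from wp_mono[OF fams[OF this]]
    have "wp w (seqs [rep (k - 1) (seqs [do_family k p fin, BinOp Mul rM rM rW, BinOp Mul rJ rJ rBase])])
      (\<lambda>t \<rho>'' \<mu>''. 2 * k + (family_time + (1 + (1 + t))) \<le> families_time \<and>
       Inv (Suc (k - 1)) \<rho>'' \<mu>'') (\<rho>'(rM := 1, rJ := 2 ^ b)) \<mu>'"
      by (simp add: families_time_def)
    then show ?thesis
      using that(2) w0 by (intro wp_instr_Cons) simp_all
  qed
  have rest: "wp w (seqs [do_family k p Skip, Const rM 1, Copy rJ rBase,
     rep (k - 1) (seqs [do_family k p fin, BinOp Mul rM rM rW, BinOp Mul rJ rJ rBase])])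
      (\<lambda>t \<rho>'' \<mu>''. 2 * k + t \<le> families_time \<and>
       Inv (Suc (k - 1)) \<rho>'' \<mu>'') \<rho>' \<mu>'" if I: "Inv 0 \<rho>' \<mu>'" for \<rho>' \<mu>'
  proof (rule wp_Cons, simp, rule wp_mono[OF family[OF _ I, of Skip]])
    fix t \<rho>'' \<mu>''
    assume "t \<le> family_time \<and> Inv (Suc 0) (\<rho>''(rM := M (Suc 0), rJ := (2 ^ b) ^ Suc 0)) \<mu>'' \<and>
      (\<forall>r. r \<notin> work_regs \<longrightarrow> \<rho>'' r = \<rho>' r)"
    moreover have "\<rho>' rBase = 2 ^ b"
      using I const_regsD(4)[OF c(1)] by (auto simp: Inv_def)
    ultimately show "wp w (seqs [Const rM 1, Copy rJ rBase,
         rep (k - 1) (seqs [do_family k p fin, BinOp Mul rM rM rW, BinOp Mul rJ rJ rBase])])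
      (\<lambda>u \<rho>'' \<mu>''. 2 * k + (t + u) \<le> families_time \<and> Inv (Suc (k - 1)) \<rho>'' \<mu>'') \<rho>'' \<mu>''"
      by (intro wp_mono[OF tail]) auto
  qed simp
  have "wp w (do_families k p fin) (\<lambda>t \<rho>' \<mu>'. t \<le> families_time \<and> Inv (Suc (k - 1)) \<rho>' \<mu>') \<rho> \<mu>"
    unfolding do_families_def
  proof (rule wp_Cons, simp, rule wp_mono[OF wp_multiplier[OF c(1,2)]])
    fix t \<rho>' \<mu>'
    assume *: "t \<le> 2 * k \<and> \<rho>' rM = M 0 \<and> \<mu>' = \<mu> \<and> (\<forall>r. r \<noteq> rM \<longrightarrow> \<rho>' r = \<rho> r)"
    then have "Inv 0 \<rho>' \<mu>'"
      using xs(2) c r by (auto simp: Inv_def in_cells_def out_cells_def)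
    from rest[OF this] show "wp w (seqs [do_family k p Skip, Const rM 1, Copy rJ rBase,
         rep (k - 1) (seqs [do_family k p fin, BinOp Mul rM rM rW, BinOp Mul rJ rJ rBase])])
      (\<lambda>u \<rho>'' \<mu>''. t + u \<le> families_time \<and> Inv (Suc (k - 1)) \<rho>'' \<mu>'') \<rho>' \<mu>'"
      using * by (auto elim!: wp_mono)
  qed
  then show ?thesis
    using k by (auto elim!: wp_mono simp: Inv_def)
qed

text \<open>Sources lie \<open>D\<close> cells ahead of their targets, so copying in ascending order
  never overwrites a cell that is still to be read.\<close>

lemma wp_move_down:
  assumes c: "const_regs \<rho>" and r: "repr xs out \<mu>" "\<rho> rQ = D + length out" "D + length out + D < 2 ^ w"
  shows "wp w move_down (\<lambda>t \<rho>' \<mu>'. t \<le> 6 * (D + length out) + 3 \<and>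
     \<mu>' = (\<lambda>a. if a < length out then out ! a else 0) \<and>
     (\<forall>r. r \<notin> {rCnt, rX, rY, rV} \<longrightarrow> \<rho>' r = \<rho> r)) \<rho> \<mu>"
proof -
  define E where "E = D + length out"
  define Inv where "Inv = (\<lambda>i \<rho>' \<mu>'. \<rho>' rCnt = i \<and> i \<le> E \<and> \<rho>' rX = E - i \<and>
     \<mu>' = (\<lambda>a. if a < E - i then \<mu> (a + D) else \<mu> a) \<and>
     (\<forall>r. r \<notin> {rCnt, rX, rY, rV} \<longrightarrow> \<rho>' r = \<rho> r))"
  have body: "wp w shift_cell (\<lambda>t \<rho>'' \<mu>''. t \<le> 5 \<and> Inv i \<rho>'' \<mu>'') \<rho>' \<mu>'"
    if I: "Inv (Suc i) \<rho>' \<mu>'" for i \<rho>' \<mu>'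
  proof -
    define a where "a = E - Suc i"
    have a: "E - i = Suc a" "a < E" "i < E"
      using I by (auto simp: a_def Inv_def)
    have regs: "\<rho>' rCnt = Suc i" "\<rho>' rX = a" "\<rho>' rD = D" "\<rho>' rOne = 1"
      using I const_regsD(3,10)[OF c] by (auto simp: Inv_def a_def)
    have vals: "binop_val w Add a D = a + D" "binop_val w Add a 1 = Suc a" "binop_val w Sub (Suc i) 1 = i"
      using a r(3) by (auto simp: binop_val_Add binop_val_Sub E_def)
    have "\<mu>' (a + D) = \<mu> (a + D)"
      using I r(1) by (auto simp: Inv_def a_def repr_def)
    moreover have "D > 0" by (simp add: D_def)
    ultimately have "\<mu>'(a := \<mu>' (a + D)) = (\<lambda>x. if x < Suc a then \<mu> (x + D) else \<mu> x)"
      using I by (auto simp: Inv_def a_def[symmetric] less_Suc_eq)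
    then show ?thesis
      using I regs vals a unfolding shift_cell_def seqs.simps
      by (intro wp_straight) (auto simp: Inv_def)
  qed
  have E_w: "E < 2 ^ w"
    using r(3) by (simp add: E_def)
  have "wp w (While rCnt shift_cell) (\<lambda>t \<rho>' \<mu>'. t \<le> E * (5 + 1) + 1 \<and> Inv 0 \<rho>' \<mu>') (\<rho>(rCnt := E, rX := 0)) \<mu>"
  proof (rule wp_While_countdown[where I = Inv, OF _ body])
    show "Inv E (\<rho>(rCnt := E, rX := 0)) \<mu>"
      by (auto simp: Inv_def)
  qed (simp_all add: Inv_def)
  moreover have "(\<lambda>a. if a < E then \<mu> (a + D) else \<mu> a) = (\<lambda>a. if a < length out then out ! a else 0)"
    using r(1) by (auto simp: repr_def E_def fun_eq_iff add.commute[of _ D])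
  ultimately have "wp w (seqs [While rCnt shift_cell]) (\<lambda>t \<rho>' \<mu>'. 1 + (1 + t) \<le> 6 * E + 3 \<and>
     \<mu>' = (\<lambda>a. if a < length out then out ! a else 0) \<and>
     (\<forall>r. r \<notin> {rCnt, rX, rY, rV} \<longrightarrow> \<rho>' r = \<rho> r)) (\<rho>(rCnt := E, rX := 0)) \<mu>"
    by (auto elim!: wp_mono simp: Inv_def)
  then show ?thesis
    unfolding move_down_def using r(2) by (intro wp_instr_Cons) (simp_all add: E_def)
qed

lemma wp_clear:
  assumes "rs \<noteq> []"
  shows "wp w (seqs (map (\<lambda>r. Const r 0) rs))
    (\<lambda>t \<rho>' \<mu>'. t \<le> length rs \<and> \<mu>' = \<mu> \<and> \<rho>' = (\<lambda>r. if r \<in> set rs then 0 else \<rho> r)) \<rho> \<mu>"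
  using assms
proof (induction rs arbitrary: \<rho>)
  case (Cons r rs)
  show ?case
  proof (cases "rs = []")
    case True
    then show ?thesis
      by (auto intro!: wp_Const)
  next
    case False
    have "wp w (seqs (map (\<lambda>r. Const r 0) rs))
      (\<lambda>t \<rho>' \<mu>'. 1 + t \<le> length (r # rs) \<and> \<mu>' = \<mu> \<and> \<rho>' = (\<lambda>x. if x \<in> set (r # rs) then 0 else \<rho> x)) (\<rho>(r := 0)) \<mu>"
      by (rule wp_mono[OF Cons.IH[OF False]]) auto
    then show ?thesis
      using False by (simp only: list.map) (intro wp_instr_Cons, simp_all)
  qed
qed simp

lemma wp_setup_regs:
  assumes "\<mu> 0 = n" "\<mu> 1 = g" "\<mu> 2 = b"
  shows "wp w (setup_regs k) (\<lambda>t \<rho>' \<mu>'. t \<le> 27 \<and> \<mu>' = \<mu> \<and> const_regs \<rho>' \<and> \<rho>' rP = 3 \<and> \<rho>' rJ = 1 \<and> \<rho>' rM = 0 \<and>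
     (\<forall>r. r \<notin> {2..<26} \<longrightarrow> \<rho>' r = 0)) (\<lambda>_. 0) \<mu>"
proof -
  have b'2: "2 \<le> b'" "2 * (k - 1) \<le> b'" "k \<le> b'" "g \<le> b'"
  proof -
    have "2 * 1 * (k - 1) \<le> 2 * m * (k - 1)"
      using m_pos by (intro mult_le_mono1 mult_le_mono2) simp
    then show "2 \<le> b'" "2 * (k - 1) \<le> b'" "k \<le> b'" "g \<le> b'"
      using k unfolding b'_def by linarith+
  qed
  have w: "b' < 2 ^ w"
    using b'_w less_exp[of w] by linarith
  \<comment> \<open>\<open>b' \<ge> 2\<close> forces \<open>w \<ge> 3\<close>, so the small
    constants used as addresses and offsets fit into a word.\<close>
  have "(2::nat) ^ 3 \<le> 2 ^ w"
    using b'2 b'_w by (intro power_increasing) auto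
  then have w8: "8 \<le> (2::nat) ^ w" by simp
  define kb c1 B1 B2 ng kng base1 D3 where defs: "kb = k * b" "c1 = 2 * (k - 1)" "B1 = c1 * m" "B2 = B1 + g"
    "ng = n * g" "kng = ng * k" "base1 = (2 ^ b + 1 :: nat)" "D3 = kng * base1"
  have b'_eq: "b' = B2 + 2"
    by (simp add: b'_def defs mult.assoc mult.commute[of m])
  have D_eq: "D = D3 + 3"
    by (simp add: D_def defs mult.assoc mult.commute[of k])
  have D_w: "D < 2 ^ w"
  proof -
    have "x \<le> 3 * x" for x :: nat by simp
    from le_less_trans[OF order_trans[OF D_le this] size_w] show ?thesis .
  qed
  have "ng \<le> kng" "kng \<le> D3"
    using k by (simp_all add: defs)
  then have "ng < 2 ^ w"
    using D_w D_eq by linarith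
  then have v_ng: "binop_val w Mul n g = ng"
    unfolding defs by (rule binop_val_Mul)
  have "base1 < 2 ^ w"
  proof -
    have "(2::nat) ^ b < 2 ^ Suc b" by simp
    also have "\<dots> \<le> 2 ^ m"
      using k by (intro power_increasing) (simp_all add: m_def)
    finally show ?thesis
      using exp_less[OF b_le(3)] unfolding defs by linarith
  qed
  then have v: "binop_val w Mul k b = kb" "binop_val w Add kb 1 = m" "binop_val w Mul c1 m = B1"
    "binop_val w Add B1 g = B2" "binop_val w Add B2 2 = b'"
    "binop_val w Mul ng k = kng" "binop_val w Add (2 ^ b) 1 = base1" "binop_val w Mul kng base1 = D3"
    "binop_val w Add D3 3 = D" "binop_val w Mul (2 ^ m) (2 ^ m) = 2 ^ (2 * m)"
    "binop_val w Add 0 1 = 1" "binop_val w Add 1 1 = 2" "binop_val w Add 2 1 = 3"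
    using D_w w w8 b'_eq b_le m_le D_eq exp_less[OF m_le]
    by (auto simp: binop_val.simps defs m_def power_add[symmetric] mult_2 simp del: power_Suc)
  have s: "binop_val w Shl 1 b = 2 ^ b" "binop_val w Shl 1 kb = 2 ^ (k * b)" "binop_val w Shl 1 m = 2 ^ m"
    "binop_val w Shl 1 b' = 2 ^ b'"
    using b_le b'_w m_le by (auto simp: defs intro!: binop_val_Shl simp del: One_nat_def)
  have cs: "1 mod 2 ^ w = (1::nat)" "k mod 2 ^ w = k" "c1 mod 2 ^ w = c1" "2 mod 2 ^ w = (2::nat)"
    using w w8 b'2 b'_w by (auto simp: defs)
  note eqs = v[simplified] v_ng s[simplified] cs[simplified] assms[simplified]
  show ?thesis
    unfolding setup_regs_def defs(2)[symmetric]
    by ((rule wp_instr_Cons, simp, simp add: eqs)+, rule wp_BinOp, simp add: const_regs_def)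
qed

lemma wp_write_header:
  assumes c: "const_regs \<rho>" and r: "repr xs [] \<mu>" and D_w: "D + 3 < 2 ^ w"
  shows "wp w write_header (\<lambda>t \<rho>' \<mu>'. t \<le> 7 \<and> repr xs [n, g, b'] \<mu>' \<and> \<rho>' rQ = D + 3 \<and>
    (\<forall>r. r \<noteq> rQ \<longrightarrow> \<rho>' r = \<rho> r)) \<rho> \<mu>"
proof -
  have "repr xs [n, g, b'] (\<mu>(D := n, D + 1 := g, D + 2 := b'))"
    using repr_append[OF repr_append[OF repr_append[OF r, of n], of g], of b']
    by (simp add: numeral_2_eq_2)
  moreover have "binop_val w Add D 1 = D + 1" "binop_val w Add (D + 1) 1 = D + 2"
    "binop_val w Add (D + 2) 1 = D + 3"
    using D_w by (simp_all add: binop_val_Add)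
  ultimately show ?thesis
    unfolding write_header_def seqs.simps using const_regsD[OF c]
    by (intro wp_straight) simp
qed

lemma map_val_new_list:
  assumes "j < k"
  shows "map val (new_list j ys) = concat (map (gen j) (map val ys))"
proof -
  have "val (bits b' (enc j Y)) = enc j Y" if "Y < 2 ^ (k * b)" for Y
    by (rule val_bits[OF enc_less[OF that assms]])
  then show ?thesis
    unfolding new_list_def gen_def map_concat map_map comp_def
    by (intro arg_cong[of _ _ concat] map_cong refl) simp
qed

text \<open>The final \<open>+ 1\<close> pays for the fixed overhead when
  \<open>n * g = 0\<close>.\<close>

definition transform_time :: nat where
  "transform_time = (4 * k * k + 56 * k + 110) * (n * g * (2 ^ b * 2 ^ (k * b)) + 1)"

lemma time_bound:
  assumes "l \<le> k * (n * g) * (1 + 2 ^ b * 2 ^ (k * b)) + 3"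
  shows "27 + (7 + (families_time + (6 * (D + l) + 3 + 24))) \<le> transform_time"
proof -
  define P B :: nat where "P = 2 ^ (k * b)" and "B = 2 ^ b"
  have pos: "P \<ge> 1" "B \<ge> 1" "B * P \<ge> 1"
    by (simp_all add: P_def B_def)
  \<comment> \<open>The common unit of all costs: the maximal number of codes tried per family.
    Lower-order terms are absorbed with \<open>B * P \<ge> 1\<close>.\<close>
  define U where "U = n * g * (B * P)"
  have "word_time + 1 \<le> P * (4 * k + 22)"
    using pos(1) unfolding word_time_def P_def[symmetric] by (simp add: algebra_simps)
  then have "B * (word_time + 1) \<le> B * (P * (4 * k + 22))"
    by (rule mult_le_mono2)
  then have "set_time + 1 \<le> B * P * (4 * k + 22) + 10"
    unfolding set_time_def B_def[symmetric] by (simp add: mult.assoc)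
  also have "\<dots> \<le> B * P * (4 * k + 32)"
    using pos(3) by (simp add: algebra_simps)
  finally have "n * g * (set_time + 1) \<le> n * g * (B * P * (4 * k + 32))"
    by (rule mult_le_mono2)
  then have fam: "family_time \<le> U * (4 * k + 32) + 2"
    unfolding family_time_def U_def by (simp add: mult.assoc)
  have "families_time \<le> k * (family_time + 2) + 2 * k + 1"
  proof -
    obtain k' where "k = Suc k'" using k by (cases k) auto
    then show ?thesis unfolding families_time_def by simp
  qed
  also have "\<dots> \<le> k * (U * (4 * k + 32) + 4) + 2 * k + 1"
    using mult_le_mono2[of "family_time + 2" "U * (4 * k + 32) + 4" k] fam by simp
  finally have fams: "families_time \<le> (4 * k * k + 32 * k) * U + 6 * k + 1"
    by (simp add: algebra_simps)
  have "k * (n * g) * (1 + B * P) \<le> k * (n * g) * (B * P + B * P)"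
    using pos(3) by (intro mult_le_mono2) simp
  also have "\<dots> = 2 * k * U"
    by (simp add: U_def algebra_simps)
  finally have "l \<le> 2 * k * U + 3" "D \<le> 2 * k * U + 3"
    using assms D_le unfolding P_def B_def by simp_all
  then have "27 + (7 + (families_time + (6 * (D + l) + 3 + 24))) \<le> (4 * k * k + 56 * k) * U + 6 * k + 98"
    using fams by (simp add: algebra_simps)
  also have "\<dots> \<le> transform_time"
    unfolding transform_time_def P_def[symmetric] B_def[symmetric] U_def[symmetric] by (simp add: algebra_simps)
  finally show ?thesis .
qed

text \<open>The final state is literally the initial state for the new instance, including clean
  registers and memory, so sequential composition with the solver is immediate.\<close>

lemma transform_correct:
  assumes V: "factored_instance k n g b V" and I: "list_all2 lists_fvecs I V"
  shows "\<exists>t \<le> transform_time. exec w (transform k p fin) (init_state w (encode_instance n g b I)) t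
    (init_state w (encode_instance n g b' (new_lists I)))"
proof -
  define Zs where "Zs = map (\<lambda>L. map (map val) (concat L)) I"
  have len_I: "length I = k"
    using V I by (auto simp: factored_instance_def dest: list_all2_lengthD)
  have sets: "length (concat (I ! j)) = n * g \<and>
      (\<forall>ys\<in>set (concat (I ! j)). length ys \<le> 2 ^ b \<and> (\<forall>u\<in>set ys. length u = b))" if j: "j < k" for j
  proof -
    have "lists_fvecs (I ! j) (V ! j)"
      using I j len_I by (simp add: list_all2_conv_all_nth)
    then obtain vs where vs: "distinct vs" "set vs = V ! j" "list_all2 lists_fvec (I ! j) vs"
      by (auto simp: lists_fvecs_def)
    have n: "length vs = n" and sub: "set vs \<subseteq> factored_vectors g b"
      using V_nth[OF V j] vs(2) distinct_card[OF vs(1)] by auto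
    have each: "length xss = g \<and> (\<forall>ys\<in>set xss. distinct ys \<and> (\<forall>u\<in>set ys. length u = b))"
      if xss: "xss \<in> set (I ! j)" for xss
    proof -
      obtain v where v: "v \<in> set vs" "lists_fvec xss v"
        using vs(3) xss by (metis in_set_conv_nth list_all2_conv_all_nth)
      then show ?thesis
        using subsetD[OF sub v(1)] v(2) by (auto simp: lists_fvec_def factored_vectors_def)
    qed
    have "length (concat (I ! j)) = sum_list (map length (I ! j))"
      by (rule length_concat)
    also have "map length (I ! j) = replicate n g"
      using each n list_all2_lengthD[OF vs(3)] by (metis length_map replicate_eqI in_set_conv_nth nth_map)
    finally have "length (concat (I ! j)) = n * g"
      by (simp add: sum_list_replicate)
    moreover have "length ys \<le> 2 ^ b" if "distinct ys" "\<forall>u\<in>set ys. length u = b" for ys :: "bitvec list"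
    proof -
      have "card (set ys) \<le> card {u. set u \<subseteq> (UNIV :: bool set) \<and> length u = b}"
        using that(2) by (intro card_mono finite_lists_length_eq) auto
      then show ?thesis
        using distinct_card[OF that(1)] card_lists_length_eq[of "UNIV :: bool set" b] by simp
    qed
    ultimately show ?thesis
      using each by auto
  qed
  have Zs: "length (Zs ! j) = n * g \<and> (\<forall>zs\<in>set (Zs ! j). length zs \<le> 2 ^ b)" if "j < k" for j
    using sets[OF that] that len_I by (auto simp: Zs_def)
  have upt: "map ((!) I) [0..<k] = I"
    using len_I map_nth by blast
  define xs where "xs = encode_instance n g b I"
  define out where "out = encode_instance n g b' (new_lists I)"
  have encode_set_eq: "encode_set = set_cells \<circ> map val"
    by (auto simp: encode_set_def set_cells_def fun_eq_iff)
  have concats: "concat (map h (concat (concat (map G js)))) = concat (map (\<lambda>j. concat (map h (concat (G j)))) js)"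
    for h :: "bitvec list \<Rightarrow> nat list" and G :: "nat \<Rightarrow> bitvec list list list" and js
    by (induction js) auto
  have xs_eq: "xs = [n, g, b] @ in_cells Zs k"
  proof -
    have "concat (map encode_set (concat (I ! j))) = concat (map set_cells (Zs ! j))" if "j < k" for j
      using that len_I by (simp add: Zs_def encode_set_eq)
    then have "map (\<lambda>j. concat (map encode_set (concat (I ! j)))) [0..<k] =
        map (\<lambda>j. concat (map set_cells (Zs ! j))) [0..<k]"
      by (intro map_cong) simp_all
    then show ?thesis
      using concats[of encode_set "(!) I" "[0..<k]"]
      by (simp only: xs_def encode_instance_def in_cells_def upt)
  qed
  have out_eq: "out = [n, g, b'] @ out_cells Zs k"
  proof -
    have "concat (map encode_set (concat (map (map (new_list j)) (I ! j)))) =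
        concat (map (new_cells j) (Zs ! j))" if "j < k" for j
    proof -
      have "encode_set (new_list j ys) = new_cells j (map val ys)" for ys
        using map_val_new_list[OF that, of ys] by (simp add: encode_set_eq new_cells_def)
      then show ?thesis
        using that len_I by (simp add: Zs_def map_concat[symmetric] comp_def)
    qed
    then have "map (\<lambda>j. concat (map encode_set (concat (map (map (new_list j)) (I ! j))))) [0..<k] =
        map (\<lambda>j. concat (map (new_cells j) (Zs ! j))) [0..<k]"
      by (intro map_cong) simp_all
    then show ?thesis
      using concats[of encode_set "\<lambda>j. map (map (new_list j)) (I ! j)" "[0..<k]"]
      by (simp only: out_def encode_instance_def out_cells_def new_lists_def)
  qed
  have len_in: "length (in_cells Zs j) \<le> j * (n * g * (1 + 2 ^ b))" if "j \<le> k" for j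
    using that
  proof (induction j)
    case (Suc j)
    have "length (concat (map set_cells Z)) \<le> length Z * (1 + 2 ^ b)"
      if "\<forall>zs\<in>set Z. length zs \<le> 2 ^ b" for Z
      using that by (induction Z) (auto simp: set_cells_def)
    from this[of "Zs ! j"] show ?case
      using Suc Zs[of j] by (simp add: in_cells_Suc)
  qed (simp add: in_cells_def)
  have len_xs: "length xs \<le> D"
    using len_in[of k] by (simp add: xs_eq D_def algebra_simps)
  have len_out: "length out \<le> k * (n * g) * (1 + 2 ^ b * 2 ^ (k * b)) + 3"
    using length_out_cells[of k Zs, OF Zs] by (simp add: out_eq algebra_simps)
  define S where "S = k * (n * g) * (1 + 2 ^ b * 2 ^ (k * b)) + 3"
  have room: "D + length out + D < 2 ^ w" "D + 3 < 2 ^ w"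
    using D_le len_out size_w unfolding S_def[symmetric] out_eq by simp_all
  have small: "n < 2 ^ w" "g < 2 ^ w" "b < 2 ^ w" "b' < 2 ^ w"
  proof -
    show "n < 2 ^ w" by (rule n_w)
    have "w < 2 ^ w" by (rule less_exp)
    then show "g < 2 ^ w" "b < 2 ^ w" "b' < 2 ^ w"
      using b'_w b_le unfolding b'_def by linarith+
  qed
  have exps: "(2::nat) ^ b < 2 ^ w" "(2::nat) ^ b * 2 ^ (k * b) < 2 ^ w"
  proof -
    have "b + k * b \<le> 2 * m"
      using b_le(1,2) by linarith
    then show "(2::nat) ^ b < 2 ^ w" "(2::nat) ^ b * 2 ^ (k * b) < 2 ^ w"
      using exp_less[of b] exp_less[of "b + k * b"] m_le by (simp_all add: power_add)
  qed
  \<comment> \<open>\<open>init_state\<close> reduces cells modulo \<open>2 ^ w\<close>. All cells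
    of both encodings fit into a word, so this reduction loses nothing.\<close>
  have xs_small: "\<forall>x\<in>set xs. x < 2 ^ w"
  proof -
    have "z < 2 ^ w" if jz: "j < k" "zs \<in> set (Zs ! j)" "z \<in> set (set_cells zs)" for j zs z
    proof -
      obtain ys where ys: "ys \<in> set (concat (I ! j))" "zs = map val ys"
        using jz(1,2) len_I by (auto simp: Zs_def)
      then have "val u < 2 ^ b" if "u \<in> set ys" for u
        using sets[OF \<open>j < k\<close>] that val_less[of u] by metis
      moreover have "length zs \<le> 2 ^ b"
        using Zs[OF that(1)] that(2) by simp
      ultimately have "z \<le> 2 ^ b"
        using that(3) ys(2) by (auto simp: set_cells_def less_imp_le)
      then show ?thesis
        using exps(1) by (rule le_less_trans)
    qed
    then show ?thesis
      using small by (auto simp: xs_eq in_cells_def)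
  qed
  have out_small: "\<forall>x\<in>set out. x < 2 ^ w"
  proof -
    have "z < 2 ^ w" if "j < k" "zs \<in> set (Zs ! j)" "z \<in> set (new_cells j zs)" for j zs z
    proof -
      have "length (concat (map (gen j) zs)) \<le> 2 ^ b * 2 ^ (k * b)"
        using length_new_cells[of zs j] Zs[OF that(1)] that(2) by (simp add: new_cells_def set_cells_def)
      moreover have "y < 2 ^ b'" if "y \<in> set (concat (map (gen j) zs))" for y
        using that enc_less[OF _ \<open>j < k\<close>] by (auto simp: gen_def)
      ultimately have "z \<le> 2 ^ b * 2 ^ (k * b) \<or> z < 2 ^ b'"
        using that(3) unfolding new_cells_def set_cells_def by auto
      then show ?thesis
        using exps(2) exp_less[of b', OF order_refl] by linarith
    qed
    then show ?thesis
      using small by (auto simp: out_eq out_cells_def)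
  qed
  define \<mu>0 where "\<mu>0 = (\<lambda>a. if a < length xs then xs ! a else 0)"
  define \<mu>1 where "\<mu>1 = (\<lambda>a. if a < length out then out ! a else 0)"
  have init: "init_state w xs = \<lparr>regs = (\<lambda>_. 0), mem = \<mu>0, outs = []\<rparr>"
    "init_state w out = \<lparr>regs = (\<lambda>_. 0), mem = \<mu>1, outs = []\<rparr>"
    using xs_small out_small by (auto simp: init_state_def \<mu>0_def \<mu>1_def fun_eq_iff)
  have repr0: "repr xs [] \<mu>0"
    using len_xs by (simp add: repr_def \<mu>0_def)
  have "wp w (transform k p fin) (\<lambda>t \<rho>' \<mu>'. t \<le> transform_time \<and> \<rho>' = (\<lambda>_. 0) \<and> \<mu>' = \<mu>1) (\<lambda>_. 0) \<mu>0"
  proof -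
    let ?T = "27 + (7 + (families_time + (6 * (D + length out) + 3 + 24)))"
    have clear: "wp w (seqs [clear_regs]) (\<lambda>u \<rho>' \<mu>'. u \<le> 24 \<and> \<rho>' = (\<lambda>_. 0) \<and> \<mu>' = \<mu>) \<rho> \<mu>"
      if "\<forall>r. r \<notin> {2..<26} \<longrightarrow> \<rho> r = 0" for \<rho> \<mu>
    proof -
      have rs: "[2..<26] \<noteq> ([] :: nat list)" "length [2..<26 :: nat] = 24"
        by (simp_all only: upt_eq_Nil_conv length_upt) simp_all
      have eq: "(\<lambda>r. if r \<in> set [2..<26] then 0 else \<rho> r) = (\<lambda>_. 0)"
        using that by (simp only: set_upt) auto
      show ?thesis
        unfolding clear_regs_def seqs.simps(2)
        using wp_clear[OF rs(1), of \<mu> \<rho>] by (simp only: eq rs(2) conj_ac)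
    qed
    have move: "wp w (seqs [move_down, clear_regs])
        (\<lambda>u \<rho>' \<mu>'. u \<le> 6 * (D + length out) + 3 + 24 \<and> \<rho>' = (\<lambda>_. 0) \<and> \<mu>' = \<mu>1) \<rho> \<mu>"
      if c: "const_regs \<rho>" and r: "repr xs out \<mu>" "\<rho> rQ = D + length out"
        and z: "\<forall>r. r \<notin> {2..<26} \<longrightarrow> \<rho> r = 0" for \<rho> \<mu>
    proof (rule wp_Cons, simp, rule wp_mono[OF wp_move_down[OF c r room(1)]])
      fix t :: nat and \<rho>' \<mu>' assume *: "t \<le> 6 * (D + length out) + 3 \<and>
        \<mu>' = (\<lambda>a. if a < length out then out ! a else 0) \<and> (\<forall>r. r \<notin> {rCnt, rX, rY, rV} \<longrightarrow> \<rho>' r = \<rho> r)"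
      show "wp w (seqs [clear_regs]) (\<lambda>u \<rho>' \<mu>'. t + u \<le> 6 * (D + length out) + 3 + 24 \<and>
          \<rho>' = (\<lambda>_. 0) \<and> \<mu>' = \<mu>1) \<rho>' \<mu>'"
        by (rule wp_mono[OF clear]) (use * z in \<open>auto simp: \<mu>1_def\<close>)
    qed
    have fams: "wp w (seqs [do_families k p fin, move_down, clear_regs])
        (\<lambda>u \<rho>' \<mu>'. u \<le> families_time + (6 * (D + length out) + 3 + 24) \<and> \<rho>' = (\<lambda>_. 0) \<and> \<mu>' = \<mu>1) \<rho> \<mu>"
      if c: "const_regs \<rho>" "\<rho> rP = 3" "\<rho> rM = 0" "\<rho> rJ = 1"
        and r: "repr xs [n, g, b'] \<mu>" "\<rho> rQ = D + 3"
        and z: "\<forall>r. r \<notin> {2..<26} \<longrightarrow> \<rho> r = 0" for \<rho> \<mu>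
    proof (rule wp_Cons, simp, rule wp_mono[OF wp_do_families[OF Zs xs_eq c(2,1,3,4) r]])
      fix t :: nat and \<rho>' \<mu>' assume "t \<le> families_time \<and> repr xs ([n, g, b'] @ out_cells Zs k) \<mu>' \<and>
        \<rho>' rQ = D + length ([n, g, b'] @ out_cells Zs k) \<and>
        (\<forall>r. r \<notin> insert rM (insert rJ work_regs) \<longrightarrow> \<rho>' r = \<rho> r)"
      then have *: "t \<le> families_time" "repr xs out \<mu>'" "\<rho>' rQ = D + length out"
        "\<forall>r. r \<notin> insert rM (insert rJ work_regs) \<longrightarrow> \<rho>' r = \<rho> r"
        unfolding out_eq by blast+
      have "const_regs \<rho>'"
        by (rule const_regs_cong[OF c(1)]) (use *(4) in auto)
      moreover have "\<forall>r. r \<notin> {2..<26} \<longrightarrow> \<rho>' r = 0"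
        using z *(4) by auto
      ultimately have "wp w (seqs [move_down, clear_regs])
          (\<lambda>u \<rho>' \<mu>'. u \<le> 6 * (D + length out) + 3 + 24 \<and> \<rho>' = (\<lambda>_. 0) \<and> \<mu>' = \<mu>1) \<rho>' \<mu>'"
        using move *(2,3) by blast
      then show "wp w (seqs [move_down, clear_regs])
          (\<lambda>u \<rho>' \<mu>'. t + u \<le> families_time + (6 * (D + length out) + 3 + 24) \<and> \<rho>' = (\<lambda>_. 0) \<and> \<mu>' = \<mu>1) \<rho>' \<mu>'"
        by (rule wp_mono) (use *(1) in simp)
    qed
    have header: "wp w (seqs [write_header, do_families k p fin, move_down, clear_regs])
        (\<lambda>u \<rho>' \<mu>'. u \<le> 7 + (families_time + (6 * (D + length out) + 3 + 24)) \<and> \<rho>' = (\<lambda>_. 0) \<and> \<mu>' = \<mu>1) \<rho> \<mu>0"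
      if c: "const_regs \<rho>" "\<rho> rP = 3" "\<rho> rM = 0" "\<rho> rJ = 1"
        and z: "\<forall>r. r \<notin> {2..<26} \<longrightarrow> \<rho> r = 0" for \<rho>
    proof (rule wp_Cons, simp, rule wp_mono[OF wp_write_header[OF c(1) repr0 room(2)]])
      fix t :: nat and \<rho>' \<mu>' assume *: "t \<le> 7 \<and> repr xs [n, g, b'] \<mu>' \<and> \<rho>' rQ = D + 3 \<and> (\<forall>r. r \<noteq> rQ \<longrightarrow> \<rho>' r = \<rho> r)"
      have "const_regs \<rho>'"
        by (rule const_regs_cong[OF c(1)]) (use * in auto)
      moreover have "\<rho>' rP = 3" "\<rho>' rM = 0" "\<rho>' rJ = 1" "\<forall>r. r \<notin> {2..<26} \<longrightarrow> \<rho>' r = 0"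
        using * c z by auto
      ultimately have "wp w (seqs [do_families k p fin, move_down, clear_regs])
          (\<lambda>u \<rho>' \<mu>'. u \<le> families_time + (6 * (D + length out) + 3 + 24) \<and> \<rho>' = (\<lambda>_. 0) \<and> \<mu>' = \<mu>1) \<rho>' \<mu>'"
        using fams * by blast
      then show "wp w (seqs [do_families k p fin, move_down, clear_regs])
          (\<lambda>u \<rho>' \<mu>'. t + u \<le> 7 + (families_time + (6 * (D + length out) + 3 + 24)) \<and> \<rho>' = (\<lambda>_. 0) \<and> \<mu>' = \<mu>1) \<rho>' \<mu>'"
        by (rule wp_mono) (use * in simp)
    qed
    have "\<mu>0 0 = n" "\<mu>0 1 = g" "\<mu>0 2 = b"
      by (simp_all add: \<mu>0_def xs_eq numeral_2_eq_2)
    note regs = wp_setup_regs[OF this]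
    have "wp w (transform k p fin) (\<lambda>u \<rho>' \<mu>'. u \<le> ?T \<and> \<rho>' = (\<lambda>_. 0) \<and> \<mu>' = \<mu>1) (\<lambda>_. 0) \<mu>0"
      unfolding transform_def
    proof (rule wp_Cons, simp, rule wp_mono[OF regs])
      fix t :: nat and \<rho>' \<mu>' assume *: "t \<le> 27 \<and> \<mu>' = \<mu>0 \<and> const_regs \<rho>' \<and> \<rho>' rP = 3 \<and> \<rho>' rJ = 1 \<and> \<rho>' rM = 0 \<and>
        (\<forall>r. r \<notin> {2..<26} \<longrightarrow> \<rho>' r = 0)"
      then have "wp w (seqs [write_header, do_families k p fin, move_down, clear_regs])
          (\<lambda>u \<rho>' \<mu>'. u \<le> 7 + (families_time + (6 * (D + length out) + 3 + 24)) \<and> \<rho>' = (\<lambda>_. 0) \<and> \<mu>' = \<mu>1) \<rho>' \<mu>'"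
        using header[of \<rho>'] by blast
      then show "wp w (seqs [write_header, do_families k p fin, move_down, clear_regs])
          (\<lambda>u \<rho>' \<mu>'. t + u \<le> ?T \<and> \<rho>' = (\<lambda>_. 0) \<and> \<mu>' = \<mu>1) \<rho>' \<mu>'"
        by (rule wp_mono) (use * in simp)
    qed
    then show ?thesis
      by (rule wp_mono) (use time_bound[OF len_out] in linarith)
  qed
  then show ?thesis
    unfolding wp_def xs_def[symmetric] out_def[symmetric] init by blast
qed

end

section \<open>Transfer of running times\<close>

lemma card_factored_vectors: "finite (factored_vectors g b) \<and> card (factored_vectors g b) = 2 ^ (2 ^ b * g)"
proof -
  have W: "{u. set u \<subseteq> (UNIV :: bool set) \<and> length u = b} = {u. length u = b}"
    by auto
  have fin: "finite {u :: bitvec. length u = b}" and card: "card {u :: bitvec. length u = b} = 2 ^ b"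
    using finite_lists_length_eq[of "UNIV :: bool set" b] card_lists_length_eq[of "UNIV :: bool set" b]
    by (simp_all add: W)
  have "factored_vectors g b = {v. set v \<subseteq> Pow {u. length u = b} \<and> length v = g}"
    by (auto simp: factored_vectors_def)
  then show ?thesis
    using finite_lists_length_eq[of "Pow {u :: bitvec. length u = b}" g] fin
      card_lists_length_eq[of "Pow {u :: bitvec. length u = b}" g]
    by (simp add: card_Pow card power_mult)
qed

text \<open>A family consists of \<open>n\<close> distinct factored vectors. The existence of a
  source instance thus bounds \<open>n\<close>, which is what the adversary argument needs.\<close>

lemma instance_size:
  assumes "factored_instance k n g b V" "k > 0"
  shows "n \<le> 2 ^ (2 ^ b * g)"
proof -
  have "V ! 0 \<in> set V"
    using assms by (auto simp: factored_instance_def)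
  then have "V ! 0 \<subseteq> factored_vectors g b" "card (V ! 0) = n"
    using assms by (auto simp: factored_instance_def)
  then show ?thesis
    using card_mono[of "factored_vectors g b" "V ! 0"] card_factored_vectors[of g b] by simp
qed

text \<open>The word length must suffice for every \<open>n\<close>, not only eventually. The
  finitely many exceptions go into the constant, since \<open>log 2 (n + 2) \<ge> 1\<close>.\<close>

lemma smallo_log_bound:
  fixes h :: "nat \<Rightarrow> nat"
  assumes "(\<lambda>n. real (h n)) \<in> o(\<lambda>n. log 2 (real n))"
  obtains c :: nat where "\<And>n. real (h n) \<le> real c * log 2 (real n + 2)"
proof -
  have "eventually (\<lambda>n. norm (real (h n)) \<le> 1 * norm (log 2 (real n))) at_top"
    using landau_o.smallD[OF assms, of 1] by simp
  then obtain N where N: "\<And>n. n \<ge> N \<Longrightarrow> real (h n) \<le> \<bar>log 2 (real n)\<bar>"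
    by (auto simp: eventually_at_top_linorder)
  define c where "c = Suc (\<Sum>n<Suc N. h n)"
  have "1 \<le> c"
    by (simp add: c_def)
  have "real (h n) \<le> real c * log 2 (real n + 2)" for n
  proof -
    have L: "1 \<le> log 2 (real n + 2)"
      by (simp add: le_log_iff)
    show ?thesis
    proof (cases "n < Suc N")
      case True
      then have "h n \<le> c"
        unfolding c_def by (intro le_SucI member_le_sum) auto
      then have "real (h n) * 1 \<le> real c * log 2 (real n + 2)"
        using L by (intro mult_mono) auto
      then show ?thesis by simp
    next
      case False
      then have n: "n \<ge> N" "n \<ge> 1" by auto
      have "real (h n) \<le> log 2 (real n)"
        using N[OF n(1)] n(2) by (simp add: zero_le_log_cancel_iff)
      also have "\<dots> \<le> 1 * log 2 (real n + 2)"
        using n(2) by simp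
      also have "\<dots> \<le> real c * log 2 (real n + 2)"
        using L \<open>1 \<le> c\<close> by (intro mult_right_mono) auto
      finally show ?thesis .
    qed
  qed
  then show ?thesis
    by (rule that)
qed

lemma log_div_log_log_bigo: "(\<lambda>n. log 2 (real n) / log 2 (log 2 (real n))) \<in> O(\<lambda>n. log 2 (real n))"
proof (rule bigoI[where c = 1])
  have "eventually (\<lambda>n::nat. n \<ge> 16) at_top"
    by (rule eventually_ge_at_top)
  then show "eventually (\<lambda>n. norm (log 2 (real n) / log 2 (log 2 (real n))) \<le> 1 * norm (log 2 (real n))) at_top"
  proof eventually_elim
    case (elim n)
    have "4 \<le> log 2 (real n)"
      using elim by (simp add: le_log_iff)
    moreover from this have "1 \<le> log 2 (log 2 (real n))"
      by (simp add: le_log_iff)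
    ultimately show ?case
      by (simp add: divide_le_eq mult_le_cancel_left1)
  qed
qed

lemma const_smallo_log: "(\<lambda>n. c) \<in> o(\<lambda>n::nat. log 2 (real n))" for c :: real
proof (rule landau_o.smallI)
  fix d :: real assume d: "d > 0"
  have "eventually (\<lambda>n. max 1 (2 powr (\<bar>c\<bar> / d)) \<le> real n) at_top"
    using filterlim_real_sequentially unfolding filterlim_at_top by blast
  then show "eventually (\<lambda>n. norm c \<le> d * norm (log 2 (real n))) at_top"
  proof eventually_elim
    case (elim n)
    then have "\<bar>c\<bar> / d \<le> log 2 (real n)"
      by (simp add: le_log_iff)
    then show ?case
      using d elim by (simp add: divide_le_eq mult.commute zero_le_log_cancel_iff)
  qed
qed

text \<open>Solvability is assumed for all parameters, so the solver may be taken for the longer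
  words \<open>B\<close>. Its own reading time at this length dominates the time of the reduction,
  whence the class \<open>O(T)\<close> is preserved without a logarithmic factor.\<close>

theorem factored_solvable_transfer:
  assumes k: "k \<ge> 2" and f: "computed_by f p" "extendable k f"
    and f': "tests_equality f' e" "finishes fin e" "separates k f' q"
    and solvable: "factored_solvable k f' (O(T))"
  shows "factored_solvable k f (O(T))"
  unfolding factored_solvable_def
proof (intro allI impI)
  fix g b :: "nat \<Rightarrow> nat"
  assume g: "(\<lambda>n. real (g n)) \<in> o(\<lambda>n. log 2 (real n) / log 2 (log 2 (real n)))"
    and b: "(\<lambda>n. real (b n)) \<in> o(\<lambda>n. log 2 (real n))"
  have red: "reduction k f f' p e" 
    using k f f' by unfold_locales
  define B where "B = (\<lambda>n. 2 * (k * b n + 1) * (k - 1) + g n + 2)"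
  have B_eq: "reduction.b' k (g n) (b n) = B n" for n
    using reduction.b'_def[OF red] reduction.m_def[OF red] by (simp add: B_def)
  have g_log: "(\<lambda>n. real (g n)) \<in> o(\<lambda>n. log 2 (real n))"
    by (rule landau_o.small_big_trans[OF g log_div_log_log_bigo])
  have "(\<lambda>n. real (2 * k * (k - 1)) * real (b n) + real (g n) + real (2 * (k - 1) + 2)) \<in> o(\<lambda>n. log 2 (real n))"
    using b g_log const_smallo_log by (intro sum_in_smallo) (auto simp: landau_o.small.cmult_in_iff')
  also have "(\<lambda>n. real (2 * k * (k - 1)) * real (b n) + real (g n) + real (2 * (k - 1) + 2)) = (\<lambda>n. real (B n))"
    unfolding B_def by (auto simp: fun_eq_iff algebra_simps simp flip: of_nat_add of_nat_mult of_nat_Suc)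
  finally have B_small: "(\<lambda>n. real (B n)) \<in> o(\<lambda>n. log 2 (real n))" .
  obtain P t' where t': "(\<lambda>n. real (t' n)) \<in> O(T)" and P: "solves_factored k f' g B P t'"
    using solvable g B_small unfolding factored_solvable_def by blast
  obtain c' :: nat where c': "\<And>n V I w. factored_instance k n (g n) (B n) V \<Longrightarrow> list_all2 lists_fvecs I V \<Longrightarrow>
      real c' * log 2 (real n + 2) \<le> real w \<Longrightarrow>
      computes_within w P (encode_instance n (g n) (B n) I) (factored_count (f' (B n)) (g n) V) (t' n)"
    using P unfolding solves_factored_def by blast
  obtain c3 :: nat where c3: "\<And>n. real (B n) \<le> real c3 * log 2 (real n + 2)"
    using smallo_log_bound[OF B_small] by blast
  have red_bounds: "b n + k * b n \<le> B n - 2" "g n + b n \<le> B n - 2" "b n + k * b n + g n \<le> B n - 2" for n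
  proof -
    define Q where "Q = 2 * (k * b n + 1) * (k - 1)"
    define kb where "kb = k * b n"
    have "1 * b n \<le> kb"
      unfolding kb_def using k by (intro mult_le_mono1) simp
    moreover have "2 * (kb + 1) * 1 \<le> Q"
      unfolding Q_def kb_def using k by (intro mult_le_mono2) simp
    moreover have "B n - 2 = Q + g n"
      by (simp add: B_def Q_def)
    ultimately show "b n + k * b n \<le> B n - 2" "g n + b n \<le> B n - 2" "b n + k * b n + g n \<le> B n - 2"
      by (simp_all add: kb_def[symmetric])
  qed
  have g_le: "g n \<le> 2 ^ g n" for n
    using less_exp[of "g n"] by simp
  \<comment> \<open>The summand \<open>g n\<close> of \<open>B n\<close> absorbs the factor
    \<open>g n\<close> through \<open>g n \<le> 2 ^ g n\<close>.\<close>
  have load: "g n * (2 ^ b n * 2 ^ (k * b n)) \<le> 2 ^ (B n - 2)" for n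
  proof -
    have "g n * (2 ^ b n * 2 ^ (k * b n)) \<le> 2 ^ g n * (2 ^ b n * 2 ^ (k * b n))"
      using g_le by (rule mult_le_mono1)
    also have "\<dots> = 2 ^ (b n + k * b n + g n)"
      by (simp add: power_add)
    also have "\<dots> \<le> 2 ^ (B n - 2)"
      using red_bounds(3) by (intro power_increasing) auto
    finally show ?thesis .
  qed
  \<comment> \<open>\<open>2 * c3\<close> pays for \<open>2 ^ (2 * B n)\<close>, \<open>k\<close>
    for the factor \<open>k < 2 ^ k\<close>, and 10 for the factors \<open>n + 2\<close> and
    \<open>512 = 2 ^ 9\<close>.\<close>
  define c2 where "c2 = 2 * c3 + k + 10"
  have word: "B n < w \<and> n < 2 ^ w \<and> 3 * (k * (n * g n) * (1 + 2 ^ b n * 2 ^ (k * b n)) + 3) < 2 ^ w"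
    if w: "real c2 * log 2 (real n + 2) \<le> real w" for n w
  proof -
    define L where "L = log 2 (real n + 2)"
    have L: "1 \<le> L" "real n + 2 = 2 powr L"
      by (simp_all add: L_def le_log_iff)
    have c2L: "real c2 * L = 2 * (real c3 * L) + real k * L + 10 * L"
      by (simp add: c2_def algebra_simps)
    have "real k * 1 \<le> real k * L"
      using L(1) by (intro mult_left_mono) auto
    then have sum_le: "2 * real (B n) + real k + L + 9 \<le> real w"
      using w c3[of n] L(1) c2L unfolding L_def[symmetric] by linarith
    have "real (2 * B n + k + 9) + L \<le> real w"
      using sum_le by simp
    then have "2 powr (real (2 * B n + k + 9) + L) \<le> 2 powr real w"
      by simp
    then have "2 ^ (2 * B n + k + 9) * (real n + 2) \<le> 2 ^ w"
      using L(2) by (simp add: powr_add powr_realpow[symmetric] del: of_nat_add)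
    then have "real (2 ^ (2 * B n + k + 9) * (n + 2)) \<le> real (2 ^ w)"
      by (simp add: distrib_left add.commute)
    then have big: "2 ^ (2 * B n + k + 9) * (n + 2) \<le> 2 ^ w"
      by (simp only: of_nat_le_iff)
    define X :: nat where "X = 2 ^ (2 * B n)"
    have X: "1 \<le> X" by (simp add: X_def)
    have gX: "g n * (1 + 2 ^ b n * 2 ^ (k * b n)) \<le> 2 * X"
    proof -
      have "g n * (1 + 2 ^ b n * 2 ^ (k * b n)) \<le> g n * (2 * (2 ^ b n * 2 ^ (k * b n)))"
        by (intro mult_le_mono2) simp
      also have "\<dots> \<le> 2 * 2 ^ (B n - 2)"
        using load[of n] by simp
      also have "\<dots> \<le> 2 * X"
        unfolding X_def by (intro mult_le_mono2 power_increasing) auto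
      finally show ?thesis .
    qed
    have kk: "k < 2 ^ k" by (rule less_exp)
    have "k * (n * g n) * (1 + 2 ^ b n * 2 ^ (k * b n)) = k * n * (g n * (1 + 2 ^ b n * 2 ^ (k * b n)))"
      by (simp only: mult.assoc)
    also have "\<dots> \<le> 2 ^ k * n * (2 * X)"
      using kk by (intro mult_le_mono[OF _ gX] mult_le_mono1) simp
    finally have "3 * (k * (n * g n) * (1 + 2 ^ b n * 2 ^ (k * b n)) + 3) \<le> 3 * (2 ^ k * n * (2 * X) + 3)"
      by simp
    also have "\<dots> < 512 * (2 ^ k * X * (n + 2))"
    proof -
      define Y Z where "Y = 2 ^ k * X" and "Z = Y * n"
      have eqs: "2 ^ k * n * (2 * X) = 2 * Z" "2 ^ k * X * (n + 2) = Z + 2 * Y"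
        by (simp_all add: Y_def Z_def algebra_simps)
      have "1 \<le> Y"
        using X by (simp add: Y_def)
      then show ?thesis unfolding eqs by simp
    qed
    also have "512 * (2 ^ k * X * (n + 2)) = 2 ^ (2 * B n + k + 9) * (n + 2)"
      by (simp add: X_def power_add)
    finally have size: "3 * (k * (n * g n) * (1 + 2 ^ b n * 2 ^ (k * b n)) + 3) < 2 ^ w"
      using big by simp
    have "1 * (n + 2) \<le> 2 ^ (2 * B n + k + 9) * (n + 2)"
      by (intro mult_le_mono1) simp
    from order_trans[OF this big] have "n < 2 ^ w"
      by simp
    moreover have "B n < w"
      using sum_le L(1) by linarith
    ultimately show ?thesis
      using size by blast
  qed
  define K where "K = 4 * k * k + 56 * k + 110"
  \<comment> \<open>Without an instance of size \<open>n\<close> the solver need not take any time,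
    so the cost of the reduction could not be charged to it. The default 0 is then a valid bound, as
    there is nothing to solve.\<close>
  define t where "t = (\<lambda>n. if \<exists>V. factored_instance k n (g n) (b n) V
    then K * (n * g n * (2 ^ b n * 2 ^ (k * b n)) + 1) + t' n else 0)"
  have "solves_factored k f g b (Seq (transform k p fin) P) t"
    unfolding solves_factored_def
  proof (rule exI[of _ "c' + c2"], intro allI impI, elim conjE)
    fix n V I w
    assume V: "factored_instance k n (g n) (b n) V" and I: "list_all2 lists_fvecs I V"
      and w: "real (c' + c2) * log 2 (real n + 2) \<le> real w"
    have "0 \<le> log 2 (real n + 2)" by simp
    then have "0 \<le> real c' * log 2 (real n + 2)" "0 \<le> real c2 * log 2 (real n + 2)"
      by simp_all
    then have w': "real c' * log 2 (real n + 2) \<le> real w" "real c2 * log 2 (real n + 2) \<le> real w"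
      using w unfolding of_nat_add distrib_right by linarith+
    interpret ram_reduction k f f' p e "g n" "b n" fin w n
      using red f'(2) word[OF w'(2)] B_eq[of n] by (simp add: ram_reduction_def ram_reduction_axioms_def)
    obtain t1 where t1: "t1 \<le> transform_time" "exec w (transform k p fin)
        (init_state w (encode_instance n (g n) (b n) I)) t1 (init_state w (encode_instance n (g n) b' (new_lists I)))"
      using transform_correct[OF V I] by blast
    have "computes_within w P (encode_instance n (g n) b' (new_lists I)) (factored_count (f' b') (g n) (new_family V)) (t' n)"
      using c'[of n "new_family V" "new_lists I" w] new_family_instance[OF V] new_lists_represent[OF V I] w'(1) B_eq[of n]
      by simp
    then obtain t2 s where t2: "exec w P (init_state w (encode_instance n (g n) b' (new_lists I))) t2 s" "t2 \<le> t' n"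
      "horner_sum (\<lambda>x. x) (2 ^ w) (outs s) = factored_count (f (b n)) (g n) V"
      unfolding computes_within_def factored_count_new_family[OF V] by blast
    have "t1 + t2 \<le> t n"
      using t1(1) t2(2) V unfolding t_def K_def transform_time_def by auto
    then show "computes_within w (Seq (transform k p fin) P) (encode_instance n (g n) (b n) I)
        (factored_count (f (b n)) (g n) V) (t n)"
      unfolding computes_within_def using exec.Seq[OF t1(2) t2(1)] t2(3) by blast
  qed
  moreover have "(\<lambda>n. real (t n)) \<in> O(T)"
  proof (rule landau_o.big_trans[OF _ t'], rule bigoI[where c = "real (2 * K + 1)"])
    have "t n \<le> (2 * K + 1) * t' n" if n: "n \<ge> 2" for n
    proof (cases "\<exists>V. factored_instance k n (g n) (b n) V")
      case True
      then have size: "n \<le> 2 ^ (2 ^ b n * g n)"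
        using instance_size k by fastforce
      then have g1: "g n \<ge> 1"
        using n by (cases "g n = 0") auto
      have "2 ^ b n * g n \<le> 2 ^ b n * 2 ^ g n"
        using g_le by (rule mult_le_mono2)
      also have "\<dots> = 2 ^ (g n + b n)"
        by (simp add: power_add)
      also have "\<dots> \<le> 2 ^ (B n - 2)"
        using red_bounds(2) by (intro power_increasing) auto
      finally have "(2::nat) ^ (2 ^ b n * g n) \<le> 2 ^ 2 ^ (B n - 2)"
        by (intro power_increasing) auto
      with size have n_le: "n \<le> 2 ^ 2 ^ (B n - 2)"
        by linarith
      \<comment> \<open>The time bound does not depend on the word length, so one admissible word
        length is enough for the lower bound.\<close>
      obtain w :: nat where w: "real c' * log 2 (real n + 2) \<le> real w"
        using real_arch_simple by blast
      have lower: "n * 2 ^ (B n - 2) \<le> t' n"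
      proof (rule reads_lower_bound[OF k f'(3) g1 _ n_le])
        show "2 \<le> B n" by (simp add: B_def)
        show "computes_within w P (encode_instance n (g n) (B n) I) (factored_count (f' (B n)) (g n) V) (t' n)"
          if "factored_instance k n (g n) (B n) V" "list_all2 lists_fvecs I V" for V I
          using c'[OF that w] .
      qed
      have "n * g n * (2 ^ b n * 2 ^ (k * b n)) \<le> n * 2 ^ (B n - 2)"
        using load[of n] by (simp add: mult.assoc)
      with lower have 1: "n * g n * (2 ^ b n * 2 ^ (k * b n)) \<le> t' n"
        by linarith
      have "1 * 1 \<le> n * 2 ^ (B n - 2)"
        using n by (intro mult_le_mono) auto
      with lower have "1 \<le> t' n"
        by linarith
      with 1 have "K * (n * g n * (2 ^ b n * 2 ^ (k * b n)) + 1) \<le> K * (t' n + t' n)"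
        by (intro mult_le_mono2 add_mono)
      then show ?thesis
        using True unfolding t_def by (simp add: algebra_simps)
    next
      case False
      then have "t n = 0"
        unfolding t_def by (simp only: if_False)
      then show ?thesis by simp
    qed
    then have "real (t n) \<le> real (2 * K + 1) * real (t' n)" if "n \<ge> 2" for n
      using that by (metis of_nat_le_iff of_nat_mult)
    then show "eventually (\<lambda>n. norm (real (t n)) \<le> real (2 * K + 1) * norm (real (t' n))) at_top"
      by (intro eventually_mono[OF eventually_ge_at_top[of "2::nat"]]) simp
  qed
  ultimately show "\<exists>P t. (\<lambda>n. real (t n)) \<in> O(T) \<and> solves_factored k f g b P t"
    by blast
qed

lemma bigo_subset_soft_O: "O(T) \<subseteq> soft_O T"
proof -
  have "O(T) = O(\<lambda>n. T n * log 2 (real n) ^ 0)"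
    by simp
  then show ?thesis
    unfolding soft_O_def by blast
qed

lemma factored_solvable_mono: "factored_solvable k f C \<Longrightarrow> C \<subseteq> C' \<Longrightarrow> factored_solvable k f C'"
  unfolding factored_solvable_def by (meson subsetD)

theorem theorem1p8:
  fixes k :: nat and T :: "nat \<Rightarrow> real"
  assumes "k \<ge> 2"
    and "factored_solvable k ov_pred (O(T)) \<or> factored_solvable k sum_pred (O(T)) \<or>
         factored_solvable k xor_pred (O(T))"
  shows "factored_solvable k ov_pred (soft_O T) \<and> factored_solvable k sum_pred (soft_O T) \<and>
         factored_solvable k xor_pred (soft_O T)"
proof -
  \<comment> \<open>All nine reductions at once: the source enters through
    \<open>computed_by\<close> and \<open>extendable\<close>, the target through
    \<open>tests_equality\<close>, \<open>finishes\<close> and \<open>separates\<close>.\<close>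
  have "factored_solvable k f (soft_O T)" if f: "computed_by f p" "extendable k f" for f p
    using assms(2)
      factored_solvable_transfer[OF assms(1) f tests_equality_ov finishes_ov separates_ov[OF assms(1)], of T]
      factored_solvable_transfer[OF assms(1) f tests_equality_sum finishes_sum separates_sum[OF assms(1)], of T]
      factored_solvable_transfer[OF assms(1) f tests_equality_xor finishes_xor separates_xor[OF assms(1)], of T]
      factored_solvable_mono[OF _ bigo_subset_soft_O, of k f T]
    by blast
  then show ?thesis
    using computed_by_ov computed_by_sum computed_by_xor extendable_ov[OF assms(1)]
      extendable_sum[OF assms(1)] extendable_xor[OF assms(1)]
    by blast
qed

end
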